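(* Let $s,r$ be coprime positive integers and grade the free algebra $\mathbb{C}\langle x,y\rangle$ by $\deg x=s$, $\deg y=r$. Let $P\in\mathbb{C}\langle x,y\rangle$ be homogeneous of degree $d\geq 1$ for this grading, and suppose that its abelianization $P_{ab}\in\mathbb{C}[x,y]$ is square-free (in particular nonzero). Let $A=\mathbb{C}\langle x,y\rangle/\langle P\rangle$. Then $B_2(A)$ is isomorphic, as a graded complex vector space, to $\Omega^2(A_{ab})$, where $A_{ab}=\mathbb{C}[x,y]/(P_{ab})$. In particular, the Hilbert-Poincaré series of $B_2(A)$ is $$HP(B_2(A))(t)=\frac{(t^{s}-t^{d})(t^{r}-t^{d})}{(1-t^{s})(1-t^{r})}.$$
   Context: For an associative algebra $A$ put $L_1(A)=A$, $L_{i+1}(A)=[A,L_i(A)]$ (the linear span of the commutators $[a,b]=ab-ba$ with $a\in A$, $b\in L_i(A)$) and $B_i(A)=L_i(A)/L_{i+1}(A)$. The abelianization $A_{ab}$ is the maximal commutative quotient of $A$, and for $P\in A$ its abelianization $P_{ab}$ is its image in $A_{ab}$; for $A=\mathbb{C}\langle x,y\rangle$, $A_{ab}=\mathbb{C}[x,y]$. $\langle P\rangle$ is the two-sided ideal generated by $P$. For a commutative $\mathbb{C}$-algebra $C$, $\Omega^2(C)$ is the space of (Kähler) differential 2-forms of $C$ over $\mathbb{C}$. All spaces are graded by the grading induced from $\deg x=s$, $\deg y=r$ (with $\deg dx=s$, $\deg dy=r$), and the Hilbert-Poincaré series of a graded space $V=\bigoplus_m V[m]$ is $HP(V)(t)=\sum_m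 \dim V[m]\,t^m$. *)

theory Defs
  imports
    "HOL-Library.Poly_Mapping"
    "HOL-Computational_Algebra.Squarefree"
    "HOL-Computational_Algebra.Formal_Power_Series"
    "HOL-Algebra.QuotRing"
    "Jordan_Normal_Form.VS_Connect"
begin

text \<open>
  Algebras over a commutative ring \<open>K\<close> are represented by \<^typ>\<open>('k, 'a) module\<close> records, which
  carry a ring structure together with a scalar multiplication. When such a record is used merely
  as a module, its fields \<open>mult\<close> and \<open>one\<close> are irrelevant. A grading is a family
  \<open>G :: nat \<Rightarrow> 'a set\<close> of homogeneous components.
\<close>

text \<open>The ring part agrees with \<^term>\<open>M Quot N\<close>.\<close>

definition quot_module :: "('k, 'a, 'm) module_scheme \<Rightarrow> 'a set \<Rightarrow> ('k, 'a set) module" where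
  "quot_module M N =
     \<lparr>carrier = a_rcosets\<^bsub>M\<^esub> N, monoid.mult = rcoset_mult M N, one = N +>\<^bsub>M\<^esub> \<one>\<^bsub>M\<^esub>,
      ring.zero = N, add = set_add M,
      module.smult = (\<lambda>c X. \<Union>x\<in>X. N +>\<^bsub>M\<^esub> (c \<odot>\<^bsub>M\<^esub> x))\<rparr>"

definition quot_grading ::
    "('k, 'a, 'm) module_scheme \<Rightarrow> 'a set \<Rightarrow> (nat \<Rightarrow> 'a set) \<Rightarrow> nat \<Rightarrow> 'a set set" where
  "quot_grading M N G m = (\<lambda>x. N +>\<^bsub>M\<^esub> x) ` G m"

definition graded_linear_iso ::
    "('k, 'l) ring_scheme \<Rightarrow> ('k, 'a, 'm) module_scheme \<Rightarrow> (nat \<Rightarrow> 'a set) \<Rightarrow>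
     ('k, 'b, 'n) module_scheme \<Rightarrow> (nat \<Rightarrow> 'b set) \<Rightarrow> ('a \<Rightarrow> 'b) \<Rightarrow> bool" where
  "graded_linear_iso K V G W H f \<longleftrightarrow>
     linear_map K V W f \<and> bij_betw f (carrier V) (carrier W) \<and> (\<forall>m. f ` G m = H m)"

definition hilbert_series ::
    "('k, 'l) ring_scheme \<Rightarrow> ('k, 'a, 'm) module_scheme \<Rightarrow> (nat \<Rightarrow> 'a set) \<Rightarrow> rat fps" where
  "hilbert_series K V G = Abs_fps (\<lambda>m. of_nat (vectorspace.dim K (V\<lparr>carrier := G m\<rparr>)))"

definition commutator :: "('a, 'm) ring_scheme \<Rightarrow> 'a \<Rightarrow> 'a \<Rightarrow> 'a" where
  "commutator A a b = a \<otimes>\<^bsub>A\<^esub> b \<ominus>\<^bsub>A\<^esub> b \<otimes>\<^bsub>A\<^esub> a"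

text \<open>The series is indexed from 1; the value at 0 is a dummy.\<close>

fun lower_central ::
    "('k, 'l) ring_scheme \<Rightarrow> ('k, 'a, 'm) module_scheme \<Rightarrow> nat \<Rightarrow> 'a set" where
  "lower_central K A 0 = carrier A"
| "lower_central K A (Suc 0) = carrier A"
| "lower_central K A (Suc (Suc i)) =
     LinearCombinations.module.span K A
       {commutator A a b | a b. a \<in> carrier A \<and> b \<in> lower_central K A (Suc i)}"

definition B_space ::
    "('k, 'l) ring_scheme \<Rightarrow> ('k, 'a, 'm) module_scheme \<Rightarrow> nat \<Rightarrow> ('k, 'a set) module" where
  "B_space K A i =
     quot_module (A\<lparr>carrier := lower_central K A i\<rparr>) (lower_central K A (Suc i))"

definition B_grading ::
    "('k, 'l) ring_scheme \<Rightarrow> ('k, 'a, 'm) module_scheme \<Rightarrow> (nat \<Rightarrow> 'a set) \<Rightarrow>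
     nat \<Rightarrow> nat \<Rightarrow> 'a set set" where
  "B_grading K A G i =
     quot_grading (A\<lparr>carrier := lower_central K A i\<rparr>) (lower_central K A (Suc i))
       (\<lambda>m. G m \<inter> lower_central K A i)"

definition commutator_ideal :: "('a, 'm) ring_scheme \<Rightarrow> 'a set" where
  "commutator_ideal A = Idl\<^bsub>A\<^esub> {commutator A a b | a b. a \<in> carrier A \<and> b \<in> carrier A}"

definition abelianization :: "('k, 'a, 'm) module_scheme \<Rightarrow> ('k, 'a set) module" where
  "abelianization A = quot_module A (commutator_ideal A)"

definition abelianization_grading ::
    "('k, 'a, 'm) module_scheme \<Rightarrow> (nat \<Rightarrow> 'a set) \<Rightarrow> nat \<Rightarrow> 'a set set" where
  "abelianization_grading A G = quot_grading A (commutator_ideal A) G"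

definition free_module :: "('r, 'l) ring_scheme \<Rightarrow> 'i set \<Rightarrow> ('r, 'i \<Rightarrow> 'r) module" where
  "free_module R S =
     \<lparr>carrier = {f. (\<forall>i\<in>S. f i \<in> carrier R) \<and> (\<forall>i. i \<notin> S \<longrightarrow> f i = \<zero>\<^bsub>R\<^esub>) \<and>
                    finite {i. f i \<noteq> \<zero>\<^bsub>R\<^esub>}},
      monoid.mult = (\<lambda>f g i. \<zero>\<^bsub>R\<^esub>), one = (\<lambda>i. \<zero>\<^bsub>R\<^esub>),
      ring.zero = (\<lambda>i. \<zero>\<^bsub>R\<^esub>), add = (\<lambda>f g i. f i \<oplus>\<^bsub>R\<^esub> g i),
      module.smult = (\<lambda>c f i. c \<otimes>\<^bsub>R\<^esub> f i)\<rparr>"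

definition free_gen :: "('r, 'l) ring_scheme \<Rightarrow> 'i \<Rightarrow> 'i \<Rightarrow> 'r" where
  "free_gen R i = (\<lambda>j. if j = i then \<one>\<^bsub>R\<^esub> else \<zero>\<^bsub>R\<^esub>)"

definition kaehler_relations ::
    "('k, 'l) ring_scheme \<Rightarrow> ('k, 'c, 'm) module_scheme \<Rightarrow> ('c \<Rightarrow> 'c) set" where
  "kaehler_relations K C =
     (let F = free_module C (carrier C); D = free_gen C in
       LinearCombinations.module.span C F
         ({D (a \<oplus>\<^bsub>C\<^esub> b) \<ominus>\<^bsub>F\<^esub> (D a \<oplus>\<^bsub>F\<^esub> D b) | a b. a \<in> carrier C \<and> b \<in> carrier C} \<union>
          {D (a \<otimes>\<^bsub>C\<^esub> b) \<ominus>\<^bsub>F\<^esub> (a \<odot>\<^bsub>F\<^esub> D b \<oplus>\<^bsub>F\<^esub> b \<odot>\<^bsub>F\<^esub> D a) | a b. a \<in> carrier C \<and> b \<in> carrier C} \<union>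
          {D (k \<odot>\<^bsub>C\<^esub> \<one>\<^bsub>C\<^esub>) | k. k \<in> carrier K}))"

definition Omega1 ::
    "('k, 'l) ring_scheme \<Rightarrow> ('k, 'c, 'm) module_scheme \<Rightarrow> ('c, ('c \<Rightarrow> 'c) set) module" where
  "Omega1 K C = quot_module (free_module C (carrier C)) (kaehler_relations K C)"

definition differential ::
    "('k, 'l) ring_scheme \<Rightarrow> ('k, 'c, 'm) module_scheme \<Rightarrow> 'c \<Rightarrow> ('c \<Rightarrow> 'c) set" where
  "differential K C a =
     kaehler_relations K C +>\<^bsub>free_module C (carrier C)\<^esub> free_gen C a"

definition wedge_relations ::
    "('r, 'l) ring_scheme \<Rightarrow> ('r, 'a, 'm) module_scheme \<Rightarrow> ('a \<times> 'a \<Rightarrow> 'r) set" where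
  "wedge_relations R M =
     (let F = free_module R (carrier M \<times> carrier M); T = (\<lambda>x y. free_gen R (x, y)) in
       LinearCombinations.module.span R F
         ({T (x \<oplus>\<^bsub>M\<^esub> y) z \<ominus>\<^bsub>F\<^esub> (T x z \<oplus>\<^bsub>F\<^esub> T y z) | x y z.
             x \<in> carrier M \<and> y \<in> carrier M \<and> z \<in> carrier M} \<union>
          {T x (y \<oplus>\<^bsub>M\<^esub> z) \<ominus>\<^bsub>F\<^esub> (T x y \<oplus>\<^bsub>F\<^esub> T x z) | x y z.
             x \<in> carrier M \<and> y \<in> carrier M \<and> z \<in> carrier M} \<union>
          {T (c \<odot>\<^bsub>M\<^esub> x) y \<ominus>\<^bsub>F\<^esub> c \<odot>\<^bsub>F\<^esub> T x y | c x y.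
             c \<in> carrier R \<and> x \<in> carrier M \<and> y \<in> carrier M} \<union>
          {T x (c \<odot>\<^bsub>M\<^esub> y) \<ominus>\<^bsub>F\<^esub> c \<odot>\<^bsub>F\<^esub> T x y | c x y.
             c \<in> carrier R \<and> x \<in> carrier M \<and> y \<in> carrier M} \<union>
          {T x x | x. x \<in> carrier M}))"

definition exterior_square ::
    "('r, 'l) ring_scheme \<Rightarrow> ('r, 'a, 'm) module_scheme \<Rightarrow> ('r, ('a \<times> 'a \<Rightarrow> 'r) set) module" where
  "exterior_square R M =
     quot_module (free_module R (carrier M \<times> carrier M)) (wedge_relations R M)"

definition wedge ::
    "('r, 'l) ring_scheme \<Rightarrow> ('r, 'a, 'm) module_scheme \<Rightarrow> 'a \<Rightarrow> 'a \<Rightarrow> ('a \<times> 'a \<Rightarrow> 'r) set" where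
  "wedge R M x y =
     wedge_relations R M +>\<^bsub>free_module R (carrier M \<times> carrier M)\<^esub> free_gen R (x, y)"

definition restrict_scalars ::
    "('k, 'c, 'm) module_scheme \<Rightarrow> ('c, 'a, 'n) module_scheme \<Rightarrow> ('k, 'a) module" where
  "restrict_scalars C M =
     \<lparr>carrier = carrier M, monoid.mult = monoid.mult M, one = one M, ring.zero = ring.zero M,
      add = add M, module.smult = (\<lambda>k x. (k \<odot>\<^bsub>C\<^esub> \<one>\<^bsub>C\<^esub>) \<odot>\<^bsub>M\<^esub> x)\<rparr>"

type_synonym 'c two_form = "(('c \<Rightarrow> 'c) set \<times> ('c \<Rightarrow> 'c) set \<Rightarrow> 'c) set"

text \<open>The exterior square is taken over \<open>C\<close>; the result is then viewed as a \<open>K\<close>-module.\<close>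

definition Omega2 ::
    "('k, 'l) ring_scheme \<Rightarrow> ('k, 'c, 'm) module_scheme \<Rightarrow> ('k, 'c two_form) module" where
  "Omega2 K C = restrict_scalars C (exterior_square C (Omega1 K C))"

text \<open>The differential has degree 0, so \<open>a db \<and> dc\<close> has degree \<open>deg a + deg b + deg c\<close>.\<close>

definition Omega2_grading ::
    "('k, 'l) ring_scheme \<Rightarrow> ('k, 'c, 'm) module_scheme \<Rightarrow> (nat \<Rightarrow> 'c set) \<Rightarrow>
     nat \<Rightarrow> 'c two_form set" where
  "Omega2_grading K C G m =
     LinearCombinations.module.span K (Omega2 K C)
       {a \<odot>\<^bsub>exterior_square C (Omega1 K C)\<^esub>
          wedge C (Omega1 K C) (differential K C b) (differential K C c) | a b c i j k.
        a \<in> G i \<and> b \<in> G j \<and> c \<in> G k \<and> i + j + k = m}"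

datatype letter = GenX | GenY

datatype word = Word (letters: "letter list")

instantiation word :: monoid_add
begin

definition zero_word :: word where
  "0 = Word []"

definition plus_word :: "word \<Rightarrow> word \<Rightarrow> word" where
  "u + v = Word (letters u @ letters v)"

instance
  by standard (simp_all add: zero_word_def plus_word_def)

end

abbreviation num_x :: "word \<Rightarrow> nat" where
  "num_x w \<equiv> count_list (letters w) GenX"

abbreviation num_y :: "word \<Rightarrow> nat" where
  "num_y w \<equiv> count_list (letters w) GenY"

text \<open>
  Words form a monoid under concatenation (written additively), and the convolution product of
  \<^typ>\<open>word \<Rightarrow>\<^sub>0 complex\<close> makes this type the monoid algebra of words.
\<close>

definition free_algebra :: "(complex, word \<Rightarrow>\<^sub>0 complex) module" where
  "free_algebra =
     \<lparr>carrier = UNIV, monoid.mult = (*), one = 1, ring.zero = 0, add = (+),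
      module.smult = (\<lambda>c. Poly_Mapping.map ((*) c))\<rparr>"

definition free_grading :: "nat \<Rightarrow> nat \<Rightarrow> nat \<Rightarrow> (word \<Rightarrow>\<^sub>0 complex) set" where
  "free_grading s r m = {p. \<forall>w\<in>Poly_Mapping.keys p. s * num_x w + r * num_y w = m}"

text \<open>
  The polynomial ring in \<open>x\<close>, \<open>y\<close> is \<^typ>\<open>complex poly poly\<close>, with \<open>y\<close> as the outer and \<open>x\<close> as the
  inner variable: the coefficient of \<open>x\<^sup>i y\<^sup>j\<close> in \<open>p\<close> is \<open>coeff (coeff p j) i\<close>.
\<close>

definition poly_algebra :: "(complex, complex poly poly) module" where
  "poly_algebra =
     \<lparr>carrier = UNIV, monoid.mult = (*), one = 1, ring.zero = 0, add = (+),
      module.smult = (\<lambda>c. Polynomial.smult [:c:])\<rparr>"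

definition poly_grading :: "nat \<Rightarrow> nat \<Rightarrow> nat \<Rightarrow> complex poly poly set" where
  "poly_grading s r m =
     {p. \<forall>i j. Polynomial.coeff (Polynomial.coeff p j) i \<noteq> 0 \<longrightarrow> s * i + r * j = m}"

text \<open>
  The algebra homomorphism fixing \<open>x\<close> and \<open>y\<close>. Its kernel is the ideal generated by all commutators,
  so it identifies the abelianization of the free algebra with the polynomial ring.
\<close>

definition poly_of_free :: "(word \<Rightarrow>\<^sub>0 complex) \<Rightarrow> complex poly poly" where
  "poly_of_free p =
     (\<Sum>w\<in>Poly_Mapping.keys p.
        Polynomial.monom (Polynomial.monom (Poly_Mapping.lookup p w) (num_x w)) (num_y w))"

definition one_relator_algebra ::
    "(word \<Rightarrow>\<^sub>0 complex) \<Rightarrow> (complex, (word \<Rightarrow>\<^sub>0 complex) set) module" where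
  "one_relator_algebra P = quot_module free_algebra (Idl\<^bsub>free_algebra\<^esub> {P})"

definition one_relator_grading ::
    "nat \<Rightarrow> nat \<Rightarrow> (word \<Rightarrow>\<^sub>0 complex) \<Rightarrow> nat \<Rightarrow> (word \<Rightarrow>\<^sub>0 complex) set set" where
  "one_relator_grading s r P =
     quot_grading free_algebra (Idl\<^bsub>free_algebra\<^esub> {P}) (free_grading s r)"

definition plane_curve_algebra ::
    "complex poly poly \<Rightarrow> (complex, complex poly poly set) module" where
  "plane_curve_algebra f = quot_module poly_algebra (Idl\<^bsub>poly_algebra\<^esub> {f})"

definition plane_curve_grading ::
    "nat \<Rightarrow> nat \<Rightarrow> complex poly poly \<Rightarrow> nat \<Rightarrow> complex poly poly set set" where
  "plane_curve_grading s r f =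
     quot_grading poly_algebra (Idl\<^bsub>poly_algebra\<^esub> {f}) (poly_grading s r)"

end

theory Submission
  imports Defs "HOL-Computational_Algebra.Field_as_Ring"
begin

text \<open>
  Write \<open>F\<close> for the free algebra on \<open>x\<close>, \<open>y\<close>, write \<open>f\<close> for the abelianization of \<open>P\<close>, and let
  \<open>{g, h} = g\<^sub>x h\<^sub>y - g\<^sub>y h\<^sub>x\<close>, so that \<open>dg \<and> dh = {g, h} dx \<and> dy\<close>. Both \<open>B\<^sub>2(A)\<close> and
  \<open>\<Omega>\<^sup>2(A\<^sub>a\<^sub>b)\<close> turn out to be the quotient of \<open>\<complex>[x,y] dx \<and> dy\<close> by the Jacobian ideal \<open>(f\<^sub>x, f\<^sub>y)\<close>;
  the isomorphism is \<open>[a, b] \<mapsto> da \<and> db\<close>. It is obtained from two graded surjections out of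
  \<open>\<complex>[x,y]\<close> with the same kernel (\<open>bracket_of_form_eq_iff\<close>, \<open>two_form_eq_iff\<close>).

  Without a relation, \<open>[a, b] \<mapsto> da \<and> db\<close> identifies \<open>L\<^sub>2(F)/L\<^sub>3(F)\<close> with the two-forms of the
  plane. It is well defined because it is the restriction to \<open>L\<^sub>2(F)\<close> of a linear map \<open>theta\<close> on \<open>F\<close>: the
  pair \<open>(poly_of_free, theta)\<close> is a homomorphism to the polynomial forms of even degree with a
  deformed product, in which triple commutators vanish (\<open>theta_mult\<close>). It is injective because
  \<open>[a, z]\<close> modulo \<open>L\<^sub>3\<close> depends on the abelianization of \<open>z\<close> only (\<open>bracket_kernel_L3\<close>); hence every
  element of \<open>L\<^sub>2\<close> is congruent to some \<open>[x, t]\<close>, whose image \<open>t\<^sub>y\<close> vanishes only if \<open>t\<close>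
  may be taken in \<open>\<complex>[x]\<close> (\<open>L2_theta_kernel\<close>).

  The relation divides \<open>L\<^sub>2(F)/L\<^sub>3(F)\<close> further by \<open>L\<^sub>2(F) \<inter> \<langle>P\<rangle>\<close>. Modulo \<open>(f, f\<^sub>x, f\<^sub>y)\<close> the map
  \<open>theta\<close> is linear over the polynomials on \<open>\<langle>P\<rangle>\<close>, so an element of \<open>\<langle>P\<rangle>\<close> with abelianization
  zero has its image in \<open>(f, f\<^sub>x, f\<^sub>y)\<close> (\<open>theta_on_ideal\<close>). Homogeneity enters through Euler's identity
  \<open>d f = s x f\<^sub>x + r y f\<^sub>y\<close>: it puts \<open>f\<close> into \<open>(f\<^sub>x, f\<^sub>y)\<close>, and it shows that the images \<open>{a, gf}\<close> of the
  brackets \<open>[a, gP]\<close> span the whole Jacobian ideal (\<open>jacobian_from_ideal\<close>). On the other side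
  \<open>\<Omega>\<^sup>2(A\<^sub>a\<^sub>b)\<close> is \<open>\<complex>[x,y] dx \<and> dy\<close> modulo \<open>f\<close> and \<open>df \<and> \<Omega>\<^sup>1\<close>, which is the same quotient.

  For the Hilbert series, a common prime factor of \<open>f\<^sub>x\<close> and \<open>f\<^sub>y\<close> would divide \<open>f\<close> twice, so
  square-freeness makes \<open>f\<^sub>x, f\<^sub>y\<close> coprime (\<open>partials_coprime\<close>). All relations \<open>u f\<^sub>x + v f\<^sub>y = 0\<close> are then
  multiples of the obvious one, and the dimension of the quotient in each degree is an alternating
  sum of four numbers of monomials, one for each term of \<open>(t\<^sup>s - t\<^sup>d)(t\<^sup>r - t\<^sup>d)\<close>.
\<close>

section \<open>Brackets in an associative ring\<close>

definition bracket :: "'a::ring \<Rightarrow> 'a \<Rightarrow> 'a" where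
  "bracket a b = a * b - b * a"

lemma bracket_add_left: "bracket (a + b) c = bracket a c + bracket b c"
  and bracket_add_right: "bracket a (b + c) = bracket a b + bracket a c"
  and bracket_diff_right: "bracket a (b - c) = bracket a b - bracket a c"
  and bracket_minus_left: "bracket (- a) b = - bracket a b"
  and bracket_skew: "bracket b a = - bracket a b"
  and bracket_zero_right: "bracket a 0 = 0"
  by (simp_all add: bracket_def algebra_simps)

text \<open>The additive span of the brackets \<open>[a, b]\<close> with \<open>b\<close> in \<open>B\<close>. Over an algebra this is the linear
  span, since scalars can be moved into \<open>a\<close>.\<close>

inductive_set bracket_span :: "'a::ring set \<Rightarrow> 'a set" for B where
  zero: "0 \<in> bracket_span B"
| step: "z \<in> bracket_span B \<Longrightarrow> b \<in> B \<Longrightarrow> z + bracket a b \<in> bracket_span B"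

abbreviation L2 :: "'a::ring set" where "L2 \<equiv> bracket_span UNIV"
abbreviation L3 :: "'a::ring set" where "L3 \<equiv> bracket_span L2"

lemma bracket_in_span: "b \<in> B \<Longrightarrow> bracket a b \<in> bracket_span B"
  using bracket_span.step[OF bracket_span.zero, of b B a] by simp

lemma bracket_span_add:
  assumes "y \<in> bracket_span B" "z \<in> bracket_span B"
  shows "y + z \<in> bracket_span B"
  using assms(2)
proof induction
  case (step z b a)
  then show ?case using bracket_span.step[of "y + z" B b a] by (simp add: add.assoc)
qed (use assms(1) in simp)

lemma bracket_span_minus: "z \<in> bracket_span B \<Longrightarrow> - z \<in> bracket_span B"
proof (induction rule: bracket_span.induct)
  case (step z b a)
  then show ?case using bracket_span.step[of "- z" B b "- a"] by (simp add: bracket_minus_left)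
qed (simp add: bracket_span.zero)

lemma bracket_span_diff:
  "y \<in> bracket_span B \<Longrightarrow> z \<in> bracket_span B \<Longrightarrow> y - z \<in> bracket_span B"
  using bracket_span_add[of y B "- z"] bracket_span_minus[of z B] by simp

lemma bracket_span_mono: "B \<subseteq> C \<Longrightarrow> bracket_span B \<subseteq> bracket_span C"
proof
  fix z assume "B \<subseteq> C" "z \<in> bracket_span B"
  from this(2,1) show "z \<in> bracket_span C" by induction (auto intro: bracket_span.intros)
qed

lemma bracket_span_of_nat:
  "z \<in> bracket_span B \<Longrightarrow> of_nat n * z \<in> bracket_span (B :: 'a::ring_1 set)"
  by (induction n) (auto simp: distrib_right bracket_span.zero intro: bracket_span_add)

lemma L3_subset_L2: "L3 \<subseteq> L2"
  by (rule bracket_span_mono) simp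

lemma bracket_L2: "bracket a b \<in> L2"
  by (rule bracket_in_span) simp

lemma bracket_bracket_L3: "bracket a (bracket b c) \<in> L3"
  by (rule bracket_in_span) (rule bracket_L2)

lemma bracket_swap_factors: "bracket a (b * c) - bracket a (c * b) \<in> L3"
  using bracket_bracket_L3[of a b c] by (simp add: bracket_def algebra_simps)

text \<open>From \<open>[ab, c] = [a, bc] + [b, ca]\<close>: with \<open>\<ell>\<close> in \<^term>\<open>L2\<close> on the right the left-hand side
  lies in \<^term>\<open>L3\<close>, so that \<open>(a, b) \<mapsto> [a, b\<ell>]\<close> is skew modulo \<^term>\<open>L3\<close>.\<close>

lemma bracket_mult_left: "bracket (a * b) c = bracket a (b * c) + bracket b (c * a)"
  by (simp add: bracket_def algebra_simps)

lemma bracket_mult_L2_skew: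
  assumes "l \<in> L2"
  shows "bracket a (b * l) + bracket b (a * l) \<in> L3"
proof -
  have "bracket a (b * l) + bracket b (a * l) = bracket (a * b) l + bracket b (bracket a l)"
    by (simp add: bracket_def algebra_simps)
  moreover have "bracket (a * b) l \<in> L3"
    by (rule bracket_in_span) (rule assms)
  ultimately show ?thesis
    using bracket_span_add[OF _ bracket_bracket_L3] by metis
qed

text \<open>Moving both factors by skewness turns \<open>[a, \<ell>'\<ell>]\<close> into the bracket of \<open>a\<ell>\<close> with \<open>\<ell>'\<close>.\<close>

lemma bracket_L2_mult_L2:
  assumes l: "l \<in> L2" and l': "l' \<in> L2"
  shows "bracket a (l' * l) \<in> L3"
proof -
  have "bracket a (l' * l) = (bracket a (l' * l) + bracket l' (a * l)) + bracket (a * l) l'"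
    by (simp add: bracket_def algebra_simps)
  with bracket_mult_L2_skew[OF l, of a l'] bracket_in_span[OF l', of "a * l"]
  show ?thesis using bracket_span_add by metis
qed

definition is_ideal :: "'a::ring set \<Rightarrow> bool" where
  "is_ideal T \<longleftrightarrow> 0 \<in> T \<and> (\<forall>a\<in>T. \<forall>b\<in>T. a + b \<in> T) \<and> (\<forall>a\<in>T. \<forall>u. u * a \<in> T \<and> a * u \<in> T)"

lemma is_ideal_add: "is_ideal T \<Longrightarrow> a \<in> T \<Longrightarrow> b \<in> T \<Longrightarrow> a + b \<in> T"
  and is_ideal_left: "is_ideal T \<Longrightarrow> a \<in> T \<Longrightarrow> u * a \<in> T"
  and is_ideal_right: "is_ideal T \<Longrightarrow> a \<in> T \<Longrightarrow> a * u \<in> T"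
  and is_ideal_zero: "is_ideal T \<Longrightarrow> 0 \<in> T"
  by (auto simp: is_ideal_def)

lemma is_ideal_minus:
  fixes T :: "'a::ring_1 set"
  shows "is_ideal T \<Longrightarrow> a \<in> T \<Longrightarrow> - a \<in> T"
  using is_ideal_left[of T a "- 1"] by simp

lemma is_ideal_diff:
  fixes T :: "'a::ring_1 set"
  shows "is_ideal T \<Longrightarrow> a \<in> T \<Longrightarrow> b \<in> T \<Longrightarrow> a - b \<in> T"
  using is_ideal_add[of T a "- b"] is_ideal_minus[of T b] by simp

text \<open>The largest two-sided ideal whose brackets with the whole ring stay in \<^term>\<open>L3\<close>. For the
  free algebra on two generators it turns out to contain the kernel of abelianization, so that
  \<open>[a, z]\<close> modulo \<^term>\<open>L3\<close> depends on the abelianization of \<open>z\<close> only.\<close>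

definition deep_ideal :: "'a::ring_1 set" where
  "deep_ideal = {z. \<forall>u v a. bracket a (u * z * v) \<in> L3}"

lemma deep_idealD: "z \<in> deep_ideal \<Longrightarrow> bracket a z \<in> L3"
  unfolding deep_ideal_def using mult_1_left mult_1_right by (metis (mono_tags, lifting) mem_Collect_eq)

lemma deep_ideal_is_ideal: "is_ideal (deep_ideal :: 'a::ring_1 set)"
  unfolding is_ideal_def
proof (intro conjI ballI allI)
  show "(0::'a) \<in> deep_ideal"
    by (simp add: deep_ideal_def bracket_zero_right bracket_span.zero)
next
  fix a b :: 'a assume "a \<in> deep_ideal" "b \<in> deep_ideal"
  then show "a + b \<in> deep_ideal"
    by (auto simp: deep_ideal_def distrib_left distrib_right bracket_add_right
        intro!: bracket_span_add)
next
  fix z w :: 'a assume z: "z \<in> deep_ideal"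
  have "bracket a (u * (w * z) * v) \<in> L3" for a u v
    using z unfolding deep_ideal_def by (metis (mono_tags, lifting) mem_Collect_eq mult.assoc)
  then show "w * z \<in> deep_ideal"
    by (simp add: deep_ideal_def)
  have "bracket a (u * (z * w) * v) \<in> L3" for a u v
    using z unfolding deep_ideal_def by (metis (mono_tags, lifting) mem_Collect_eq mult.assoc)
  then show "z * w \<in> deep_ideal"
    by (simp add: deep_ideal_def)
qed

text \<open>Up to cyclic rotation inside the second slot, \<open>[a, u[c, \<ell>]v]\<close> is \<open>[a, [b, c]\<ell>]\<close> with \<open>b = vu\<close>;
  this is the bracket of \<open>a\<close> with a product of two elements of \<^term>\<open>L2\<close>.\<close>

lemma bracket_with_L2_in_deep_ideal:
  fixes l :: "'a::ring_1"
  assumes l: "l \<in> L2"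
  shows "bracket c l \<in> deep_ideal"
proof -
  have "bracket a (u * bracket c l * v) \<in> L3" for u v a
  proof -
    define b where "b = v * u"
    have "bracket a (u * bracket c l * v)
        = bracket a (bracket b c * l) - bracket a (bracket (b * l) c)
          + bracket a (bracket (u * bracket c l) v)"
      by (simp add: bracket_def algebra_simps b_def)
    moreover have "bracket a (bracket b c * l) \<in> L3"
      by (rule bracket_L2_mult_L2[OF l bracket_L2])
    ultimately show ?thesis
      using bracket_span_add[OF bracket_span_diff[OF _ bracket_bracket_L3] bracket_bracket_L3]
      by metis
  qed
  then show ?thesis by (simp add: deep_ideal_def)
qed

text \<open>Applying the derivation \<open>[x, _]\<close> twice to \<open>y\<^sup>2\<close> gives this element and two terms with a factor
  \<open>[x, [x, y]]\<close>.\<close>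

lemma bracket_sq_deep:
  fixes x y :: "'a::ring_1"
  shows "bracket x y * bracket x y + bracket x y * bracket x y \<in> deep_ideal"
proof -
  let ?l = "bracket x y"
  let ?m = "bracket x ?l"
  have "?l * ?l + ?l * ?l = bracket x (bracket x (y * y)) - (?m * y + y * ?m)"
    by (simp add: bracket_def algebra_simps)
  moreover have "?m \<in> deep_ideal" and "bracket x (bracket x (y * y)) \<in> deep_ideal"
    by (rule bracket_with_L2_in_deep_ideal, rule bracket_L2)+
  moreover note I = deep_ideal_is_ideal
  ultimately show ?thesis
    by (metis is_ideal_add[OF I] is_ideal_diff[OF I] is_ideal_left[OF I] is_ideal_right[OF I])
qed

text \<open>Elements of \<^term>\<open>L2\<close> are central modulo \<^term>\<open>deep_ideal\<close>, so \<open>[x, _]\<close> differentiates powers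
  of \<open>y\<close> as in the commutative case.\<close>

lemma bracket_power_right_deep:
  fixes x y :: "'a::ring_1"
  shows "bracket x (y ^ n) - of_nat n * (y ^ (n - 1) * bracket x y) \<in> deep_ideal"
proof (induction n)
  case 0
  then show ?case by (simp add: bracket_def is_ideal_zero[OF deep_ideal_is_ideal])
next
  case (Suc n)
  note I = deep_ideal_is_ideal
  let ?l = "bracket x y"
  have 1: "bracket x (y ^ Suc n) = ?l * y ^ n + y * bracket x (y ^ n)"
    by (simp add: bracket_def algebra_simps)
  have 2: "y * (of_nat n * (y ^ (n - 1) * ?l)) = of_nat n * (y ^ n * ?l)"
  proof -
    have "y * (of_nat n * (y ^ (n - 1) * ?l)) = of_nat n * (y * y ^ (n - 1) * ?l)"
      by (metis mult.assoc mult_of_nat_commute)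
    then show ?thesis by (cases n) simp_all
  qed
  have "bracket x (y ^ Suc n) - of_nat (Suc n) * (y ^ (Suc n - 1) * ?l)
      = - bracket (y ^ n) ?l + y * (bracket x (y ^ n) - of_nat n * (y ^ (n - 1) * ?l))"
    unfolding 1 right_diff_distrib 2 by (simp add: bracket_def algebra_simps)
  moreover have "bracket (y ^ n) ?l \<in> deep_ideal"
    by (rule bracket_with_L2_in_deep_ideal, rule bracket_L2)
  ultimately show ?case
    using Suc by (metis is_ideal_add[OF I] is_ideal_minus[OF I] is_ideal_left[OF I])
qed

text \<open>The second slot may be rotated cyclically modulo \<^term>\<open>L3\<close>; expanding \<open>[a\<^sup>n, b]\<close> by
  \<open>bracket_mult_left\<close> therefore gives \<open>n\<close> equal terms.\<close>

lemma bracket_power_left: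
  fixes a b :: "'a::ring_1"
  shows "bracket (a ^ n) b - of_nat n * bracket a (a ^ (n - 1) * b) \<in> L3"
proof -
  have "bracket (a ^ Suc n) b - of_nat (Suc n) * bracket a (a ^ n * b) \<in> L3" for n
  proof (induction n arbitrary: b)
    case 0
    then show ?case by (simp add: bracket_span.zero)
  next
    case (Suc n)
    let ?e = "bracket (a ^ Suc n) (b * a) - of_nat (Suc n) * bracket a (a ^ n * (b * a))"
    let ?s = "bracket a (a ^ n * b * a) - bracket a (a * (a ^ n * b))"
    have "bracket (a ^ Suc (Suc n)) b = bracket a (a ^ Suc n * b) + bracket (a ^ Suc n) (b * a)"
      using bracket_mult_left[of a "a ^ Suc n" b] by simp
    then have "bracket (a ^ Suc (Suc n)) b - of_nat (Suc (Suc n)) * bracket a (a ^ Suc n * b)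
        = ?e + of_nat (Suc n) * ?s"
      by (simp add: algebra_simps)
    moreover have "?s \<in> L3" by (rule bracket_swap_factors)
    ultimately show ?case
      using Suc[of "b * a"] bracket_span_add bracket_span_of_nat by metis
  qed
  note * = this
  show ?thesis
  proof (cases n)
    case 0
    then show ?thesis by (simp add: bracket_def bracket_span.zero)
  next
    case (Suc m)
    then show ?thesis using *[of m] by simp
  qed
qed

section \<open>The polynomial ring in two variables\<close>

type_synonym bipoly = "complex poly poly"

abbreviation cst :: "complex \<Rightarrow> bipoly" where "cst c \<equiv> [:[:c:]:]"
abbreviation PX :: bipoly where "PX \<equiv> [:[:0, 1:]:]"
abbreviation PY :: bipoly where "PY \<equiv> [:0, 1:]"

abbreviation mon :: "complex \<Rightarrow> nat \<Rightarrow> nat \<Rightarrow> bipoly" where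
  "mon c i j \<equiv> Polynomial.monom (Polynomial.monom c i) j"

abbreviation dx :: "bipoly \<Rightarrow> bipoly" where "dx \<equiv> map_poly pderiv"
abbreviation dy :: "bipoly \<Rightarrow> bipoly" where "dy \<equiv> pderiv"

abbreviation coef :: "bipoly \<Rightarrow> nat \<Rightarrow> nat \<Rightarrow> complex" where
  "coef g i j \<equiv> Polynomial.coeff (Polynomial.coeff g j) i"

lemma mon_mult: "mon a i j * mon b k l = mon (a * b) (i + k) (j + l)"
  by (simp add: mult_monom)

lemma cst_one [simp]: "cst 1 = 1"
  by (metis one_pCons)

lemma PX_power: "PX ^ i = mon 1 i 0"
  by (induction i) (simp_all add: monom_0 monom_Suc)

lemma PY_power: "PY ^ j = mon 1 0 j"
  by (induction j) (simp_all add: monom_0 monom_Suc)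

lemma mon_eq: "mon c i j = cst c * PX ^ i * PY ^ j"
  unfolding PX_power PY_power by (simp add: mult_monom smult_monom)

lemma coeff_dx [simp]: "Polynomial.coeff (dx g) j = pderiv (Polynomial.coeff g j)"
  by (simp add: coeff_map_poly)

lemma dx_add: "dx (g + h) = dx g + dx h"
  by (rule poly_eqI) (simp add: pderiv_add)

lemma pderiv_sum: "pderiv (sum h A) = (\<Sum>a\<in>A. pderiv (h a))"
  by (induction A rule: infinite_finite_induct) (simp_all add: pderiv_add)

lemma dx_mult: "dx (g * h) = g * dx h + dx g * h"
proof (rule poly_eqI)
  fix n
  have "Polynomial.coeff (dx (g * h)) n
      = (\<Sum>i\<le>n. pderiv (Polynomial.coeff g i * Polynomial.coeff h (n - i)))"
    by (simp add: coeff_mult pderiv_sum)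
  also have "\<dots> = Polynomial.coeff (g * dx h + dx g * h) n"
    by (simp add: coeff_mult pderiv_mult sum.distrib mult.commute[of "pderiv _"])
  finally show "Polynomial.coeff (dx (g * h)) n = Polynomial.coeff (g * dx h + dx g * h) n" .
qed

lemma dx_mon: "dx (mon c i j) = mon (of_nat i * c) (i - 1) j"
  by (rule poly_eqI) (simp add: pderiv_monom)

lemma dy_mon: "dy (mon c i j) = mon (of_nat j * c) i (j - 1)"
  by (simp add: pderiv_monom of_nat_poly mult_monom smult_monom)

lemma dx_cst [simp]: "dx (cst c) = 0"
  using dx_mon[of c 0 0] by (simp add: monom_0)

lemma dx_PX [simp]: "dx PX = 1"
  using dx_mon[of 1 1 0] PX_power[of 1] by (simp add: monom_0)

lemma dx_PY [simp]: "dx PY = 0"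
  using dx_mon[of 1 0 1] PY_power[of 1] by (simp add: monom_0)

lemma dy_cst [simp]: "dy (cst c) = 0"
  and dy_PX [simp]: "dy PX = 0"
  and dy_PY [simp]: "dy PY = 1"
  by (simp_all add: pderiv_pCons)

lemma bipoly_expansion: "g = (\<Sum>j\<le>degree g. \<Sum>i\<le>degree (Polynomial.coeff g j). mon (coef g i j) i j)"
proof -
  have "(\<Sum>i\<in>A. Polynomial.monom (q i) j) = Polynomial.monom (\<Sum>i\<in>A. q i) j"
    for A :: "nat set" and q :: "nat \<Rightarrow> complex poly" and j
    by (induction A rule: infinite_finite_induct) (simp_all add: add_monom)
  then have "(\<Sum>i\<le>degree p. Polynomial.monom (Polynomial.monom (Polynomial.coeff p i) i) j)
      = Polynomial.monom p j" for p :: "complex poly" and j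
    by (simp add: poly_as_sum_of_monoms)
  then show ?thesis by (simp add: poly_as_sum_of_monoms)
qed

text \<open>Additive properties need to be checked on monomials only, and only on those in the support; the
  latter lets the same principle produce homogeneous witnesses.\<close>

lemma bipoly_induct_support:
  assumes mon: "\<And>i j c. coef g i j \<noteq> 0 \<Longrightarrow> Q (mon c i j)"
    and zero: "Q 0" and add: "\<And>p q. Q p \<Longrightarrow> Q q \<Longrightarrow> Q (p + q)"
  shows "Q g"
proof -
  have sum: "finite A \<Longrightarrow> (\<And>a. a \<in> A \<Longrightarrow> Q (h a)) \<Longrightarrow> Q (sum h A)" for A :: "nat set" and h
    by (induction rule: finite_induct) (auto simp: zero intro: add)
  have "Q (mon (coef g i j) i j)" for i j
    using mon zero by (cases "coef g i j = 0") auto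
  then show ?thesis
    by (subst bipoly_expansion) (intro sum; simp)
qed

lemma bipoly_induct:
  assumes "\<And>i j c. Q (mon c i j)" and "\<And>p q. Q p \<Longrightarrow> Q q \<Longrightarrow> Q (p + q)"
  shows "Q g"
  using assms(1)[of 0] assms by (intro bipoly_induct_support[of g Q]) auto

definition poisson :: "bipoly \<Rightarrow> bipoly \<Rightarrow> bipoly" where
  "poisson g h = dx g * dy h - dy g * dx h"

section \<open>The free algebra on two generators\<close>

type_synonym free = "word \<Rightarrow>\<^sub>0 complex"

abbreviation sc :: "complex \<Rightarrow> free" where "sc c \<equiv> Poly_Mapping.single 0 c"
abbreviation gx :: free where "gx \<equiv> Poly_Mapping.single (Word [GenX]) 1"
abbreviation gy :: free where "gy \<equiv> Poly_Mapping.single (Word [GenY]) 1"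

lemma free_expansion: "p = (\<Sum>w\<in>Poly_Mapping.keys p. Poly_Mapping.single w (Poly_Mapping.lookup p w))"
  by (rule poly_mapping_eqI)
    (simp add: lookup_sum lookup_single when_def in_keys_iff)

lemma free_induct_support:
  fixes p :: free
  assumes single: "\<And>w c. w \<in> Poly_Mapping.keys p \<Longrightarrow> Q (Poly_Mapping.single w c)"
    and zero: "Q 0" and add: "\<And>p q. Q p \<Longrightarrow> Q q \<Longrightarrow> Q (p + q)"
  shows "Q p"
proof -
  have "finite A \<Longrightarrow> (\<And>a. a \<in> A \<Longrightarrow> Q (h a)) \<Longrightarrow> Q (sum h A)" for A :: "word set" and h
    by (induction rule: finite_induct) (auto simp: zero intro: add)
  then show ?thesis
    by (subst free_expansion) (simp add: single)
qed

lemma free_induct: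
  fixes p :: free
  assumes "\<And>w c. Q (Poly_Mapping.single w c)" and "\<And>p q. Q p \<Longrightarrow> Q q \<Longrightarrow> Q (p + q)"
  shows "Q p"
  using assms(1)[of _ 0] assms by (intro free_induct_support[of p Q]) auto

lemma single_eq_sc_mult: "Poly_Mapping.single w c = sc c * Poly_Mapping.single w 1"
  by (simp add: mult_single)

lemma single_Cons:
  "Poly_Mapping.single (Word (a # l)) c
    = Poly_Mapping.single (Word [a]) 1 * (Poly_Mapping.single (Word l) c :: free)"
  by (simp add: mult_single plus_word_def)

lemma sc_mult_sc: "sc a * sc b = sc (a * b)"
  by (simp add: mult_single)

lemma sc_commute: "sc c * p = p * (sc c :: free)"
  by (induction p rule: free_induct) (simp_all add: mult_single distrib_left distrib_right mult.commute)

lemma of_nat_eq_sc: "of_nat n = sc (of_nat n)"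
  by simp

lemma bracket_sc_left: "bracket (sc c * a) b = sc c * bracket a b"
  by (simp add: bracket_def right_diff_distrib mult.assoc) (metis mult.assoc sc_commute)

lemma bracket_sc_right: "bracket a (sc c * b) = sc c * bracket a b"
  by (simp add: bracket_def right_diff_distrib mult.assoc) (metis mult.assoc sc_commute)

lemma bracket_span_sc: "z \<in> bracket_span B \<Longrightarrow> sc c * z \<in> bracket_span B"
proof (induction rule: bracket_span.induct)
  case (step z b a)
  then show ?case
    using bracket_span.step[of "sc c * z" B b "sc c * a"] by (simp add: bracket_sc_left distrib_left)
qed (simp add: bracket_span.zero)

definition lin :: "(word \<Rightarrow> bipoly) \<Rightarrow> free \<Rightarrow> bipoly" where
  "lin h p = (\<Sum>w\<in>Poly_Mapping.keys p. cst (Poly_Mapping.lookup p w) * h w)"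

lemma lin_superset:
  assumes "finite A" "Poly_Mapping.keys p \<subseteq> A"
  shows "lin h p = (\<Sum>w\<in>A. cst (Poly_Mapping.lookup p w) * h w)"
  unfolding lin_def
  by (rule sum.mono_neutral_left) (use assms in \<open>auto simp: in_keys_iff\<close>)

lemma lin_add: "lin h (p + q) = lin h p + lin h q"
proof -
  let ?A = "Poly_Mapping.keys p \<union> Poly_Mapping.keys q"
  have "lin h (p + q) = (\<Sum>w\<in>?A. cst (Poly_Mapping.lookup (p + q) w) * h w)"
    by (rule lin_superset) (use Poly_Mapping.keys_add[of p q] in auto)
  also have "\<dots> = (\<Sum>w\<in>?A. cst (Poly_Mapping.lookup p w) * h w)
      + (\<Sum>w\<in>?A. cst (Poly_Mapping.lookup q w) * h w)"
    by (simp add: lookup_add flip: sum.distrib smult_add_left)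
  also have "\<dots> = lin h p + lin h q"
    by (simp add: lin_superset[of ?A p] lin_superset[of ?A q])
  finally show ?thesis .
qed

lemma lin_single: "lin h (Poly_Mapping.single w c) = cst c * h w"
  by (simp add: lin_def)

lemma lin_zero: "lin h 0 = 0"
  by (simp add: lin_def)

lemma poly_of_free_eq_lin: "poly_of_free = lin (\<lambda>w. mon 1 (num_x w) (num_y w))"
  by (rule ext) (simp add: poly_of_free_def lin_def smult_monom)

lemma poly_of_free_single: "poly_of_free (Poly_Mapping.single w c) = mon c (num_x w) (num_y w)"
  by (simp add: poly_of_free_eq_lin lin_single smult_monom)

lemma poly_of_free_add: "poly_of_free (p + q) = poly_of_free p + poly_of_free q"
  by (simp add: poly_of_free_eq_lin lin_add)

lemma poly_of_free_zero [simp]: "poly_of_free 0 = 0"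
  by (simp add: poly_of_free_eq_lin lin_zero)

lemma poly_of_free_diff: "poly_of_free (p - q) = poly_of_free p - poly_of_free q"
  using poly_of_free_add[of "p - q" q] by simp

lemma poly_of_free_sc [simp]: "poly_of_free (sc c) = cst c"
  by (simp add: poly_of_free_single zero_word_def monom_0)

lemma poly_of_free_gx [simp]: "poly_of_free gx = PX"
  and poly_of_free_gy [simp]: "poly_of_free gy = PY"
  by (simp_all add: poly_of_free_single monom_0 monom_Suc)

lemma poly_of_free_mult: "poly_of_free (p * q) = poly_of_free p * poly_of_free q"
proof (induction p rule: free_induct)
  case (1 u a)
  show ?case
    by (induction q rule: free_induct)
      (simp_all add: mult_single poly_of_free_single mon_mult plus_word_def distrib_left poly_of_free_add)
qed (simp_all add: distrib_right poly_of_free_add)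

lemma poly_of_free_one [simp]: "poly_of_free 1 = 1"
  using poly_of_free_sc[of 1] by simp

lemma poly_of_free_power: "poly_of_free (p ^ n) = poly_of_free p ^ n"
  by (induction n) (simp_all add: poly_of_free_mult)

lemma poly_of_free_bracket: "poly_of_free (bracket p q) = 0"
  by (simp add: bracket_def poly_of_free_diff poly_of_free_mult)

lemma poly_of_free_L2: "z \<in> L2 \<Longrightarrow> poly_of_free z = 0"
  by (induction rule: bracket_span.induct) (simp_all add: poly_of_free_add poly_of_free_bracket)

section \<open>Commutators of the free algebra and two-forms of the plane\<close>

text \<open>On a word \<open>w\<close> with \<open>i\<close> letters \<open>x\<close> and \<open>j\<close> letters \<open>y\<close> this is \<open>- n x\<^bsup>i-1\<^esup> y\<^bsup>j-1\<^esup>\<close>, where \<open>n\<close> counts the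
  pairs of a letter \<open>y\<close> standing to the left of a letter \<open>x\<close>.\<close>

fun theta_letters :: "letter list \<Rightarrow> bipoly" where
  "theta_letters [] = 0"
| "theta_letters (GenX # l) = PX * theta_letters l"
| "theta_letters (GenY # l) = PY * theta_letters l - dx (mon 1 (count_list l GenX) (count_list l GenY))"

definition theta :: "free \<Rightarrow> bipoly" where
  "theta = lin (\<lambda>w. theta_letters (letters w))"

lemma theta_add: "theta (p + q) = theta p + theta q"
  by (simp add: theta_def lin_add)

lemma theta_zero [simp]: "theta 0 = 0"
  by (simp add: theta_def lin_zero)

lemma theta_diff: "theta (p - q) = theta p - theta q"
  using theta_add[of "p - q" q] by simp

lemma theta_single: "theta (Poly_Mapping.single w c) = cst c * theta_letters (letters w)"
  by (simp add: theta_def lin_single)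

lemma mon_Suc_x: "mon c (Suc i) j = PX * mon c i j"
  and mon_Suc_y: "mon c i (Suc j) = PY * mon c i j"
  by (simp_all add: mon_eq mult_ac)

lemma theta_letters_append:
  fixes u v :: "letter list"
  defines "m \<equiv> \<lambda>l. mon 1 (count_list l GenX) (count_list l GenY)"
  shows "theta_letters (u @ v)
    = m u * theta_letters v + theta_letters u * m v - dy (m u) * dx (m v)"
proof (induction u)
  case Nil
  have m: "m [] = 1" by (simp add: m_def monom_0)
  show ?case unfolding m by (simp del: coeff_dx)
next
  case (Cons a u)
  have m_append: "m (u @ v) = m u * m v"
    by (simp add: m_def mon_mult)
  show ?case
  proof (cases a)
    case GenX
    have m_X: "m (GenX # u) = PX * m u"
      by (simp add: m_def mon_Suc_x del: mult_pCons_left)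
    have d: "dy (PX * m u) = PX * dy (m u)"
      by (simp only: pderiv_mult dy_PX) (simp only: mult_zero_right add_0_right)
    show ?thesis
      unfolding append_Cons GenX theta_letters.simps m_X d Cons.IH by (simp only: algebra_simps)
  next
    case GenY
    have m_Y: "m (GenY # u) = PY * m u"
      by (simp add: m_def mon_Suc_y del: mult_pCons_left)
    have d: "dy (PY * m u) = PY * dy (m u) + m u"
      by (simp only: pderiv_mult dy_PY) (simp only: mult_1_right)
    have t: "theta_letters (GenY # l) = PY * theta_letters l - dx (m l)" for l
      by (simp add: m_def del: mult_pCons_left)
    show ?thesis
      unfolding append_Cons GenY t m_Y d Cons.IH m_append dx_mult by (simp only: algebra_simps)
  qed
qed

text \<open>The pair \<open>(poly_of_free, theta)\<close> is the homomorphism from the free algebra to the even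
  polynomial forms \<open>\<complex>[x,y] \<oplus> \<complex>[x,y] dx dy\<close> with the deformed product
  \<open>g * h = gh - g\<^sub>y h\<^sub>x dx dy\<close>, whose commutator is the Poisson bracket.\<close>

lemma theta_mult:
  "theta (p * q) = poly_of_free p * theta q + theta p * poly_of_free q
    - dy (poly_of_free p) * dx (poly_of_free q)"
proof (induction p rule: free_induct)
  case (1 u a)
  show ?case
  proof (induction q rule: free_induct)
    case (1 v b)
    let ?m = "\<lambda>w. mon 1 (num_x w) (num_y w)"
    have m: "mon c i j = cst c * mon 1 i j" for c i j
      by (simp add: smult_monom)
    have d: "dy (cst c * g) = cst c * dy g" "dx (cst c * g) = cst c * dx g" for c g
      by (simp_all only: pderiv_mult dx_mult dy_cst dx_cst) simp_all
    have "theta (Poly_Mapping.single u a * Poly_Mapping.single v b)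
        = cst a * cst b * theta_letters (letters u @ letters v)"
      by (simp add: mult_single theta_single plus_word_def)
    then show ?case
      unfolding poly_of_free_single theta_letters_append theta_single
      unfolding m[of a] m[of b] d
      by (simp only: algebra_simps)
  next
    case (2 q q')
    then show ?case by (simp add: distrib_left distrib_right theta_add poly_of_free_add dx_add
          del: coeff_dx)
  qed
next
  case (2 p p')
  then show ?case by (simp add: distrib_left distrib_right theta_add poly_of_free_add pderiv_add)
qed

lemma theta_bracket: "theta (bracket p q) = poisson (poly_of_free p) (poly_of_free q)"
  by (simp add: bracket_def theta_diff theta_mult poisson_def)

lemma theta_L3: "z \<in> L3 \<Longrightarrow> theta z = 0"
proof (induction rule: bracket_span.induct)
  case (step z b a)
  then show ?case by (simp add: theta_add theta_bracket poly_of_free_L2 poisson_def)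
qed simp

definition ordered_lift :: "bipoly \<Rightarrow> free" where
  "ordered_lift g = Sum_any (\<lambda>(i, j). sc (coef g i j) * gx ^ i * gy ^ j)"

lemma finite_coef_support: "finite {(i, j). coef g i j \<noteq> 0}"
proof (rule finite_subset)
  show "{(i, j). coef g i j \<noteq> 0} \<subseteq> (\<lambda>(j, i). (i, j)) ` (SIGMA j:{..degree g}. {..degree (Polynomial.coeff g j)})"
    by (force simp: image_iff intro!: le_degree)
qed simp

lemma finite_ordered_lift_support:
  "finite {a. (case a of (i, j) \<Rightarrow> sc (coef g i j) * gx ^ i * gy ^ j) \<noteq> 0}"
  by (rule finite_subset[OF _ finite_coef_support[of g]]) auto

lemma ordered_lift_add: "ordered_lift (g + h) = ordered_lift g + ordered_lift h"
  unfolding ordered_lift_def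
  by (subst Sum_any.distrib[OF finite_ordered_lift_support finite_ordered_lift_support, symmetric])
    (simp add: case_prod_unfold single_add distrib_right)

lemma ordered_lift_zero: "ordered_lift 0 = 0"
  by (simp add: ordered_lift_def case_prod_unfold)

lemma ordered_lift_mon: "ordered_lift (mon c i j) = sc c * gx ^ i * gy ^ j"
proof -
  have "ordered_lift (mon c i j)
      = (\<Sum>(k, l)\<in>{(i, j)}. sc (coef (mon c i j) k l) * gx ^ k * gy ^ l)"
    unfolding ordered_lift_def by (rule Sum_any.expand_superset) (auto split: if_splits)
  then show ?thesis by simp
qed

lemma bracket_power_right_ideal:
  fixes T :: "'a::ring_1 set"
  assumes T: "is_ideal T" and "bracket x y \<in> T"
  shows "bracket y (x ^ i) \<in> T"
proof (induction i)
  case 0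
  then show ?case by (simp add: bracket_def is_ideal_zero[OF T])
next
  case (Suc i)
  have "bracket y (x ^ Suc i) = x * bracket y (x ^ i) - bracket x y * x ^ i"
    by (simp add: bracket_def algebra_simps)
  with Suc assms(2) show ?case
    using is_ideal_diff[OF T] is_ideal_left[OF T] is_ideal_right[OF T] by metis
qed

text \<open>Modulo an ideal containing \<open>[x, y]\<close> the letters of a word may be sorted.\<close>

lemma sub_ordered_lift_in_ideal:
  fixes T :: "free set"
  assumes T: "is_ideal T" and l: "bracket gx gy \<in> T"
  shows "p - ordered_lift (poly_of_free p) \<in> T"
proof (induction p rule: free_induct)
  case (1 w c)
  have "Poly_Mapping.single (Word l) 1 - gx ^ count_list l GenX * gy ^ count_list l GenY \<in> T" for l
  proof (induction l)
    case Nil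
    have "Poly_Mapping.single (Word []) 1 = (1 :: free)"
      by (simp flip: zero_word_def)
    then show ?case by (simp add: is_ideal_zero[OF T])
  next
    case (Cons a l)
    let ?i = "count_list l GenX" and ?j = "count_list l GenY"
    let ?e = "Poly_Mapping.single (Word l) 1 - gx ^ ?i * gy ^ ?j"
    show ?case
    proof (cases a)
      case GenX
      have "Poly_Mapping.single (Word (a # l)) 1 - gx ^ Suc ?i * gy ^ ?j = gx * ?e"
        using single_Cons[of a l 1] GenX by (simp add: right_diff_distrib mult.assoc)
      then show ?thesis
        using is_ideal_left[OF T Cons, of gx] GenX by simp
    next
      case GenY
      have "Poly_Mapping.single (Word (a # l)) 1 - gx ^ ?i * gy ^ Suc ?j
          = gy * ?e + bracket gy (gx ^ ?i) * gy ^ ?j"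
        using single_Cons[of a l 1] GenY by (simp add: bracket_def algebra_simps)
      moreover have "bracket gy (gx ^ ?i) \<in> T"
        by (rule bracket_power_right_ideal[OF T l])
      ultimately show ?thesis
        using is_ideal_add[OF T is_ideal_left[OF T Cons] is_ideal_right[OF T]] GenY by simp
    qed
  qed
  from is_ideal_left[OF T this[of "letters w"], of "sc c"] show ?case
    by (simp add: poly_of_free_single ordered_lift_mon right_diff_distrib mult.assoc
        flip: single_eq_sc_mult[of w c])
next
  case (2 p q)
  from is_ideal_add[OF T 2] show ?case
    by (simp add: poly_of_free_add ordered_lift_add algebra_simps)
qed

text \<open>The kernel of abelianization is the ideal generated by \<open>[x, y]\<close>.\<close>

lemma poly_of_free_kernel:
  assumes "is_ideal T" "bracket gx gy \<in> T" "poly_of_free p = 0"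
  shows "p \<in> T"
  using sub_ordered_lift_in_ideal[OF assms(1,2), of p] assms(3) by (simp add: ordered_lift_zero)

lemma bracket_power_self: "bracket a (a ^ n * b) = a ^ n * bracket a (b :: 'a::ring_1)"
  by (simp add: bracket_def right_diff_distrib power_commutes flip: mult.assoc)

lemma sc_half_double: "sc (1 / 2) * (z + z) = z"
proof -
  have "sc (1/2) * (z + z) = (sc (1/2) + sc (1/2)) * z"
    by (simp only: distrib_left distrib_right)
  then show ?thesis by (simp flip: single_add)
qed

lemma sc_div_cancel: "sc (c / of_nat (Suc n)) * (of_nat (Suc n) * z) = sc c * z"
proof -
  have "sc (c / of_nat (Suc n)) * (of_nat (Suc n) * z) = (sc (c / of_nat (Suc n)) * sc (of_nat (Suc n))) * z"
    by (simp only: of_nat_eq_sc mult.assoc)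
  then show ?thesis by (simp only: sc_mult_sc) (simp del: of_nat_Suc)
qed

text \<open>It has to be shown that \<open>[a, p\<ell>]\<close> is in \<^term>\<open>L3\<close> for \<open>\<ell> = [x, y]\<close> and all \<open>p\<close>. As \<open>\<ell>\<close> is central and
  of square zero modulo \<^term>\<open>deep_ideal\<close>, the product \<open>p\<ell>\<close> depends on the abelianization of \<open>p\<close>
  only; and \<open>x\<^sup>i y\<^sup>j \<ell>\<close> is congruent to \<open>[x, x\<^sup>i y\<^bsup>j+1\<^esup>] / (j + 1)\<close>, an element of \<^term>\<open>L2\<close>.\<close>

lemma bracket_xy_in_deep_ideal: "bracket gx gy \<in> deep_ideal"
proof -
  note I = deep_ideal_is_ideal
  let ?l = "bracket gx gy"
  \<comment> \<open>Containing \<open>\<ell>\<close>, this ideal contains all differences of words with the same letters.\<close>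
  define T where "T = {z. z * ?l \<in> deep_ideal}"
  have T: "is_ideal T"
    unfolding is_ideal_def
  proof (intro conjI ballI allI)
    show "0 \<in> T" by (simp add: T_def is_ideal_zero[OF I])
  next
    fix a b assume "a \<in> T" "b \<in> T"
    then show "a + b \<in> T" by (simp add: T_def distrib_right is_ideal_add[OF I])
  next
    fix a u assume a: "a \<in> T"
    then show "u * a \<in> T" by (simp add: T_def mult.assoc is_ideal_left[OF I])
    have "a * u * ?l = a * ?l * u + a * bracket u ?l"
      by (simp add: bracket_def algebra_simps)
    moreover have "bracket u ?l \<in> deep_ideal"
      by (rule bracket_with_L2_in_deep_ideal[OF bracket_L2])
    ultimately show "a * u \<in> T"
      using a is_ideal_add[OF I is_ideal_right[OF I] is_ideal_left[OF I]] by (simp add: T_def)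
  qed
  have lT: "?l \<in> T"
    using is_ideal_left[OF I bracket_sq_deep, of "sc (1/2)" gx gy]
    by (simp add: T_def sc_half_double)
  have pl: "bracket a (p * ?l) \<in> L3" for a p
  proof (induction p rule: free_induct)
    case (1 w c)
    let ?p = "Poly_Mapping.single w c" and ?i = "num_x w" and ?j = "num_y w"
    define e where "e = bracket gx (gy ^ Suc ?j) - of_nat (Suc ?j) * (gy ^ ?j * ?l)"
    define s where "s = sc (c / of_nat (Suc ?j)) * gx ^ ?i"
    have e: "e \<in> deep_ideal"
      using bracket_power_right_deep[of gx gy "Suc ?j"] by (simp add: e_def)
    have q: "(?p - ordered_lift (poly_of_free ?p)) * ?l \<in> deep_ideal"
      using sub_ordered_lift_in_ideal[OF T lT, of ?p] by (simp add: T_def)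
    have "s * (of_nat (Suc ?j) * (gy ^ ?j * ?l))
        = sc (c / of_nat (Suc ?j)) * (of_nat (Suc ?j) * (gx ^ ?i * (gy ^ ?j * ?l)))"
      unfolding s_def by (simp only: mult.assoc mult_of_nat_commute)
    also have "\<dots> = ordered_lift (poly_of_free ?p) * ?l"
      unfolding sc_div_cancel by (simp add: poly_of_free_single ordered_lift_mon mult.assoc)
    finally have "?p * ?l = (?p - ordered_lift (poly_of_free ?p)) * ?l - s * e + s * bracket gx (gy ^ Suc ?j)"
      by (simp add: e_def algebra_simps)
    moreover have "s * bracket gx (gy ^ Suc ?j) = bracket gx (s * gy ^ Suc ?j)"
      unfolding s_def by (simp only: bracket_sc_right bracket_power_self mult.assoc)
    ultimately have eq: "bracket a (?p * ?l)
        = bracket a ((?p - ordered_lift (poly_of_free ?p)) * ?l - s * e)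
          + bracket a (bracket gx (s * gy ^ Suc ?j))"
      by (simp only: bracket_add_right)
    have "bracket a ((?p - ordered_lift (poly_of_free ?p)) * ?l - s * e) \<in> L3"
      by (intro deep_idealD is_ideal_diff[OF I] q is_ideal_left[OF I] e)
    then show ?case
      unfolding eq by (rule bracket_span_add) (rule bracket_bracket_L3)
  next
    case (2 p q)
    then show ?case by (simp only: distrib_right bracket_add_right bracket_span_add)
  qed
  have "bracket a (u * ?l * v) \<in> L3" for a u v
  proof -
    have "bracket a (u * ?l * v) = bracket a (v * u * ?l) + bracket a (bracket (u * ?l) v)"
      by (simp add: bracket_def algebra_simps)
    then show ?thesis
      using bracket_span_add[OF pl bracket_bracket_L3] by metis
  qed
  then show ?thesis by (simp add: deep_ideal_def)
qed

lemma bracket_kernel_L3: "poly_of_free z = 0 \<Longrightarrow> bracket a z \<in> L3"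
  by (rule deep_idealD, rule poly_of_free_kernel[OF deep_ideal_is_ideal bracket_xy_in_deep_ideal])

text \<open>Replacing \<open>q\<close> by the ordered monomial \<open>y\<^sup>j x\<^sup>i\<close>, both \<open>(j + 1) [y, y\<^sup>j x\<^sup>i]\<close> and
  \<open>- i [x, x\<^bsup>i-1\<^esup> y\<^bsup>j+1\<^esup>]\<close> are congruent to \<open>[y\<^bsup>j+1\<^esup>, x\<^sup>i]\<close>.\<close>

lemma bracket_y_reduces_to_x: "\<exists>t. bracket gy q - bracket gx t \<in> L3"
proof (induction q rule: free_induct)
  case (1 w c)
  let ?i = "num_x w" and ?j = "num_y w"
  define e where "e = sc (c / of_nat (Suc ?j))"
  define q where "q = gy ^ ?j * gx ^ ?i"
  define u where "u = gx ^ (?i - 1) * gy ^ Suc ?j"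
  have "poly_of_free (Poly_Mapping.single w c - sc c * q) = 0"
    unfolding q_def poly_of_free_diff poly_of_free_mult poly_of_free_power
      poly_of_free_sc poly_of_free_gx poly_of_free_gy poly_of_free_single[of w] mon_eq
    by (simp only: mult_ac diff_self)
  then have A: "bracket gy (Poly_Mapping.single w c - sc c * q) \<in> L3"
    by (rule bracket_kernel_L3)
  have "bracket (gy ^ Suc ?j) (gx ^ ?i) - of_nat (Suc ?j) * bracket gy q \<in> L3"
    using bracket_power_left[of gy "Suc ?j" "gx ^ ?i"] by (simp add: q_def)
  moreover have "bracket (gx ^ ?i) (gy ^ Suc ?j) - of_nat ?i * bracket gx u \<in> L3"
    using bracket_power_left[of gx ?i "gy ^ Suc ?j"] by (simp add: u_def)
  ultimately have "- ((bracket (gy ^ Suc ?j) (gx ^ ?i) - of_nat (Suc ?j) * bracket gy q)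
      + (bracket (gx ^ ?i) (gy ^ Suc ?j) - of_nat ?i * bracket gx u)) \<in> L3"
    by (intro bracket_span_minus bracket_span_add)
  then have "of_nat (Suc ?j) * bracket gy q + of_nat ?i * bracket gx u \<in> L3"
    unfolding bracket_skew[of "gx ^ ?i" "gy ^ Suc ?j"] by (simp add: algebra_simps)
  then have "e * (of_nat (Suc ?j) * bracket gy q + of_nat ?i * bracket gx u) \<in> L3"
    unfolding e_def by (rule bracket_span_sc)
  moreover have "e * (of_nat (Suc ?j) * bracket gy q + of_nat ?i * bracket gx u)
      = bracket gy (sc c * q) + bracket gx (e * (of_nat ?i * u))"
    unfolding distrib_left e_def sc_div_cancel
    by (simp only: bracket_sc_right of_nat_eq_sc)
  ultimately have "bracket gy (Poly_Mapping.single w c - sc c * q)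
      + (bracket gy (sc c * q) + bracket gx (e * (of_nat ?i * u))) \<in> L3"
    using bracket_span_add[OF A] by metis
  then have "bracket gy (Poly_Mapping.single w c) - bracket gx (- (e * (of_nat ?i * u))) \<in> L3"
    by (simp add: bracket_diff_right) (simp add: bracket_def algebra_simps)
  then show ?case by blast
next
  case (2 p q)
  then obtain s t where "bracket gy p - bracket gx s \<in> L3" "bracket gy q - bracket gx t \<in> L3"
    by blast
  from bracket_span_add[OF this] have "bracket gy (p + q) - bracket gx (s + t) \<in> L3"
    by (simp add: bracket_add_right algebra_simps)
  then show ?case by blast
qed

lemma L2_reduces_to_bracket_x:
  assumes "z \<in> (L2 :: free set)"
  shows "\<exists>t. z - bracket gx t \<in> L3"
proof -
  let ?S = "{z. \<exists>t. z - bracket gx t \<in> L3}"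
  have S_add: "y + z \<in> ?S" if yz: "y \<in> ?S" "z \<in> ?S" for y z
  proof -
    from yz obtain s t where "y - bracket gx s \<in> L3" "z - bracket gx t \<in> L3" by blast
    from bracket_span_add[OF this] have "(y + z) - bracket gx (s + t) \<in> L3"
      by (simp add: bracket_add_right algebra_simps)
    then show ?thesis by blast
  qed
  have zero: "0 \<in> ?S"
    by (auto intro!: exI[of _ 0] simp: bracket_zero_right bracket_span.zero)
  have letter: "bracket (Poly_Mapping.single (Word [a]) 1) q \<in> ?S" for a q
    using bracket_y_reduces_to_x[of q]
    by (cases a) (auto intro!: exI[of _ q] simp: bracket_span.zero)
  have word: "bracket (Poly_Mapping.single (Word l) c) q \<in> ?S" for l c q
  proof (induction l arbitrary: q)
    case Nil
    have "bracket (Poly_Mapping.single (Word []) c) q = 0"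
      unfolding bracket_def using sc_commute[of c q] by (simp add: zero_word_def)
    then show ?case using zero by simp
  next
    case (Cons a l)
    show ?case
      unfolding single_Cons[of a l] bracket_mult_left by (rule S_add[OF letter Cons])
  qed
  have bracket: "bracket p q \<in> ?S" for p q
  proof (induction p rule: free_induct)
    case (1 w c)
    show ?case using word[of "letters w"] by simp
  next
    case (2 p p')
    then show ?case unfolding bracket_add_left by (rule S_add)
  qed
  from assms have "z \<in> ?S"
  proof induction
    case (step z b a)
    then show ?case by (intro S_add bracket)
  qed (rule zero)
  then show ?thesis by simp
qed

text \<open>Injectivity of \<open>[a, b] \<mapsto> da \<and> db\<close> on \<open>L\<^sub>2/L\<^sub>3\<close>: modulo \<^term>\<open>L3\<close> an element of \<^term>\<open>L2\<close>
  is \<open>[x, t]\<close>, with image \<open>t\<^sub>y\<close>; if this vanishes, \<open>t\<close> is a polynomial in \<open>x\<close>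
  up to the kernel of abelianization.\<close>

lemma L2_theta_kernel:
  assumes z: "z \<in> (L2 :: free set)" and 0: "theta z = 0"
  shows "z \<in> L3"
proof -
  obtain t where t: "z - bracket gx t \<in> L3"
    using L2_reduces_to_bracket_x[OF z] by blast
  have "theta (bracket gx t) = 0"
    using theta_L3[OF t] 0 by (simp add: theta_diff)
  then have "dy (poly_of_free t) = 0"
    by (simp add: theta_bracket poisson_def)
  then obtain p where p: "poly_of_free t = [:p:]"
    by (auto simp: pderiv_eq_0_iff elim: degree_eq_zeroE)
  have "\<exists>t0. poly_of_free t0 = [:p:] \<and> bracket gx t0 = 0"
  proof (induction p)
    case 0
    then show ?case by (intro exI[of _ 0]) (simp add: bracket_zero_right)
  next
    case (pCons a p)
    then obtain t0 where t0: "poly_of_free t0 = [:p:]" "bracket gx t0 = 0" by blast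
    have "poly_of_free (sc a + gx * t0) = [:pCons a p:]"
      by (simp add: poly_of_free_add poly_of_free_mult t0)
    moreover have "bracket gx (sc a + gx * t0) = bracket gx (sc a) + gx * bracket gx t0"
      by (simp add: bracket_def algebra_simps)
    then have "bracket gx (sc a + gx * t0) = 0"
      using t0 sc_commute[of a gx] by (simp add: bracket_def)
    ultimately show ?case by blast
  qed
  then obtain t0 where t0: "poly_of_free t0 = [:p:]" "bracket gx t0 = 0" by blast
  then have "bracket gx (t - t0) \<in> L3"
    by (intro bracket_kernel_L3) (simp add: poly_of_free_diff p)
  with t0 have "bracket gx t \<in> L3" by (simp add: bracket_diff_right)
  from bracket_span_add[OF t this] show ?thesis by simp
qed

section \<open>Gradings and the Euler identity\<close>

definition supp_in :: "(nat \<times> nat) set \<Rightarrow> bipoly set" where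
  "supp_in A = {g. \<forall>i j. coef g i j \<noteq> 0 \<longrightarrow> (i, j) \<in> A}"

lemma supp_in_zero: "0 \<in> supp_in A"
  by (simp add: supp_in_def)

lemma supp_in_add: "g \<in> supp_in A \<Longrightarrow> h \<in> supp_in A \<Longrightarrow> g + h \<in> supp_in A"
  unfolding supp_in_def by (auto) (metis add_0)

lemma supp_in_smult: "g \<in> supp_in A \<Longrightarrow> Polynomial.smult [:c:] g \<in> supp_in A"
  by (simp add: supp_in_def)

lemma mon_in_supp_in: "(i, j) \<in> A \<Longrightarrow> mon c i j \<in> supp_in A"
  by (simp add: supp_in_def split: if_splits)

lemma supp_in_induct [consumes 1, case_names mon zero add]:
  assumes "g \<in> supp_in A" and "\<And>c i j. (i, j) \<in> A \<Longrightarrow> Q (mon c i j)"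
    and "Q 0" and "\<And>p q. Q p \<Longrightarrow> Q q \<Longrightarrow> Q (p + q)"
  shows "Q g"
  by (rule bipoly_induct_support) (use assms in \<open>auto simp: supp_in_def\<close>)

lemma supp_in_mult:
  assumes g: "g \<in> supp_in A" and h: "h \<in> supp_in B"
    and "\<And>i j k l. (i, j) \<in> A \<Longrightarrow> (k, l) \<in> B \<Longrightarrow> (i + k, j + l) \<in> C"
  shows "g * h \<in> supp_in C"
  using g
proof (induction rule: supp_in_induct)
  case (mon c i j)
  note ij = mon
  from h show ?case
    by (induction rule: supp_in_induct)
      (auto simp only: mon_mult mult_zero_right distrib_left supp_in_zero
        intro!: mon_in_supp_in assms(3) ij supp_in_add)
qed (auto simp: supp_in_zero distrib_right intro: supp_in_add)

lemma supp_in_dx: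
  assumes g: "g \<in> supp_in A" and "\<And>i j. (Suc i, j) \<in> A \<Longrightarrow> (i, j) \<in> C"
  shows "dx g \<in> supp_in C"
  using assms by (auto simp: supp_in_def coeff_pderiv)

lemma supp_in_dy:
  assumes g: "g \<in> supp_in A" and "\<And>i j. (i, Suc j) \<in> A \<Longrightarrow> (i, j) \<in> C"
  shows "dy g \<in> supp_in C"
  using assms by (auto simp: supp_in_def coeff_pderiv of_nat_poly)

definition weight :: "nat \<Rightarrow> nat \<Rightarrow> nat \<Rightarrow> (nat \<times> nat) set" where
  "weight s r m = {(i, j). s * i + r * j = m}"

text \<open>The monomials \<open>x\<^sup>i y\<^sup>j\<close> for which \<open>x\<^sup>i y\<^sup>j dx \<and> dy\<close> has degree \<open>m\<close>.\<close>

definition form_weight :: "nat \<Rightarrow> nat \<Rightarrow> nat \<Rightarrow> (nat \<times> nat) set" where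
  "form_weight s r m = {(i, j). s * i + r * j + s + r = m}"

lemma poly_grading_eq: "poly_grading s r m = supp_in (weight s r m)"
  by (simp add: poly_grading_def supp_in_def weight_def)

lemma poly_of_free_graded:
  assumes "p \<in> free_grading s r m"
  shows "poly_of_free p \<in> supp_in (weight s r m)"
proof (rule free_induct_support[of p])
  fix w c assume "w \<in> Poly_Mapping.keys p"
  with assms show "poly_of_free (Poly_Mapping.single w c) \<in> supp_in (weight s r m)"
    unfolding poly_of_free_single
    by (intro mon_in_supp_in) (auto simp: free_grading_def weight_def)
qed (auto simp: poly_of_free_add supp_in_zero intro: supp_in_add)

lemma theta_letters_graded:
  "theta_letters l \<in> supp_in (form_weight s r (s * count_list l GenX + r * count_list l GenY))"
proof (induction l)
  case Nil
  show ?case by (simp add: supp_in_zero)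
next
  case (Cons a l)
  let ?i = "count_list l GenX" and ?j = "count_list l GenY"
  show ?case
  proof (cases a)
    case GenX
    have "mon 1 1 0 * theta_letters l \<in> supp_in (form_weight s r (s * Suc ?i + r * ?j))"
      by (rule supp_in_mult[OF mon_in_supp_in[of _ _ "{(1, 0)}"] Cons]) (auto simp: form_weight_def)
    then show ?thesis
      using GenX PX_power[of 1] by simp
  next
    case GenY
    have 1: "mon 1 0 1 * theta_letters l \<in> supp_in (form_weight s r (s * ?i + r * Suc ?j))"
      by (rule supp_in_mult[OF mon_in_supp_in[of _ _ "{(0, 1)}"] Cons]) (auto simp: form_weight_def)
    have "mon (- of_nat ?i) (?i - 1) ?j \<in> supp_in (form_weight s r (s * ?i + r * Suc ?j))"
    proof (cases ?i)
      case 0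
      then show ?thesis by (simp add: supp_in_zero)
    next
      case (Suc k)
      then show ?thesis by (intro mon_in_supp_in) (auto simp: form_weight_def)
    qed
    then have 2: "- dx (mon 1 ?i ?j) \<in> supp_in (form_weight s r (s * ?i + r * Suc ?j))"
      unfolding dx_mon minus_monom by simp
    show ?thesis
      using supp_in_add[OF 1 2] GenY PY_power[of 1] by simp
  qed
qed

lemma theta_graded:
  assumes "p \<in> free_grading s r m"
  shows "theta p \<in> supp_in (form_weight s r m)"
proof (rule free_induct_support[of p])
  fix w c assume "w \<in> Poly_Mapping.keys p"
  with assms have "s * num_x w + r * num_y w = m"
    by (simp add: free_grading_def)
  with theta_letters_graded[of "letters w" s r]
  show "theta (Poly_Mapping.single w c) \<in> supp_in (form_weight s r m)"
    by (simp add: theta_single supp_in_smult)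
qed (auto simp: theta_add supp_in_zero intro: supp_in_add)

lemma free_grading_add: "p \<in> free_grading s r m \<Longrightarrow> q \<in> free_grading s r m \<Longrightarrow> p + q \<in> free_grading s r m"
  using Poly_Mapping.keys_add[of p q] by (auto simp: free_grading_def)

lemma free_grading_zero: "0 \<in> free_grading s r m"
  by (simp add: free_grading_def)

lemma free_grading_diff: "p \<in> free_grading s r m \<Longrightarrow> q \<in> free_grading s r m \<Longrightarrow> p - q \<in> free_grading s r m"
  by (auto simp: free_grading_def in_keys_iff lookup_minus)

lemma free_grading_mult:
  assumes "p \<in> free_grading s r m" "q \<in> free_grading s r n"
  shows "p * q \<in> free_grading s r (m + n)"
proof -
  have "s * num_x w + r * num_y w = m + n" if w: "w \<in> Poly_Mapping.keys (p * q)" for w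
  proof -
    obtain u v where "w = u + v" "u \<in> Poly_Mapping.keys p" "v \<in> Poly_Mapping.keys q"
      using Poly_Mapping.keys_mult[of p q] w by blast
    with assms show ?thesis
      by (auto simp: free_grading_def plus_word_def algebra_simps)
  qed
  then show ?thesis by (simp add: free_grading_def)
qed

lemma sc_graded: "sc c \<in> free_grading s r 0"
  and gx_graded: "gx \<in> free_grading s r s"
  and gy_graded: "gy \<in> free_grading s r r"
  by (auto simp: free_grading_def zero_word_def)

lemma free_grading_power: "p \<in> free_grading s r m \<Longrightarrow> p ^ n \<in> free_grading s r (n * m)"
proof (induction n)
  case 0
  then show ?case using sc_graded[of 1] by simp
next
  case (Suc n)
  then show ?case using free_grading_mult[of p s r m "p ^ n" "n * m"] by simp
qed

lemma ordered_monomial_graded: "sc c * gx ^ i * gy ^ j \<in> free_grading s r (s * i + r * j)"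
proof -
  have "sc c * gx ^ i * gy ^ j \<in> free_grading s r (0 + i * s + j * r)"
    by (intro free_grading_mult free_grading_power sc_graded gx_graded gy_graded)
  then show ?thesis by (simp add: mult.commute)
qed

lemma poly_of_free_ordered_monomial: "poly_of_free (sc c * gx ^ i * gy ^ j) = mon c i j"
  unfolding poly_of_free_mult poly_of_free_power poly_of_free_sc poly_of_free_gx poly_of_free_gy mon_eq ..

lemma poly_of_free_graded_surj:
  assumes "g \<in> supp_in (weight s r m)"
  shows "\<exists>p \<in> free_grading s r m. poly_of_free p = g"
  using assms
proof (induction rule: supp_in_induct)
  case (mon c i j)
  then show ?case
    using ordered_monomial_graded[of c i j s r] poly_of_free_ordered_monomial
    by (auto simp: weight_def)
next
  case zero
  show ?case by (rule bexI[of _ 0]) (simp_all add: free_grading_zero)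
next
  case (add p q)
  then show ?case by (metis free_grading_add poly_of_free_add)
qed

lemma poly_of_free_surj: "\<exists>p. poly_of_free p = g"
  by (induction g rule: bipoly_induct)
    (use poly_of_free_ordered_monomial poly_of_free_add in metis)+

lemma theta_L2_mon: "\<exists>z \<in> L2 \<inter> free_grading s r (s * i + r * j + s + r). theta z = mon c i j"
proof -
  let ?t = "sc (c / of_nat (Suc j)) * gx ^ i * gy ^ Suc j"
  have "theta (bracket gx ?t) = mon c i j"
    unfolding theta_bracket poly_of_free_ordered_monomial
    by (simp add: poisson_def dy_mon of_nat_Suc[symmetric] del: of_nat_Suc)
  moreover have "bracket gx ?t \<in> free_grading s r (s * i + r * j + s + r)"
  proof -
    have "gx * ?t \<in> free_grading s r (s + (s * i + r * Suc j))"
      by (intro free_grading_mult gx_graded ordered_monomial_graded)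
    moreover have "?t * gx \<in> free_grading s r ((s * i + r * Suc j) + s)"
      by (intro free_grading_mult gx_graded ordered_monomial_graded)
    ultimately show ?thesis
      unfolding bracket_def by (intro free_grading_diff) (simp_all add: algebra_simps)
  qed
  ultimately show ?thesis using bracket_L2 by blast
qed

lemma theta_L2_graded_surj:
  assumes "g \<in> supp_in (form_weight s r m)"
  shows "\<exists>z \<in> L2 \<inter> free_grading s r m. theta z = g"
  using assms
proof (induction rule: supp_in_induct)
  case (mon c i j)
  then show ?case using theta_L2_mon[of s r i j c] by (auto simp: form_weight_def)
next
  case zero
  show ?case by (rule bexI[of _ 0]) (simp_all add: free_grading_zero bracket_span.zero)
next
  case (add p q)
  then show ?case by (metis IntE IntI bracket_span_add free_grading_add theta_add)
qed

lemma theta_L2_surj: "\<exists>z \<in> L2. theta z = g"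
proof (induction g rule: bipoly_induct)
  case (1 i j c)
  show ?case using theta_L2_mon by blast
next
  case (2 p q)
  then show ?case by (metis bracket_span_add theta_add)
qed

text \<open>The homogeneous polynomials are the eigenvectors of this operator, which turns homogeneity into an
  identity that can be multiplied and cancelled.\<close>

definition euler :: "nat \<Rightarrow> nat \<Rightarrow> bipoly \<Rightarrow> bipoly" where
  "euler s r g = cst (of_nat s) * (PX * dx g) + cst (of_nat r) * (PY * dy g)"

lemma coef_PX_dx: "coef (PX * dx g) i j = of_nat i * coef g i j"
  by (simp add: coeff_pCons coeff_pderiv split: nat.split)

lemma coef_PY_dy: "coef (PY * dy g) i j = of_nat j * coef g i j"
  by (simp add: coeff_pCons coeff_pderiv of_nat_poly split: nat.split)

lemma coef_cst_mult: "coef (cst c * g) i j = c * coef g i j"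
  by simp

lemma coef_euler: "coef (euler s r g) i j = of_nat (s * i + r * j) * coef g i j"
  unfolding euler_def coeff_add coef_cst_mult coef_PX_dx coef_PY_dy by (simp add: algebra_simps)

lemma bipoly_eqI: "(\<And>i j. coef g i j = coef h i j) \<Longrightarrow> g = h"
  by (intro poly_eqI)

lemma euler_mult: "euler s r (g * h) = euler s r g * h + g * euler s r h"
  unfolding euler_def dx_mult pderiv_mult by (simp only: algebra_simps)

lemma euler_weight:
  assumes "g \<in> supp_in (weight s r m)"
  shows "euler s r g = cst (of_nat m) * g"
proof (rule bipoly_eqI)
  fix i j
  show "coef (euler s r g) i j = coef (cst (of_nat m) * g) i j"
    unfolding coef_euler coef_cst_mult using assms
    by (cases "coef g i j = 0") (auto simp: supp_in_def weight_def)
qed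

text \<open>By the product rule for the Euler operator, \<open>g\<close> is again an eigenvector: \<open>E(g) + d g = m g\<close>. The
  conclusion is stated without subtracting \<open>d\<close> from \<open>m\<close>, so that it forces \<open>g = 0\<close> for \<open>m < d\<close>.\<close>

lemma cofactor_homogeneous:
  assumes f: "f \<in> supp_in (weight s r d)" "f \<noteq> 0" and gf: "g * f \<in> supp_in (weight s r m)"
  shows "g \<in> supp_in {(i, j). s * i + r * j + d = m}"
proof -
  have "(euler s r g + cst (of_nat d) * g - cst (of_nat m) * g) * f = 0"
    using euler_weight[OF gf] unfolding euler_mult euler_weight[OF f(1)]
    by (simp add: algebra_simps del: mult_pCons_left mult_pCons_right)
  then have "euler s r g + cst (of_nat d) * g = cst (of_nat m) * g"
    using f(2) by (simp del: mult_pCons_left)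
  then have "coef (euler s r g) i j + coef (cst (of_nat d) * g) i j = coef (cst (of_nat m) * g) i j" for i j
    by (metis coeff_add)
  then have "of_nat (s * i + r * j + d) * coef g i j = of_nat m * coef g i j" for i j
    unfolding coef_euler coef_cst_mult by (simp add: algebra_simps)
  then show ?thesis
    unfolding supp_in_def by (auto simp del: of_nat_add of_nat_mult)
qed

section \<open>The Jacobian ideal\<close>

definition jacobian :: "bipoly \<Rightarrow> bipoly set" where
  "jacobian f = {u * dx f + v * dy f | u v. True}"

lemma jacobianI: "u * dx f + v * dy f \<in> jacobian f"
  by (auto simp: jacobian_def)

lemma jacobian_zero: "0 \<in> jacobian f"
  using jacobianI[of 0 f 0] by simp

lemma jacobian_add: "g \<in> jacobian f \<Longrightarrow> h \<in> jacobian f \<Longrightarrow> g + h \<in> jacobian f"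
proof -
  assume "g \<in> jacobian f" "h \<in> jacobian f"
  then obtain u v u' v' where "g = u * dx f + v * dy f" "h = u' * dx f + v' * dy f"
    by (auto simp: jacobian_def)
  then have "g + h = (u + u') * dx f + (v + v') * dy f" by (simp add: algebra_simps)
  then show ?thesis by (simp only: jacobianI)
qed

lemma jacobian_mult: "g \<in> jacobian f \<Longrightarrow> w * g \<in> jacobian f"
proof -
  assume "g \<in> jacobian f"
  then obtain u v where "g = u * dx f + v * dy f"
    by (auto simp: jacobian_def)
  then have "w * g = (w * u) * dx f + (w * v) * dy f" by (simp add: algebra_simps)
  then show ?thesis by (simp only: jacobianI)
qed

lemma jacobian_mult_right: "g \<in> jacobian f \<Longrightarrow> g * w \<in> jacobian f"
  using jacobian_mult[of g f w] by (simp only: mult.commute)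

lemma jacobian_minus: "g \<in> jacobian f \<Longrightarrow> - g \<in> jacobian f"
  using jacobian_mult[of g f "- 1"] by simp

lemma jacobian_diff: "g \<in> jacobian f \<Longrightarrow> h \<in> jacobian f \<Longrightarrow> g - h \<in> jacobian f"
  using jacobian_add[of g f "- h"] jacobian_minus[of h f] by simp

lemma dx_in_jacobian: "dx f \<in> jacobian f"
  using jacobianI[of 1 f 0] by simp

lemma dy_in_jacobian: "dy f \<in> jacobian f"
  using jacobianI[of 0 f 1] by simp

lemma self_in_jacobian:
  assumes f: "f \<in> supp_in (weight s r d)" and d: "d \<ge> 1"
  shows "f \<in> jacobian f"
proof -
  have "cst (1 / of_nat d) * euler s r f = cst (1 / of_nat d) * cst (of_nat d) * f"
    unfolding euler_weight[OF f] by (simp only: mult.assoc)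
  also have "\<dots> = f" using d by simp
  finally have "f = cst (1 / of_nat d) * euler s r f" ..
  moreover have "euler s r f \<in> jacobian f"
    unfolding euler_def by (intro jacobian_add jacobian_mult dx_in_jacobian dy_in_jacobian)
  ultimately show ?thesis using jacobian_mult by metis
qed

text \<open>As an ideal containing \<open>P\<close> this set contains \<open>\<langle>P\<rangle>\<close>, so on \<open>\<langle>P\<rangle>\<close> the map \<^const>\<open>theta\<close> is
  linear over the polynomials up to the Jacobian ideal. The reason is that the deformation of the
  product contributes \<open>u\<^sub>y (gf)\<^sub>x\<close> or \<open>(gf)\<^sub>y u\<^sub>x\<close>, combinations of \<open>f\<close> and its partial derivatives.\<close>

lemma theta_on_ideal:
  fixes P :: free
  defines "f \<equiv> poly_of_free P"
  assumes f: "f \<in> jacobian f"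
  shows "is_ideal {z. \<exists>g. poly_of_free z = g * f \<and> theta z - g * theta P \<in> jacobian f}"
    (is "is_ideal ?D")
  unfolding is_ideal_def
proof (intro conjI ballI allI)
  show "0 \<in> ?D" by (auto intro!: exI[of _ 0] simp: jacobian_zero)
next
  fix a b assume "a \<in> ?D" "b \<in> ?D"
  then obtain g h where "poly_of_free a = g * f" "theta a - g * theta P \<in> jacobian f"
    "poly_of_free b = h * f" "theta b - h * theta P \<in> jacobian f" by auto
  moreover have "theta (a + b) - (g + h) * theta P = (theta a - g * theta P) + (theta b - h * theta P)"
    by (simp add: theta_add algebra_simps)
  ultimately have "poly_of_free (a + b) = (g + h) * f \<and> theta (a + b) - (g + h) * theta P \<in> jacobian f"
    by (metis jacobian_add poly_of_free_add distrib_right)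
  then show "a + b \<in> ?D" by blast
next
  fix z u assume "z \<in> ?D"
  then obtain g where g: "poly_of_free z = g * f" "theta z - g * theta P \<in> jacobian f" by auto
  let ?u = "poly_of_free u"
  have "theta (u * z) - (?u * g) * theta P = ?u * (theta z - g * theta P)
      + (theta u * g - dy ?u * dx g) * f - (dy ?u * g) * dx f"
    unfolding theta_mult g(1) dx_mult by (simp only: algebra_simps)
  also have "\<dots> \<in> jacobian f"
    by (intro jacobian_add jacobian_diff jacobian_mult g f dx_in_jacobian)
  finally have "poly_of_free (u * z) = (?u * g) * f
      \<and> theta (u * z) - (?u * g) * theta P \<in> jacobian f"
    by (simp add: poly_of_free_mult g mult.assoc)
  then show "u * z \<in> ?D" by blast
  have "theta (z * u) - (?u * g) * theta P = ?u * (theta z - g * theta P)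
      + (g * theta u - dy g * dx ?u) * f - (g * dx ?u) * dy f"
    unfolding theta_mult g(1) pderiv_mult by (simp only: algebra_simps)
  also have "\<dots> \<in> jacobian f"
    by (intro jacobian_add jacobian_diff jacobian_mult g f dy_in_jacobian)
  finally have "poly_of_free (z * u) = (?u * g) * f
      \<and> theta (z * u) - (?u * g) * theta P \<in> jacobian f"
    by (simp add: poly_of_free_mult g mult_ac)
  then show "z * u \<in> ?D" by blast
qed

lemma self_in_theta_ideal:
  "P \<in> {z. \<exists>g. poly_of_free z = g * poly_of_free P \<and> theta z - g * theta P \<in> jacobian (poly_of_free P)}"
  by (auto intro!: exI[of _ 1] simp: jacobian_zero)

text \<open>The brackets \<open>[a, gP]\<close> realize \<open>{a, gf}\<close>. With the Euler operator \<open>E\<close>, Euler's identity for \<open>f\<close> gives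
  \<open>(E(g) + (d + r) g) f\<^sub>x = - d {y, gf} - r {yg, f}\<close>, and \<open>E(g) + (d + r) g\<close> is a positive multiple of \<open>g\<close> if
  \<open>g\<close> is a monomial; likewise for \<open>f\<^sub>y\<close>.\<close>

lemma jacobian_from_ideal:
  fixes P :: free
  defines "f \<equiv> poly_of_free P"
  assumes I: "is_ideal I" "P \<in> I"
    and f: "f \<in> supp_in (weight s r d)" and d: "d \<ge> 1"
    and h: "h \<in> jacobian f"
  shows "\<exists>z \<in> L2 \<inter> I. theta z = h"
proof -
  let ?S = "{h. \<exists>z \<in> L2 \<inter> I. theta z = h}"
  have add: "g + h \<in> ?S" if "g \<in> ?S" "h \<in> ?S" for g h
  proof -
    from that obtain y z where "y \<in> L2" "y \<in> I" "theta y = g" "z \<in> L2" "z \<in> I" "theta z = h"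
      by blast
    then have "y + z \<in> L2 \<inter> I" "theta (y + z) = g + h"
      by (simp_all add: theta_add bracket_span_add is_ideal_add[OF I(1)])
    then show ?thesis by blast
  qed
  have cst: "cst c * h \<in> ?S" if "h \<in> ?S" for c h
  proof -
    from that obtain z where z: "z \<in> L2" "z \<in> I" "theta z = h" by auto
    have "theta (sc c * z) = cst c * h"
      unfolding theta_mult poly_of_free_L2[OF z(1)] poly_of_free_sc z(3)
      by (simp add: theta_single zero_word_def)
    then show ?thesis
      using z bracket_span_sc is_ideal_left[OF I(1)] by blast
  qed
  have poisson: "poisson a (g * f) \<in> ?S" for a g
  proof -
    obtain p q where "poly_of_free p = a" "poly_of_free q = g"
      using poly_of_free_surj by metis
    then have "theta (bracket p (q * P)) = poisson a (g * f)"
      by (simp add: theta_bracket poly_of_free_mult f_def)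
    moreover have "bracket p (q * P) \<in> I"
      unfolding bracket_def
      by (intro is_ideal_diff[OF I(1)] is_ideal_left[OF I(1)] is_ideal_right[OF I(1)] I(2))
    ultimately show ?thesis using bracket_L2 by blast
  qed
  have scale: "h \<in> ?S" if "cst (of_nat n) * h \<in> ?S" "n > 0" for h n
  proof -
    have "cst (1 / of_nat n) * (cst (of_nat n) * h) = h"
    proof -
      have "cst (1 / of_nat n) * cst (of_nat n) = 1"
        using that(2) by simp
      then show ?thesis unfolding mult.assoc[symmetric] by simp
    qed
    with cst[OF that(1), of "1 / of_nat n"] show ?thesis by simp
  qed
  have ef: "cst (of_nat d) * f = euler s r f"
    by (rule euler_weight[OF f, symmetric])
  have cst_minus: "cst (- c) = - cst c" for c
    by (simp only: minus_pCons minus_zero)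
  have poisson_rel_x: "(euler s r g + (cst (of_nat d) + cst (of_nat r)) * g) * dx f
      = - cst (of_nat d) * poisson PY (g * f) - cst (of_nat r) * poisson (PY * g) (1 * f)" for g
  proof -
    have "- cst (of_nat d) * poisson PY (g * f) = dx g * (cst (of_nat d) * f) + cst (of_nat d) * g * dx f"
      unfolding poisson_def dx_mult dx_PY dy_PY mult_zero_left mult_1_left
      by (simp add: algebra_simps del: mult_pCons_left mult_pCons_right minus_pCons add_pCons)
    then show ?thesis
      unfolding ef euler_def poisson_def dx_mult pderiv_mult dx_PY dy_PY mult_1_left mult_zero_left
      by (simp add: algebra_simps del: mult_pCons_left mult_pCons_right minus_pCons add_pCons)
  qed
  have poisson_rel_y: "(euler s r g + (cst (of_nat d) + cst (of_nat s)) * g) * dy f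
      = cst (of_nat d) * poisson PX (g * f) + cst (of_nat s) * poisson (PX * g) (1 * f)" for g
  proof -
    have "cst (of_nat d) * poisson PX (g * f) = dy g * (cst (of_nat d) * f) + cst (of_nat d) * g * dy f"
      unfolding poisson_def pderiv_mult dx_PX dy_PX mult_zero_left mult_1_left
      by (simp add: algebra_simps del: mult_pCons_left mult_pCons_right minus_pCons add_pCons)
    then show ?thesis
      unfolding ef euler_def poisson_def dx_mult pderiv_mult dx_PX dy_PX mult_1_left mult_zero_left
      by (simp add: algebra_simps del: mult_pCons_left mult_pCons_right minus_pCons add_pCons)
  qed
  have Eg: "euler s r (mon c i j) = cst (of_nat (s * i + r * j)) * mon c i j" for c i j
    by (rule euler_weight, rule mon_in_supp_in) (simp add: weight_def)
  have gx: "mon c i j * dx f \<in> ?S" for c i j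
  proof -
    let ?g = "mon c i j"
    have "cst (of_nat (s * i + r * j + d + r)) * (?g * dx f)
        = (euler s r ?g + (cst (of_nat d) + cst (of_nat r)) * ?g) * dx f"
      unfolding Eg by (simp add: smult_add_left[symmetric] algebra_simps)
    also have "\<dots> = - cst (of_nat d) * poisson PY (?g * f) - cst (of_nat r) * poisson (PY * ?g) (1 * f)"
      unfolding poisson_rel_x ..
    also have "\<dots> = cst (- of_nat d) * poisson PY (?g * f) + cst (- of_nat r) * poisson (PY * ?g) (1 * f)"
      by (simp only: cst_minus mult_minus_left diff_conv_add_uminus)
    also have "\<dots> \<in> ?S" by (rule add[OF cst[OF poisson] cst[OF poisson]])
    finally show ?thesis by (rule scale) (use d in simp)
  qed
  have gy: "mon c i j * dy f \<in> ?S" for c i j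
  proof -
    let ?g = "mon c i j"
    have "cst (of_nat (s * i + r * j + d + s)) * (?g * dy f)
        = (euler s r ?g + (cst (of_nat d) + cst (of_nat s)) * ?g) * dy f"
      unfolding Eg by (simp add: smult_add_left[symmetric] algebra_simps)
    also have "\<dots> = cst (of_nat d) * poisson PX (?g * f) + cst (of_nat s) * poisson (PX * ?g) (1 * f)"
      unfolding poisson_rel_y ..
    also have "\<dots> \<in> ?S" by (rule add[OF cst[OF poisson] cst[OF poisson]])
    finally show ?thesis by (rule scale) (use d in simp)
  qed
  obtain u v where uv: "h = u * dx f + v * dy f"
    using h by (auto simp: jacobian_def)
  have "u * dx f \<in> ?S"
  proof (induction u rule: bipoly_induct)
    case (1 i j c)
    show ?case by (rule gx)
  next
    case (2 p q)
    then show ?case unfolding distrib_right by (rule add)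
  qed
  moreover have "v * dy f \<in> ?S"
  proof (induction v rule: bipoly_induct)
    case (1 i j c)
    show ?case by (rule gy)
  next
    case (2 p q)
    then show ?case unfolding distrib_right by (rule add)
  qed
  ultimately show ?thesis using add uv by blast
qed

text \<open>A common prime factor \<open>p\<close> of the partial derivatives divides \<open>f\<close> by Euler's identity, and only
  once; so \<open>p\<close> divides its own partial derivatives and is constant.\<close>

lemma partials_coprime:
  assumes sf: "squarefree f" and f: "f \<in> jacobian f"
  shows "coprime (dx f) (dy f)"
proof (rule ccontr)
  assume "\<not> coprime (dx f) (dy f)"
  then obtain c where c: "c dvd dx f" "c dvd dy f" "\<not> c dvd 1"
    by (auto simp: coprime_def)
  have "f \<noteq> 0" using sf by auto
  with f have "dx f \<noteq> 0 \<or> dy f \<noteq> 0"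
    by (auto simp: jacobian_def)
  with c have "c \<noteq> 0" by auto
  with c(3) obtain p where "p dvd c" "prime p"
    using prime_divisor_exists by blast
  with c have p: "prime p" "p dvd dx f" "p dvd dy f"
    using dvd_trans by blast+
  then have pe: "prime_elem p" by blast
  obtain u v where "f = u * dx f + v * dy f"
    using f by (auto simp: jacobian_def)
  with p have "p dvd f" by (metis dvd_add dvd_mult)
  then obtain g where g: "f = p * g" ..
  have "\<not> p dvd g"
  proof
    assume "p dvd g"
    then have "p ^ 2 dvd f" unfolding g by (simp add: power2_eq_square mult_dvd_mono)
    with sf have "p dvd 1" by (auto simp: squarefree_def)
    with pe show False by (simp add: prime_elem_def)
  qed
  have "p dvd dx p * g"
    using p(2) unfolding g dx_mult by (metis dvd_add_right_iff dvd_triv_left)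
  with \<open>\<not> p dvd g\<close> have px: "p dvd dx p"
    using pe prime_elem_dvd_multD by blast
  have "p dvd g * dy p"
    using p(3) unfolding g pderiv_mult by (metis dvd_add_right_iff dvd_triv_left)
  with \<open>\<not> p dvd g\<close> have "p dvd dy p"
    using pe prime_elem_dvd_multD by blast
  then have "degree p = 0"
    using not_dvd_pderiv by blast
  then obtain a where a: "p = [:a:]" by (rule degree_eq_zeroE)
  have "dx p = [:pderiv a:]"
    unfolding a by (rule poly_eqI) (simp add: coeff_pCons split: nat.split)
  with px have "a dvd pderiv a"
    unfolding a by (simp add: const_poly_dvd_const_poly_iff)
  then have "degree a = 0"
    using not_dvd_pderiv by blast
  then obtain c where c: "a = [:c:]" by (rule degree_eq_zeroE)
  have "p \<noteq> 0" using pe by auto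
  then have "c \<noteq> 0" using a c by auto
  then have "p dvd 1" unfolding a c
    by (simp add: is_unit_const_poly_iff dvd_field_iff)
  with pe show False by (simp add: prime_elem_def)
qed

lemma partials_syzygy:
  assumes "coprime (dx f) (dy f)" "dx f \<noteq> 0" and eq: "u * dx f + v * dy f = 0"
  shows "\<exists>w. u = w * dy f \<and> v = - w * dx f"
proof -
  have "dx f dvd v * dy f"
  proof
    show "v * dy f = dx f * (- u)" using eq by (simp add: eq_neg_iff_add_eq_0 algebra_simps)
  qed
  then have "dx f dvd v" using assms(1) coprime_dvd_mult_left_iff by blast
  then obtain w where w: "v = dx f * w" ..
  have "dx f * u = dx f * (- w * dy f)"
    using eq unfolding w by (simp add: eq_neg_iff_add_eq_0 algebra_simps)
  then have "u = - w * dy f" using assms(2) by (simp only: mult_cancel_left) simp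
  then show ?thesis using w by (intro exI[of _ "- w"]) (simp add: mult.commute)
qed

section \<open>Quotients of modules and rings\<close>

text \<open>The structures defined as quotients carry no axioms; they inherit them along the projections.\<close>

lemma module_surj_image:
  assumes M: "module K M"
    and surj: "h ` carrier M = carrier N"
    and add: "\<And>x y. x \<in> carrier M \<Longrightarrow> y \<in> carrier M \<Longrightarrow> h (x \<oplus>\<^bsub>M\<^esub> y) = h x \<oplus>\<^bsub>N\<^esub> h y"
    and smult: "\<And>c x. c \<in> carrier K \<Longrightarrow> x \<in> carrier M \<Longrightarrow> h (c \<odot>\<^bsub>M\<^esub> x) = c \<odot>\<^bsub>N\<^esub> h x"
    and zero: "h \<zero>\<^bsub>M\<^esub> = \<zero>\<^bsub>N\<^esub>"
  shows "module K N"
proof -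
  interpret module K M by (rule M)
  have ex: "\<exists>x\<in>carrier M. X = h x" if "X \<in> carrier N" for X
    using that surj by blast
  have mem: "h x \<in> carrier N" if "x \<in> carrier M" for x
    using that surj by blast
  have add': "h x \<oplus>\<^bsub>N\<^esub> h y = h (x \<oplus>\<^bsub>M\<^esub> y)" if "x \<in> carrier M" "y \<in> carrier M" for x y
    using add that by simp
  have smult': "c \<odot>\<^bsub>N\<^esub> h x = h (c \<odot>\<^bsub>M\<^esub> x)" if "c \<in> carrier K" "x \<in> carrier M" for c x
    using smult that by simp
  show ?thesis
  proof (rule module_criteria)
    show "cring K" by (rule R.is_cring)
    show "\<forall>v\<in>carrier N. \<exists>w\<in>carrier N. v \<oplus>\<^bsub>N\<^esub> w = \<zero>\<^bsub>N\<^esub>"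
    proof
      fix v assume "v \<in> carrier N"
      then obtain x where x: "x \<in> carrier M" "v = h x" using ex by blast
      then have "v \<oplus>\<^bsub>N\<^esub> h (\<ominus>\<^bsub>M\<^esub> x) = \<zero>\<^bsub>N\<^esub>"
        by (simp add: add' M.r_neg zero)
      with x show "\<exists>w\<in>carrier N. v \<oplus>\<^bsub>N\<^esub> w = \<zero>\<^bsub>N\<^esub>"
        using mem by blast
    qed
  qed (auto dest!: ex simp: add' smult' mem M.a_ac smult_assoc1 smult_l_distr
      smult_r_distr simp flip: zero)
qed

lemma quot_module_simps:
  "carrier (quot_module M N) = (\<lambda>x. N +>\<^bsub>M\<^esub> x) ` carrier M"
  "\<zero>\<^bsub>quot_module M N\<^esub> = N"
  "\<one>\<^bsub>quot_module M N\<^esub> = N +>\<^bsub>M\<^esub> \<one>\<^bsub>M\<^esub>"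
  "X \<oplus>\<^bsub>quot_module M N\<^esub> Y = X <+>\<^bsub>M\<^esub> Y"
  "X \<otimes>\<^bsub>quot_module M N\<^esub> Y = rcoset_mult M N X Y"
  "c \<odot>\<^bsub>quot_module M N\<^esub> X = (\<Union>x\<in>X. N +>\<^bsub>M\<^esub> (c \<odot>\<^bsub>M\<^esub> x))"
  by (auto simp: quot_module_def A_RCOSETS_def RCOSETS_def a_r_coset_def)

locale module_quotient =
  fixes K :: "('k, 'l) ring_scheme" and M :: "('k, 'a, 'm) module_scheme" and N
  assumes submod: "submodule K N M"
begin

sublocale module K M
  using submod by (simp add: submodule_def)

lemma sub: "abelian_subgroup N M"
proof (rule abelian_subgroupI3)
  have "subgroup N (add_monoid M)"
  proof (rule M.add.subgroupI)
    show "N \<subseteq> carrier M" "N \<noteq> {}"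
      using submod by (auto simp: submodule_def)
    show "a \<oplus>\<^bsub>M\<^esub> b \<in> N" if "a \<in> N" "b \<in> N" for a b
      using submod that by (auto simp: submodule_def)
    show "\<ominus>\<^bsub>M\<^esub> a \<in> N" if "a \<in> N" for a
    proof -
      have "a \<in> carrier M" using submod that by (auto simp: submodule_def)
      then have "\<ominus>\<^bsub>M\<^esub> a = (\<ominus>\<^bsub>K\<^esub> \<one>\<^bsub>K\<^esub>) \<odot>\<^bsub>M\<^esub> a"
        by (simp add: smult_l_minus)
      then show ?thesis using submod that by (auto simp: submodule_def)
    qed
  qed
  then show "additive_subgroup N M" by (rule additive_subgroup.intro)
  show "abelian_group M" by (rule M.abelian_group_axioms)
qed

sublocale sub: abelian_subgroup N M
  by (rule sub)

abbreviation cls where "cls x \<equiv> N +>\<^bsub>M\<^esub> x"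

lemma cls_eq_iff:
  assumes "x \<in> carrier M" "y \<in> carrier M"
  shows "cls x = cls y \<longleftrightarrow> x \<ominus>\<^bsub>M\<^esub> y \<in> N"
proof
  assume "cls x = cls y"
  then have "x \<in> cls y" using assms sub.a_rcos_self by blast
  then show "x \<ominus>\<^bsub>M\<^esub> y \<in> N"
    using assms sub.a_rcos_module[of y x] by (simp add: a_minus_def)
next
  assume "x \<ominus>\<^bsub>M\<^esub> y \<in> N"
  then have "x \<in> cls y"
    using assms sub.a_rcos_module[of y x] by (simp add: a_minus_def)
  then show "cls x = cls y"
    using assms M.a_repr_independence[of x N y] sub.a_subgroup by blast
qed

lemma cls_add:
  "x \<in> carrier M \<Longrightarrow> y \<in> carrier M \<Longrightarrow> cls (x \<oplus>\<^bsub>M\<^esub> y) = cls x \<oplus>\<^bsub>quot_module M N\<^esub> cls y"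
  by (simp add: quot_module_simps sub.a_rcos_sum)

lemma cls_zero: "cls \<zero>\<^bsub>M\<^esub> = \<zero>\<^bsub>quot_module M N\<^esub>"
  using sub.a_subset sub.a_rcos_const[of "\<zero>\<^bsub>M\<^esub>"] sub.zero_closed by (simp add: quot_module_simps)

lemma cls_smult:
  assumes c: "c \<in> carrier K" and x: "x \<in> carrier M"
  shows "cls (c \<odot>\<^bsub>M\<^esub> x) = c \<odot>\<^bsub>quot_module M N\<^esub> cls x"
proof -
  have "cls (c \<odot>\<^bsub>M\<^esub> y) = cls (c \<odot>\<^bsub>M\<^esub> x)" if y: "y \<in> cls x" for y
  proof -
    have yc: "y \<in> carrier M"
      using y x sub.a_elemrcos_carrier by blast
    then have "y \<ominus>\<^bsub>M\<^esub> x \<in> N"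
      using y x sub.a_rcos_module[of x y] by (simp add: a_minus_def)
    then have "c \<odot>\<^bsub>M\<^esub> (y \<ominus>\<^bsub>M\<^esub> x) \<in> N"
      using submod c by (auto simp: submodule_def)
    moreover have "c \<odot>\<^bsub>M\<^esub> (y \<ominus>\<^bsub>M\<^esub> x) = c \<odot>\<^bsub>M\<^esub> y \<ominus>\<^bsub>M\<^esub> c \<odot>\<^bsub>M\<^esub> x"
      using c x yc by (simp add: a_minus_def smult_r_distr smult_r_minus)
    ultimately show ?thesis
      using cls_eq_iff c x yc by simp
  qed
  moreover have "x \<in> cls x" using x by (rule sub.a_rcos_self)
  ultimately have "(\<Union>y\<in>cls x. cls (c \<odot>\<^bsub>M\<^esub> y)) = cls (c \<odot>\<^bsub>M\<^esub> x)" by blast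
  then show ?thesis by (simp only: quot_module_simps)
qed

lemma cls_closed: "x \<in> carrier M \<Longrightarrow> cls x \<in> carrier (quot_module M N)"
  by (simp add: quot_module_simps)

lemma quotient_is_module: "module K (quot_module M N)"
  by (rule module_surj_image[OF module_axioms, of cls])
    (simp_all add: quot_module_simps(1) cls_add cls_smult cls_zero)

lemma cls_eq_zero_iff: "x \<in> carrier M \<Longrightarrow> cls x = \<zero>\<^bsub>quot_module M N\<^esub> \<longleftrightarrow> x \<in> N"
  using cls_eq_iff[of x "\<zero>\<^bsub>M\<^esub>"] M.minus_equality[of "\<zero>\<^bsub>M\<^esub>" "\<zero>\<^bsub>M\<^esub>"]
  by (simp add: cls_zero a_minus_def)

end

lemma quot_module_ring:
  assumes "ideal N M"
  shows "ring (quot_module M N)" and "(\<lambda>x. N +>\<^bsub>M\<^esub> x) \<in> Ring.ring_hom M (quot_module M N)"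
proof -
  interpret ideal N M by (rule assms)
  show hom: "(\<lambda>x. N +>\<^bsub>M\<^esub> x) \<in> Ring.ring_hom M (quot_module M N)"
    by (rule ring_hom_memI) (simp_all add: quot_module_simps rcoset_mult_add a_rcos_sum)
  have "N +>\<^bsub>M\<^esub> \<zero>\<^bsub>M\<^esub> = N"
    using a_rcos_const[of "\<zero>\<^bsub>M\<^esub>"] zero_closed by simp
  moreover have carrier: "a_rcosets\<^bsub>M\<^esub> N = (\<lambda>x. N +>\<^bsub>M\<^esub> x) ` carrier M"
    by (auto simp: A_RCOSETS_def RCOSETS_def a_r_coset_def)
  ultimately show "ring (quot_module M N)"
    using ring.ring_hom_imp_img_ring[OF ring_axioms hom]
    by (simp add: carrier quot_module_def)
qed

text \<open>Comparing both spaces with a third one, here a space of polynomials, spares a choice of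
  representatives in either of them.\<close>

lemma iso_from_common_source:
  assumes V: "vectorspace K V" and W: "vectorspace K W"
    and S: "module K S"
    and p: "p ` carrier S = carrier V" and q: "q ` carrier S = carrier W"
    and p_add: "\<And>x y. x \<in> carrier S \<Longrightarrow> y \<in> carrier S \<Longrightarrow> p (x \<oplus>\<^bsub>S\<^esub> y) = p x \<oplus>\<^bsub>V\<^esub> p y"
    and q_add: "\<And>x y. x \<in> carrier S \<Longrightarrow> y \<in> carrier S \<Longrightarrow> q (x \<oplus>\<^bsub>S\<^esub> y) = q x \<oplus>\<^bsub>W\<^esub> q y"
    and p_smult: "\<And>c x. c \<in> carrier K \<Longrightarrow> x \<in> carrier S \<Longrightarrow> p (c \<odot>\<^bsub>S\<^esub> x) = c \<odot>\<^bsub>V\<^esub> p x"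
    and q_smult: "\<And>c x. c \<in> carrier K \<Longrightarrow> x \<in> carrier S \<Longrightarrow> q (c \<odot>\<^bsub>S\<^esub> x) = c \<odot>\<^bsub>W\<^esub> q x"
    and ker: "\<And>x y. x \<in> carrier S \<Longrightarrow> y \<in> carrier S \<Longrightarrow> p x = p y \<longleftrightarrow> q x = q y"
    and D: "\<And>m. D m \<subseteq> carrier S"
    and G: "\<And>m. p ` D m = G m" and H: "\<And>m. q ` D m = H m"
  shows "\<exists>f. graded_linear_iso K V G W H f \<and> (\<forall>x \<in> carrier S. f (p x) = q x)"
proof -
  interpret S: module K S by (rule S)
  interpret V: vectorspace K V by (rule V)
  interpret W: vectorspace K W by (rule W)
  define f where "f X = q (SOME x. x \<in> carrier S \<and> p x = X)" for X
  have f: "f (p x) = q x" if x: "x \<in> carrier S" for x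
  proof -
    have "\<exists>y. y \<in> carrier S \<and> p y = p x" using x by blast
    then have "(SOME y. y \<in> carrier S \<and> p y = p x) \<in> carrier S
        \<and> p (SOME y. y \<in> carrier S \<and> p y = p x) = p x"
      by (rule someI_ex)
    then show ?thesis
      unfolding f_def using ker x by blast
  qed
  have ex: "\<exists>x\<in>carrier S. X = p x" if "X \<in> carrier V" for X
    using that p by blast
  have "f \<in> module_hom K V W"
    unfolding module_hom_def
  proof (intro CollectI conjI allI impI)
    show "f \<in> carrier V \<rightarrow> carrier W"
      using ex f q by (auto 4 3)
    show "f (X \<oplus>\<^bsub>V\<^esub> Y) = f X \<oplus>\<^bsub>W\<^esub> f Y" if XY: "X \<in> carrier V \<and> Y \<in> carrier V" for X Y
    proof -
      obtain x y where xy: "x \<in> carrier S" "X = p x" "y \<in> carrier S" "Y = p y"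
        using ex XY by blast
      then have "X \<oplus>\<^bsub>V\<^esub> Y = p (x \<oplus>\<^bsub>S\<^esub> y)" by (simp add: p_add)
      then show ?thesis using xy by (simp add: f q_add)
    qed
    show "f (c \<odot>\<^bsub>V\<^esub> X) = c \<odot>\<^bsub>W\<^esub> f X" if cX: "c \<in> carrier K \<and> X \<in> carrier V" for c X
    proof -
      obtain x where x: "x \<in> carrier S" "X = p x"
        using ex cX by blast
      then have "c \<odot>\<^bsub>V\<^esub> X = p (c \<odot>\<^bsub>S\<^esub> x)" using cX by (simp add: p_smult)
      then show ?thesis using x cX by (simp add: f q_smult)
    qed
  qed
  then have "linear_map K V W f"
    by (intro linear_map.intro mod_hom.intro mod_hom_axioms.intro V W V.module_axioms W.module_axioms)
  moreover have "bij_betw f (carrier V) (carrier W)"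
  proof (rule bij_betw_imageI)
    show "inj_on f (carrier V)"
    proof (rule inj_onI)
      fix X Y assume "X \<in> carrier V" "Y \<in> carrier V" and eq: "f X = f Y"
      then obtain x y where "x \<in> carrier S" "X = p x" "y \<in> carrier S" "Y = p y"
        using ex by metis
      then show "X = Y" using eq ker by (simp add: f)
    qed
    show "f ` carrier V = carrier W"
      unfolding p[symmetric] q[symmetric] by (auto simp: f image_iff)
  qed
  moreover have "f ` G m = H m" for m
  proof -
    have "f ` p ` D m = q ` D m"
      using f D[of m] by (auto simp: image_image subset_iff)
    then show ?thesis by (simp add: G H)
  qed
  ultimately show ?thesis
    using f unfolding graded_linear_iso_def by blast
qed

section \<open>Free modules\<close>

lemma free_module_simps:
  "carrier (free_module R S) = {f. (\<forall>i\<in>S. f i \<in> carrier R) \<and> (\<forall>i. i \<notin> S \<longrightarrow> f i = \<zero>\<^bsub>R\<^esub>) \<and> finite {i. f i \<noteq> \<zero>\<^bsub>R\<^esub>}}"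
  "\<zero>\<^bsub>free_module R S\<^esub> = (\<lambda>i. \<zero>\<^bsub>R\<^esub>)"
  "f \<oplus>\<^bsub>free_module R S\<^esub> g = (\<lambda>i. f i \<oplus>\<^bsub>R\<^esub> g i)"
  "c \<odot>\<^bsub>free_module R S\<^esub> f = (\<lambda>i. c \<otimes>\<^bsub>R\<^esub> f i)"
  by (simp_all add: free_module_def)

lemma free_module_closed:
  assumes "f \<in> carrier (free_module R S)" "cring R"
  shows "f i \<in> carrier R"
proof -
  interpret cring R by (rule assms)
  show ?thesis using assms(1) by (cases "i \<in> S") (auto simp: free_module_simps)
qed

lemma free_module_is_module:
  assumes "cring R"
  shows "module R (free_module R S)"
proof -
  interpret cring R by (rule assms)
  have cl: "f i \<in> carrier R" if "f \<in> carrier (free_module R S)" for f i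
    using free_module_closed[OF that assms] .
  have fin: "finite {i. f i \<oplus>\<^bsub>R\<^esub> g i \<noteq> \<zero>\<^bsub>R\<^esub>}"
    if "finite {i. f i \<noteq> \<zero>\<^bsub>R\<^esub>}" "finite {i. g i \<noteq> \<zero>\<^bsub>R\<^esub>}" for f g :: "'c \<Rightarrow> 'a"
    by (rule finite_subset[of _ "{i. f i \<noteq> \<zero>\<^bsub>R\<^esub>} \<union> {i. g i \<noteq> \<zero>\<^bsub>R\<^esub>}"]) (use that in auto)
  show ?thesis
  proof (rule module_criteria)
    show "\<forall>v w. v \<in> carrier (free_module R S) \<and> w \<in> carrier (free_module R S) \<longrightarrow>
        v \<oplus>\<^bsub>free_module R S\<^esub> w \<in> carrier (free_module R S)"
      by (auto simp: free_module_simps intro: fin)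
    show "\<forall>v\<in>carrier (free_module R S). \<exists>neg_v\<in>carrier (free_module R S).
        v \<oplus>\<^bsub>free_module R S\<^esub> neg_v = \<zero>\<^bsub>free_module R S\<^esub>"
    proof
      fix v assume v: "v \<in> carrier (free_module R S)"
      have "(\<lambda>i. \<ominus>\<^bsub>R\<^esub> v i) \<in> carrier (free_module R S)"
        using v cl[OF v] by (auto simp: free_module_simps elim!: finite_subset[rotated])
      moreover have "v \<oplus>\<^bsub>free_module R S\<^esub> (\<lambda>i. \<ominus>\<^bsub>R\<^esub> v i) = \<zero>\<^bsub>free_module R S\<^esub>"
        using cl[OF v] by (simp add: free_module_simps r_neg)
      ultimately show "\<exists>neg_v\<in>carrier (free_module R S).
          v \<oplus>\<^bsub>free_module R S\<^esub> neg_v = \<zero>\<^bsub>free_module R S\<^esub>" by blast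
    qed
    show "\<forall>c v. c \<in> carrier R \<and> v \<in> carrier (free_module R S) \<longrightarrow>
        c \<odot>\<^bsub>free_module R S\<^esub> v \<in> carrier (free_module R S)"
      by (auto simp: free_module_simps elim!: finite_subset[rotated])
    show "\<zero>\<^bsub>free_module R S\<^esub> \<in> carrier (free_module R S)"
      by (simp add: free_module_simps)
  qed (auto simp only: free_module_simps(2-4) fun_eq_iff intro!: assms a_comm a_assoc m_assoc
      l_distr r_distr l_one r_zero cl)
qed

lemma free_gen_closed:
  assumes "cring R" "i \<in> S"
  shows "free_gen R i \<in> carrier (free_module R S)"
proof -
  interpret cring R by (rule assms)
  have "{j. free_gen R i j \<noteq> \<zero>\<^bsub>R\<^esub>} \<subseteq> {i}" by (auto simp: free_gen_def)
  then show ?thesis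
    using assms(2) by (auto simp: free_module_simps free_gen_def intro: finite_subset)
qed

text \<open>Serves as an induction principle: whatever holds on the generators and is stable under the module
  operations holds everywhere.\<close>

lemma free_module_generated:
  assumes R: "cring R" and N: "submodule R N (free_module R S)"
    and gen: "\<And>i. i \<in> S \<Longrightarrow> free_gen R i \<in> N" and f: "f \<in> carrier (free_module R S)"
  shows "f \<in> N"
proof -
  interpret cring R by (rule R)
  have "f \<in> N" if "finite T" "{i. f i \<noteq> \<zero>\<^bsub>R\<^esub>} \<subseteq> T" "f \<in> carrier (free_module R S)" for T f
    using that
  proof (induction T arbitrary: f rule: finite_induct)
    case empty
    then have "f = \<zero>\<^bsub>free_module R S\<^esub>" by (auto simp: free_module_simps)
    then show ?case using N by (auto simp: submodule_def)
  next
    case (insert i T)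
    note cl = free_module_closed[OF insert.prems(2) R]
    show ?case
    proof (cases "i \<in> S")
      case False
      then have "f i = \<zero>\<^bsub>R\<^esub>" using insert.prems by (auto simp: free_module_simps)
      then show ?thesis using insert.prems insert.IH[of f] by auto
    next
      case True
      let ?g = "f(i := \<zero>\<^bsub>R\<^esub>)"
      have "?g \<in> carrier (free_module R S)"
        using insert.prems(2) True
        by (auto simp: free_module_simps elim!: finite_subset[rotated])
      moreover have "{j. ?g j \<noteq> \<zero>\<^bsub>R\<^esub>} \<subseteq> T" using insert.prems(1) by auto
      ultimately have "?g \<in> N" by (intro insert.IH)
      moreover have "f i \<odot>\<^bsub>free_module R S\<^esub> free_gen R i \<in> N"
        using N gen[OF True] cl by (auto simp: submodule_def)
      moreover have "f = ?g \<oplus>\<^bsub>free_module R S\<^esub> (f i \<odot>\<^bsub>free_module R S\<^esub> free_gen R i)"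
        using cl by (auto simp: free_module_simps free_gen_def fun_eq_iff)
      ultimately show ?thesis
        using N unfolding submodule_def by metis
    qed
  qed
  then show ?thesis using f by (auto simp: free_module_simps)
qed

lemma free_quotient_generated:
  assumes R: "cring R" and N: "submodule R N (free_module R S)"
    and Q: "submodule R Q (quot_module (free_module R S) N)"
    and gen: "\<And>i. i \<in> S \<Longrightarrow> N +>\<^bsub>free_module R S\<^esub> free_gen R i \<in> Q"
  shows "carrier (quot_module (free_module R S) N) \<subseteq> Q"
proof -
  let ?F = "free_module R S"
  interpret q: module_quotient R ?F N by (rule module_quotient.intro[OF N])
  have "submodule R {x \<in> carrier ?F. q.cls x \<in> Q} ?F"
    using Q q.module_axioms unfolding submodule_def
    by (auto simp: q.cls_add q.cls_smult q.cls_zero)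
  then have "x \<in> {x \<in> carrier ?F. q.cls x \<in> Q}" if "x \<in> carrier ?F" for x
    by (rule free_module_generated[OF R _ _ that]) (use gen free_gen_closed[OF R] in auto)
  then show ?thesis by (auto simp: quot_module_simps(1))
qed

section \<open>Two-forms on a plane curve\<close>

text \<open>The derivations that descend to maps from \<open>\<complex>[x,y]/(f)\<close> to the quotient by the Jacobian ideal.\<close>

definition derivation_mod :: "bipoly \<Rightarrow> (bipoly \<Rightarrow> bipoly) \<Rightarrow> bool" where
  "derivation_mod f D \<longleftrightarrow> (\<forall>g h. D (g + h) = D g + D h) \<and> (\<forall>g h. D (g * h) = g * D h + D g * h)
     \<and> (\<forall>c. D (cst c) = 0) \<and> D f \<in> jacobian f"

lemma derivation_mod_dx: "derivation_mod f dx"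
  unfolding derivation_mod_def by (metis dx_add dx_mult dx_cst dx_in_jacobian)

lemma derivation_mod_dy: "derivation_mod f dy"
  unfolding derivation_mod_def using dy_in_jacobian[of f]
  by (simp add: pderiv_add pderiv_mult mult.commute)

lemma jacobian_sum: "(\<And>i. i \<in> T \<Longrightarrow> a i \<in> jacobian f) \<Longrightarrow> sum a T \<in> jacobian f"
  by (induction T rule: infinite_finite_induct) (auto simp: jacobian_zero intro: jacobian_add)

abbreviation Kc :: "complex ring" where "Kc \<equiv> class_ring"

text \<open>\<open>\<kappa>\<close> presents \<open>C\<close> as \<open>\<complex>[x,y]/(f)\<close>. That \<open>f\<close> lies in its Jacobian ideal is Euler's identity in the
  homogeneous case.\<close>

locale plane_curve =
  fixes C :: "(complex, 'c, 'm) module_scheme" (structure) and \<kappa> :: "bipoly \<Rightarrow> 'c" and f :: bipoly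
  assumes cring: "cring C"
    and surj: "range \<kappa> = carrier C"
    and \<kappa>_add: "\<kappa> (g + h) = \<kappa> g \<oplus> \<kappa> h"
    and \<kappa>_mult: "\<kappa> (g * h) = \<kappa> g \<otimes> \<kappa> h"
    and \<kappa>_one: "\<kappa> 1 = \<one>" and \<kappa>_zero: "\<kappa> 0 = \<zero>"
    and \<kappa>_smult: "\<kappa> (cst c * g) = c \<odot> \<kappa> g"
    and \<kappa>_eq_iff: "\<kappa> g = \<kappa> h \<longleftrightarrow> f dvd g - h"
    and f_jacobian: "f \<in> jacobian f"
begin

sublocale C: cring C by (rule cring)

lemma \<kappa>_closed [simp]: "\<kappa> g \<in> carrier C"
  using surj by blast

definition cong :: "bipoly \<Rightarrow> bipoly \<Rightarrow> bool" (infix "\<approx>" 50) where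
  "g \<approx> h \<longleftrightarrow> g - h \<in> jacobian f"

lemma cong_refl: "g \<approx> g"
  by (simp add: cong_def jacobian_zero)

lemma cong_sym: "g \<approx> h \<Longrightarrow> h \<approx> g"
  unfolding cong_def using jacobian_minus[of "g - h" f] by simp

lemma cong_trans [trans]: "g \<approx> h \<Longrightarrow> h \<approx> k \<Longrightarrow> g \<approx> k"
  unfolding cong_def using jacobian_add[of "g - h" f "h - k"] by simp

lemma cong_add: "g \<approx> h \<Longrightarrow> g' \<approx> h' \<Longrightarrow> g + g' \<approx> h + h'"
  unfolding cong_def using jacobian_add[of "g - h" f "g' - h'"] by (simp add: algebra_simps)

lemma cong_diff: "g \<approx> h \<Longrightarrow> g' \<approx> h' \<Longrightarrow> g - g' \<approx> h - h'"
  unfolding cong_def using jacobian_diff[of "g - h" f "g' - h'"] by (simp add: algebra_simps)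

lemma cong_mult: "g \<approx> h \<Longrightarrow> g' \<approx> h' \<Longrightarrow> g * g' \<approx> h * h'"
proof -
  assume "g \<approx> h" "g' \<approx> h'"
  then have "g * (g' - h') + h' * (g - h) \<in> jacobian f"
    unfolding cong_def by (intro jacobian_add jacobian_mult)
  then show ?thesis by (simp add: cong_def algebra_simps)
qed

lemma cong_sum: "(\<And>i. i \<in> T \<Longrightarrow> a i \<approx> b i) \<Longrightarrow> sum a T \<approx> sum b T"
  unfolding cong_def by (simp add: jacobian_sum flip: sum_subtractf)

lemma cong_zero_iff: "g \<approx> 0 \<longleftrightarrow> g \<in> jacobian f"
  by (simp add: cong_def)

text \<open>Maps out of modules over \<open>C\<close> are written with chosen polynomial representatives. They need to be
  additive and linear only up to \<open>\<approx>\<close>, which spares a second quotient as target.\<close>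

definition rep :: "'c \<Rightarrow> bipoly" where
  "rep X = (SOME g. \<kappa> g = X)"

lemma \<kappa>_rep: "X \<in> carrier C \<Longrightarrow> \<kappa> (rep X) = X"
  unfolding rep_def surj[symmetric] by (rule someI_ex) auto

lemma cong_of_\<kappa>_eq: "\<kappa> g = \<kappa> h \<Longrightarrow> g \<approx> h"
  unfolding \<kappa>_eq_iff cong_def using f_jacobian jacobian_mult_right by (auto elim!: dvdE)

lemma derivation_cong_of_\<kappa>_eq:
  assumes D: "derivation_mod f D" and "\<kappa> g = \<kappa> h"
  shows "D g \<approx> D h"
proof -
  obtain k where k: "g - h = f * k" using assms(2) by (auto simp: \<kappa>_eq_iff)
  then have "g = h + f * k" by (simp add: algebra_simps)
  then have "D g - D h = f * D k + D f * k" using D by (simp add: derivation_mod_def)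
  also have "\<dots> \<in> jacobian f"
    using D f_jacobian by (intro jacobian_add jacobian_mult_right) (auto simp: derivation_mod_def)
  finally show ?thesis by (simp add: cong_def)
qed

definition lin_ext :: "('i \<Rightarrow> bipoly) \<Rightarrow> ('i \<Rightarrow> 'c) \<Rightarrow> bipoly" where
  "lin_ext h \<phi> = (\<Sum>i | \<phi> i \<noteq> \<zero>. rep (\<phi> i) * h i)"

lemma rep_zero: "rep \<zero> \<approx> 0"
  and rep_one: "rep \<one> \<approx> 1"
  and rep_\<kappa>: "rep (\<kappa> g) \<approx> g"
  and rep_add: "X \<in> carrier C \<Longrightarrow> Y \<in> carrier C \<Longrightarrow> rep (X \<oplus> Y) \<approx> rep X + rep Y"
  and rep_mult: "X \<in> carrier C \<Longrightarrow> Y \<in> carrier C \<Longrightarrow> rep (X \<otimes> Y) \<approx> rep X * rep Y"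
  by (rule cong_of_\<kappa>_eq, simp add: \<kappa>_rep \<kappa>_zero \<kappa>_one \<kappa>_add \<kappa>_mult)+

lemma lin_ext_superset:
  assumes "finite T" "{i. \<phi> i \<noteq> \<zero>} \<subseteq> T"
  shows "lin_ext h \<phi> \<approx> (\<Sum>i\<in>T. rep (\<phi> i) * h i)"
proof -
  let ?S = "{i. \<phi> i \<noteq> \<zero>}"
  have "(\<Sum>i\<in>T - ?S. rep (\<phi> i) * h i) \<approx> (\<Sum>i\<in>T - ?S. 0 * h i)"
    by (intro cong_sum cong_mult cong_refl) (use rep_zero in auto)
  from cong_add[OF this cong_refl[of "lin_ext h \<phi>"]] show ?thesis
    unfolding lin_ext_def using sum.subset_diff[OF assms(2,1), of "\<lambda>i. rep (\<phi> i) * h i"]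
    by (simp add: cong_sym)
qed

context
  fixes S :: "'i set" and h :: "'i \<Rightarrow> bipoly"
begin

abbreviation "FM \<equiv> free_module C S"

lemma lin_ext_add:
  assumes "\<phi> \<in> carrier FM" "\<psi> \<in> carrier FM"
  shows "lin_ext h (\<phi> \<oplus>\<^bsub>FM\<^esub> \<psi>) \<approx> lin_ext h \<phi> + lin_ext h \<psi>"
proof -
  let ?T = "{i. \<phi> i \<noteq> \<zero>} \<union> {i. \<psi> i \<noteq> \<zero>}"
  have T: "finite ?T" using assms by (auto simp: free_module_simps)
  have cl: "\<phi> i \<in> carrier C" "\<psi> i \<in> carrier C" for i
    using free_module_closed[OF assms(1) cring] free_module_closed[OF assms(2) cring] by auto
  have "{i. \<phi> i \<oplus> \<psi> i \<noteq> \<zero>} \<subseteq> ?T" using cl by auto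
  then have "lin_ext h (\<phi> \<oplus>\<^bsub>FM\<^esub> \<psi>) \<approx> (\<Sum>i\<in>?T. rep (\<phi> i \<oplus> \<psi> i) * h i)"
    using lin_ext_superset[OF T, of "\<phi> \<oplus>\<^bsub>FM\<^esub> \<psi>" h] by (simp only: free_module_simps)
  also have "\<dots> \<approx> (\<Sum>i\<in>?T. (rep (\<phi> i) + rep (\<psi> i)) * h i)"
    by (intro cong_sum cong_mult cong_refl rep_add cl)
  also have "(\<Sum>i\<in>?T. (rep (\<phi> i) + rep (\<psi> i)) * h i)
      = (\<Sum>i\<in>?T. rep (\<phi> i) * h i) + (\<Sum>i\<in>?T. rep (\<psi> i) * h i)"
    by (simp add: distrib_right sum.distrib)
  also have "\<dots> \<approx> lin_ext h \<phi> + lin_ext h \<psi>"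
    by (intro cong_add cong_sym[OF lin_ext_superset] T) auto
  finally show ?thesis .
qed

lemma lin_ext_smult:
  assumes "\<phi> \<in> carrier FM" "c \<in> carrier C"
  shows "lin_ext h (c \<odot>\<^bsub>FM\<^esub> \<phi>) \<approx> rep c * lin_ext h \<phi>"
proof -
  let ?T = "{i. \<phi> i \<noteq> \<zero>}"
  have T: "finite ?T" using assms by (auto simp: free_module_simps)
  have cl: "\<phi> i \<in> carrier C" for i
    using free_module_closed[OF assms(1) cring] .
  have "{i. c \<otimes> \<phi> i \<noteq> \<zero>} \<subseteq> ?T" using assms(2) by auto
  then have "lin_ext h (c \<odot>\<^bsub>FM\<^esub> \<phi>) \<approx> (\<Sum>i\<in>?T. rep (c \<otimes> \<phi> i) * h i)"
    using lin_ext_superset[OF T, of "c \<odot>\<^bsub>FM\<^esub> \<phi>" h] by (simp add: free_module_simps)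
  also have "\<dots> \<approx> (\<Sum>i\<in>?T. (rep c * rep (\<phi> i)) * h i)"
    by (intro cong_sum cong_mult cong_refl rep_mult cl assms)
  also have "(\<Sum>i\<in>?T. (rep c * rep (\<phi> i)) * h i) = rep c * lin_ext h \<phi>"
    by (simp add: lin_ext_def sum_distrib_left mult.assoc)
  finally show ?thesis .
qed

lemma lin_ext_gen: "lin_ext h (free_gen C i) \<approx> h i"
proof -
  have "lin_ext h (free_gen C i) \<approx> (\<Sum>j\<in>{i}. rep (free_gen C i j) * h j)"
    by (rule lin_ext_superset) (auto simp: free_gen_def)
  also have "(\<Sum>j\<in>{i}. rep (free_gen C i j) * h j) = rep \<one> * h i"
    by (simp add: free_gen_def)
  also have "\<dots> \<approx> 1 * h i"
    by (intro cong_mult rep_one cong_refl)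
  finally show ?thesis by simp
qed

lemma lin_ext_diff:
  assumes "\<phi> \<in> carrier FM" "\<psi> \<in> carrier FM"
  shows "lin_ext h (\<phi> \<ominus>\<^bsub>FM\<^esub> \<psi>) \<approx> lin_ext h \<phi> - lin_ext h \<psi>"
proof -
  interpret F: module C FM by (rule free_module_is_module[OF cring])
  have "(\<phi> \<ominus>\<^bsub>FM\<^esub> \<psi>) \<oplus>\<^bsub>FM\<^esub> \<psi> = \<phi>"
    using assms by (simp add: a_minus_def F.a_assoc F.l_neg)
  then have "lin_ext h \<phi> \<approx> lin_ext h (\<phi> \<ominus>\<^bsub>FM\<^esub> \<psi>) + lin_ext h \<psi>"
    using lin_ext_add[of "\<phi> \<ominus>\<^bsub>FM\<^esub> \<psi>" \<psi>] assms by simp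
  from cong_diff[OF cong_sym[OF this] cong_refl[of "lin_ext h \<psi>"]] show ?thesis by simp
qed

lemma lin_ext_kernel_submodule:
  "submodule C {\<phi> \<in> carrier FM. lin_ext h \<phi> \<approx> 0} FM"
proof -
  interpret F: module C FM by (rule free_module_is_module[OF cring])
  have "lin_ext h \<zero>\<^bsub>FM\<^esub> = 0" by (simp add: lin_ext_def free_module_simps)
  moreover have "lin_ext h (\<phi> \<oplus>\<^bsub>FM\<^esub> \<psi>) \<approx> 0"
    if "\<phi> \<in> carrier FM" "\<psi> \<in> carrier FM" "lin_ext h \<phi> \<approx> 0" "lin_ext h \<psi> \<approx> 0" for \<phi> \<psi>
    using cong_trans[OF lin_ext_add[OF that(1,2)] cong_add[OF that(3,4)]] by simp
  moreover have "lin_ext h (c \<odot>\<^bsub>FM\<^esub> \<phi>) \<approx> 0"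
    if "c \<in> carrier C" "\<phi> \<in> carrier FM" "lin_ext h \<phi> \<approx> 0" for c \<phi>
    using cong_trans[OF lin_ext_smult[OF that(2,1)] cong_mult[OF cong_refl that(3)]] by simp
  ultimately show ?thesis
    by unfold_locales (auto simp: cong_refl)
qed

end

abbreviation "F1 \<equiv> free_module C (carrier C)"
abbreviation "N1 \<equiv> kaehler_relations Kc C"
abbreviation "\<Omega>1 \<equiv> Omega1 Kc C"
abbreviation "d \<equiv> differential Kc C"

sublocale F1: module C F1 by (rule free_module_is_module[OF cring])

lemma const_closed: "k \<odot> \<one> = \<kappa> (cst k)"
  using \<kappa>_smult[of k 1] by (simp add: \<kappa>_one)

definition kaehler_gens :: "('c \<Rightarrow> 'c) set" where
  "kaehler_gens =
    {free_gen C (a \<oplus> b) \<ominus>\<^bsub>F1\<^esub> (free_gen C a \<oplus>\<^bsub>F1\<^esub> free_gen C b) | a b. a \<in> carrier C \<and> b \<in> carrier C} \<union>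
    {free_gen C (a \<otimes> b) \<ominus>\<^bsub>F1\<^esub> (a \<odot>\<^bsub>F1\<^esub> free_gen C b \<oplus>\<^bsub>F1\<^esub> b \<odot>\<^bsub>F1\<^esub> free_gen C a) | a b.
      a \<in> carrier C \<and> b \<in> carrier C} \<union>
    {free_gen C (k \<odot> \<one>) | k. k \<in> carrier Kc}"

lemma kaehler_relations_eq: "N1 = LinearCombinations.module.span C F1 kaehler_gens"
  by (simp add: kaehler_relations_def kaehler_gens_def Let_def)

lemma gen1_closed [simp]: "a \<in> carrier C \<Longrightarrow> free_gen C a \<in> carrier F1"
  by (rule free_gen_closed[OF cring])

lemma kaehler_gens_closed: "kaehler_gens \<subseteq> carrier F1"
  unfolding kaehler_gens_def const_closed by auto

sublocale omega1: module_quotient C F1 N1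
  unfolding kaehler_relations_eq
  by (rule module_quotient.intro[OF F1.span_is_submodule[OF kaehler_gens_closed]])

lemma \<Omega>1_eq: "\<Omega>1 = quot_module F1 N1"
  by (simp add: Omega1_def)

sublocale O1: module C "\<Omega>1"
  unfolding \<Omega>1_eq by (rule omega1.quotient_is_module)

lemma d_eq: "d a = omega1.cls (free_gen C a)"
  by (simp add: differential_def)

lemma d_closed [simp]: "a \<in> carrier C \<Longrightarrow> d a \<in> carrier \<Omega>1"
  unfolding d_eq \<Omega>1_eq by (simp add: omega1.cls_closed)

lemma kaehler_gens_in: "x \<in> kaehler_gens \<Longrightarrow> x \<in> N1"
  unfolding kaehler_relations_eq using F1.in_own_span[OF kaehler_gens_closed] by blast

lemma d_add:
  assumes "a \<in> carrier C" "b \<in> carrier C"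
  shows "d (a \<oplus> b) = d a \<oplus>\<^bsub>\<Omega>1\<^esub> d b"
proof -
  have "d a \<oplus>\<^bsub>\<Omega>1\<^esub> d b = omega1.cls (free_gen C a \<oplus>\<^bsub>F1\<^esub> free_gen C b)"
    unfolding d_eq \<Omega>1_eq using assms by (simp add: omega1.cls_add)
  moreover have "free_gen C (a \<oplus> b) \<ominus>\<^bsub>F1\<^esub> (free_gen C a \<oplus>\<^bsub>F1\<^esub> free_gen C b) \<in> N1"
    by (rule kaehler_gens_in) (use assms in \<open>unfold kaehler_gens_def, blast\<close>)
  then have "omega1.cls (free_gen C (a \<oplus> b)) = omega1.cls (free_gen C a \<oplus>\<^bsub>F1\<^esub> free_gen C b)"
    using assms by (simp add: omega1.cls_eq_iff)
  ultimately show ?thesis by (simp add: d_eq)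
qed

lemma d_mult:
  assumes "a \<in> carrier C" "b \<in> carrier C"
  shows "d (a \<otimes> b) = a \<odot>\<^bsub>\<Omega>1\<^esub> d b \<oplus>\<^bsub>\<Omega>1\<^esub> b \<odot>\<^bsub>\<Omega>1\<^esub> d a"
proof -
  have "a \<odot>\<^bsub>\<Omega>1\<^esub> d b \<oplus>\<^bsub>\<Omega>1\<^esub> b \<odot>\<^bsub>\<Omega>1\<^esub> d a
      = omega1.cls (a \<odot>\<^bsub>F1\<^esub> free_gen C b \<oplus>\<^bsub>F1\<^esub> b \<odot>\<^bsub>F1\<^esub> free_gen C a)"
    unfolding d_eq \<Omega>1_eq using assms by (simp add: omega1.cls_add omega1.cls_smult)
  moreover have "free_gen C (a \<otimes> b)
      \<ominus>\<^bsub>F1\<^esub> (a \<odot>\<^bsub>F1\<^esub> free_gen C b \<oplus>\<^bsub>F1\<^esub> b \<odot>\<^bsub>F1\<^esub> free_gen C a) \<in> N1"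
    by (rule kaehler_gens_in) (use assms in \<open>unfold kaehler_gens_def, blast\<close>)
  then have "omega1.cls (free_gen C (a \<otimes> b))
      = omega1.cls (a \<odot>\<^bsub>F1\<^esub> free_gen C b \<oplus>\<^bsub>F1\<^esub> b \<odot>\<^bsub>F1\<^esub> free_gen C a)"
    using assms by (simp add: omega1.cls_eq_iff)
  ultimately show ?thesis by (simp add: d_eq)
qed

lemma d_const: "d (\<kappa> (cst k)) = \<zero>\<^bsub>\<Omega>1\<^esub>"
proof -
  have "free_gen C (\<kappa> (cst k)) \<in> N1"
    by (rule kaehler_gens_in) (auto simp: kaehler_gens_def const_closed)
  then show ?thesis
    unfolding d_eq \<Omega>1_eq by (simp add: omega1.cls_eq_zero_iff)
qed

definition one_form :: "bipoly \<Rightarrow> bipoly \<Rightarrow> ('c \<Rightarrow> 'c) set" where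
  "one_form g h = \<kappa> g \<odot>\<^bsub>\<Omega>1\<^esub> d (\<kappa> PX) \<oplus>\<^bsub>\<Omega>1\<^esub> \<kappa> h \<odot>\<^bsub>\<Omega>1\<^esub> d (\<kappa> PY)"

lemma one_form_closed [simp]: "one_form g h \<in> carrier \<Omega>1"
  by (simp add: one_form_def)

lemma one_form_add: "one_form g h \<oplus>\<^bsub>\<Omega>1\<^esub> one_form g' h' = one_form (g + g') (h + h')"
  unfolding one_form_def by (simp add: \<kappa>_add O1.smult_l_distr O1.M.a_ac)

lemma one_form_smult: "\<kappa> k \<odot>\<^bsub>\<Omega>1\<^esub> one_form g h = one_form (k * g) (k * h)"
  unfolding one_form_def by (simp add: \<kappa>_mult O1.smult_r_distr O1.smult_assoc1)

lemma one_form_zero: "one_form 0 0 = \<zero>\<^bsub>\<Omega>1\<^esub>"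
  by (simp add: one_form_def \<kappa>_zero)

text \<open>Both sides obey the product rule, so it suffices to compare them on constants and variables.\<close>

lemma d_\<kappa>: "d (\<kappa> g) = one_form (dx g) (dy g)"
proof -
  let ?Q = "\<lambda>g. d (\<kappa> g) = one_form (dx g) (dy g)"
  have mult: "?Q (g * h)" if "?Q g" "?Q h" for g h
    unfolding \<kappa>_mult d_mult[OF \<kappa>_closed \<kappa>_closed] that one_form_smult one_form_add dx_mult pderiv_mult
    by (simp only: mult.commute add.commute)
  have cst: "?Q (cst c)" for c
    unfolding d_const dx_cst dy_cst one_form_zero ..
  have power: "?Q (g ^ n)" if "?Q g" for g n
  proof (induction n)
    case 0
    show ?case using cst[of 1] by simp
  next
    case (Suc n)
    then show ?case unfolding power_Suc by (intro mult that)
  qed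
  have X: "?Q PX" and Y: "?Q PY"
    unfolding dx_PX dy_PX dx_PY dy_PY by (simp_all add: one_form_def \<kappa>_one \<kappa>_zero)
  show ?thesis
  proof (induction g rule: bipoly_induct)
    case (1 i j c)
    show ?case unfolding mon_eq by (intro mult cst power X Y)
  next
    case (2 p q)
    then show ?case
      unfolding \<kappa>_add d_add[OF \<kappa>_closed \<kappa>_closed] dx_add pderiv_add by (simp only: one_form_add)
  qed
qed

lemma one_forms: "W \<in> carrier \<Omega>1 \<Longrightarrow> \<exists>g h. W = one_form g h"
proof -
  assume W: "W \<in> carrier \<Omega>1"
  have "submodule C {one_form g h | g h. True} \<Omega>1"
    unfolding submodule_def
  proof (intro conjI allI impI)
    show "c \<odot>\<^bsub>\<Omega>1\<^esub> v \<in> {one_form g h | g h. True}"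
      if "c \<in> carrier C" "v \<in> {one_form g h | g h. True}" for c v
      using that one_form_smult[of "rep c"] by (auto simp: \<kappa>_rep) blast
    show "v \<oplus>\<^bsub>\<Omega>1\<^esub> w \<in> {one_form g h | g h. True}"
      if "v \<in> {one_form g h | g h. True}" "w \<in> {one_form g h | g h. True}" for v w
      using that by (auto simp: one_form_add) blast
    show "\<zero>\<^bsub>\<Omega>1\<^esub> \<in> {one_form g h | g h. True}"
      unfolding one_form_zero[symmetric] by blast
  qed (auto simp: O1.module_axioms)
  moreover have "omega1.cls (free_gen C a) \<in> {one_form g h | g h. True}" if "a \<in> carrier C" for a
    using d_\<kappa>[of "rep a"] that by (auto simp: \<kappa>_rep d_eq)
  ultimately have "carrier \<Omega>1 \<subseteq> {one_form g h | g h. True}"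
    unfolding \<Omega>1_eq by (rule free_quotient_generated[OF cring omega1.submod])
  with W show ?thesis by blast
qed

end

context plane_curve
begin

abbreviation "F2 \<equiv> free_module C (carrier \<Omega>1 \<times> carrier \<Omega>1)"
abbreviation "N2 \<equiv> wedge_relations C \<Omega>1"
abbreviation "\<Omega>2 \<equiv> exterior_square C \<Omega>1"
abbreviation wedge2 (infixl "\<and>\<and>" 75) where "wedge2 \<equiv> wedge C \<Omega>1"

sublocale F2: module C F2 by (rule free_module_is_module[OF cring])

abbreviation T where "T x y \<equiv> free_gen C (x, y)"

definition wedge_gens :: "(('c \<Rightarrow> 'c) set \<times> ('c \<Rightarrow> 'c) set \<Rightarrow> 'c) set" where
  "wedge_gens =
    {T (x \<oplus>\<^bsub>\<Omega>1\<^esub> y) z \<ominus>\<^bsub>F2\<^esub> (T x z \<oplus>\<^bsub>F2\<^esub> T y z) | x y z.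
        x \<in> carrier \<Omega>1 \<and> y \<in> carrier \<Omega>1 \<and> z \<in> carrier \<Omega>1} \<union>
    {T x (y \<oplus>\<^bsub>\<Omega>1\<^esub> z) \<ominus>\<^bsub>F2\<^esub> (T x y \<oplus>\<^bsub>F2\<^esub> T x z) | x y z.
        x \<in> carrier \<Omega>1 \<and> y \<in> carrier \<Omega>1 \<and> z \<in> carrier \<Omega>1} \<union>
    {T (c \<odot>\<^bsub>\<Omega>1\<^esub> x) y \<ominus>\<^bsub>F2\<^esub> c \<odot>\<^bsub>F2\<^esub> T x y | c x y.
        c \<in> carrier C \<and> x \<in> carrier \<Omega>1 \<and> y \<in> carrier \<Omega>1} \<union>
    {T x (c \<odot>\<^bsub>\<Omega>1\<^esub> y) \<ominus>\<^bsub>F2\<^esub> c \<odot>\<^bsub>F2\<^esub> T x y | c x y.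
        c \<in> carrier C \<and> x \<in> carrier \<Omega>1 \<and> y \<in> carrier \<Omega>1} \<union>
    {T x x | x. x \<in> carrier \<Omega>1}"

lemma wedge_relations_eq: "N2 = LinearCombinations.module.span C F2 wedge_gens"
  by (simp add: wedge_relations_def wedge_gens_def Let_def)

lemma gen2_closed [simp]: "x \<in> carrier \<Omega>1 \<Longrightarrow> y \<in> carrier \<Omega>1 \<Longrightarrow> T x y \<in> carrier F2"
  by (rule free_gen_closed[OF cring]) simp

lemma wedge_gens_closed: "wedge_gens \<subseteq> carrier F2"
  unfolding wedge_gens_def by auto

sublocale omega2: module_quotient C F2 N2
  unfolding wedge_relations_eq
  by (rule module_quotient.intro[OF F2.span_is_submodule[OF wedge_gens_closed]])

lemma \<Omega>2_eq: "\<Omega>2 = quot_module F2 N2"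
  by (simp add: exterior_square_def)

sublocale O2: module C "\<Omega>2"
  unfolding \<Omega>2_eq by (rule omega2.quotient_is_module)

lemma wedge_eq: "x \<and>\<and> y = omega2.cls (T x y)"
  by (simp add: wedge_def)

lemma wedge_closed [simp]: "x \<in> carrier \<Omega>1 \<Longrightarrow> y \<in> carrier \<Omega>1 \<Longrightarrow> x \<and>\<and> y \<in> carrier \<Omega>2"
  unfolding wedge_eq \<Omega>2_eq by (simp add: omega2.cls_closed)

lemma wedge_gens_in: "x \<in> wedge_gens \<Longrightarrow> x \<in> N2"
  unfolding wedge_relations_eq using F2.in_own_span[OF wedge_gens_closed] by blast

lemma wedge_add_left:
  assumes "x \<in> carrier \<Omega>1" "y \<in> carrier \<Omega>1" "z \<in> carrier \<Omega>1"
  shows "(x \<oplus>\<^bsub>\<Omega>1\<^esub> y) \<and>\<and> z = x \<and>\<and> z \<oplus>\<^bsub>\<Omega>2\<^esub> y \<and>\<and> z"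
proof -
  have "T (x \<oplus>\<^bsub>\<Omega>1\<^esub> y) z \<ominus>\<^bsub>F2\<^esub> (T x z \<oplus>\<^bsub>F2\<^esub> T y z) \<in> N2"
    by (rule wedge_gens_in) (use assms in \<open>unfold wedge_gens_def, blast\<close>)
  then have "omega2.cls (T (x \<oplus>\<^bsub>\<Omega>1\<^esub> y) z) = omega2.cls (T x z \<oplus>\<^bsub>F2\<^esub> T y z)"
    using assms by (simp add: omega2.cls_eq_iff)
  then show ?thesis
    unfolding wedge_eq \<Omega>2_eq using assms by (simp add: omega2.cls_add)
qed

lemma wedge_add_right:
  assumes "x \<in> carrier \<Omega>1" "y \<in> carrier \<Omega>1" "z \<in> carrier \<Omega>1"
  shows "x \<and>\<and> (y \<oplus>\<^bsub>\<Omega>1\<^esub> z) = x \<and>\<and> y \<oplus>\<^bsub>\<Omega>2\<^esub> x \<and>\<and> z"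
proof -
  have "T x (y \<oplus>\<^bsub>\<Omega>1\<^esub> z) \<ominus>\<^bsub>F2\<^esub> (T x y \<oplus>\<^bsub>F2\<^esub> T x z) \<in> N2"
    by (rule wedge_gens_in) (use assms in \<open>unfold wedge_gens_def, blast\<close>)
  then have "omega2.cls (T x (y \<oplus>\<^bsub>\<Omega>1\<^esub> z)) = omega2.cls (T x y \<oplus>\<^bsub>F2\<^esub> T x z)"
    using assms by (simp add: omega2.cls_eq_iff)
  then show ?thesis
    unfolding wedge_eq \<Omega>2_eq using assms by (simp add: omega2.cls_add)
qed

lemma wedge_smult_left:
  assumes "c \<in> carrier C" "x \<in> carrier \<Omega>1" "y \<in> carrier \<Omega>1"
  shows "(c \<odot>\<^bsub>\<Omega>1\<^esub> x) \<and>\<and> y = c \<odot>\<^bsub>\<Omega>2\<^esub> (x \<and>\<and> y)"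
proof -
  have "T (c \<odot>\<^bsub>\<Omega>1\<^esub> x) y \<ominus>\<^bsub>F2\<^esub> c \<odot>\<^bsub>F2\<^esub> T x y \<in> N2"
    by (rule wedge_gens_in) (use assms in \<open>unfold wedge_gens_def, blast\<close>)
  then have "omega2.cls (T (c \<odot>\<^bsub>\<Omega>1\<^esub> x) y) = omega2.cls (c \<odot>\<^bsub>F2\<^esub> T x y)"
    using assms by (simp add: omega2.cls_eq_iff)
  then show ?thesis
    unfolding wedge_eq \<Omega>2_eq using assms by (simp add: omega2.cls_smult)
qed

lemma wedge_smult_right:
  assumes "c \<in> carrier C" "x \<in> carrier \<Omega>1" "y \<in> carrier \<Omega>1"
  shows "x \<and>\<and> (c \<odot>\<^bsub>\<Omega>1\<^esub> y) = c \<odot>\<^bsub>\<Omega>2\<^esub> (x \<and>\<and> y)"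
proof -
  have "T x (c \<odot>\<^bsub>\<Omega>1\<^esub> y) \<ominus>\<^bsub>F2\<^esub> c \<odot>\<^bsub>F2\<^esub> T x y \<in> N2"
    by (rule wedge_gens_in) (use assms in \<open>unfold wedge_gens_def, blast\<close>)
  then have "omega2.cls (T x (c \<odot>\<^bsub>\<Omega>1\<^esub> y)) = omega2.cls (c \<odot>\<^bsub>F2\<^esub> T x y)"
    using assms by (simp add: omega2.cls_eq_iff)
  then show ?thesis
    unfolding wedge_eq \<Omega>2_eq using assms by (simp add: omega2.cls_smult)
qed

lemma wedge_self: "x \<in> carrier \<Omega>1 \<Longrightarrow> x \<and>\<and> x = \<zero>\<^bsub>\<Omega>2\<^esub>"
proof -
  assume x: "x \<in> carrier \<Omega>1"
  then have "T x x \<in> N2"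
    by (intro wedge_gens_in) (unfold wedge_gens_def, blast)
  then show ?thesis
    unfolding wedge_eq \<Omega>2_eq using x by (simp add: omega2.cls_eq_zero_iff)
qed

definition two_form :: "bipoly \<Rightarrow> 'c two_form" where
  "two_form g = \<kappa> g \<odot>\<^bsub>\<Omega>2\<^esub> (d (\<kappa> PX) \<and>\<and> d (\<kappa> PY))"

lemma two_form_closed [simp]: "two_form g \<in> carrier \<Omega>2"
  by (simp add: two_form_def)

lemma two_form_add: "two_form (g + h) = two_form g \<oplus>\<^bsub>\<Omega>2\<^esub> two_form h"
  by (simp add: two_form_def \<kappa>_add O2.smult_l_distr)

lemma two_form_mult: "two_form (k * g) = \<kappa> k \<odot>\<^bsub>\<Omega>2\<^esub> two_form g"
  by (simp add: two_form_def \<kappa>_mult O2.smult_assoc1)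

lemma two_form_zero: "two_form 0 = \<zero>\<^bsub>\<Omega>2\<^esub>"
  by (simp add: two_form_def \<kappa>_zero)

lemma wedge_one_forms: "one_form a b \<and>\<and> one_form c e = two_form (a * e - b * c)"
proof -
  let ?X = "d (\<kappa> PX)" and ?Y = "d (\<kappa> PY)"
  have XY: "?X \<and>\<and> ?Y = two_form 1"
    by (simp add: two_form_def \<kappa>_one)
  have "?Y \<and>\<and> ?X = \<ominus>\<^bsub>\<Omega>2\<^esub> (?X \<and>\<and> ?Y)"
  proof (rule O2.M.minus_equality[symmetric])
    have "\<zero>\<^bsub>\<Omega>2\<^esub> = (?X \<oplus>\<^bsub>\<Omega>1\<^esub> ?Y) \<and>\<and> (?X \<oplus>\<^bsub>\<Omega>1\<^esub> ?Y)"
      by (simp add: wedge_self)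
    also have "\<dots> = ?Y \<and>\<and> ?X \<oplus>\<^bsub>\<Omega>2\<^esub> ?X \<and>\<and> ?Y"
      by (simp add: wedge_add_left wedge_add_right) (simp add: wedge_self)
    finally show "?Y \<and>\<and> ?X \<oplus>\<^bsub>\<Omega>2\<^esub> ?X \<and>\<and> ?Y = \<zero>\<^bsub>\<Omega>2\<^esub>" ..
  qed simp_all
  moreover have "two_form (- 1) = \<ominus>\<^bsub>\<Omega>2\<^esub> (?X \<and>\<and> ?Y)"
  proof (rule O2.M.minus_equality[symmetric])
    show "two_form (- 1) \<oplus>\<^bsub>\<Omega>2\<^esub> (?X \<and>\<and> ?Y) = \<zero>\<^bsub>\<Omega>2\<^esub>"
      unfolding XY two_form_add[symmetric] by (simp add: two_form_zero)
  qed simp_all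
  ultimately have YX: "?Y \<and>\<and> ?X = two_form (- 1)" by simp
  have self: "?X \<and>\<and> ?X = two_form 0" "?Y \<and>\<and> ?Y = two_form 0"
    by (simp_all add: wedge_self two_form_zero)
  have "one_form a b \<and>\<and> one_form c e
      = \<kappa> c \<odot>\<^bsub>\<Omega>2\<^esub> (\<kappa> a \<odot>\<^bsub>\<Omega>2\<^esub> (?X \<and>\<and> ?X) \<oplus>\<^bsub>\<Omega>2\<^esub> \<kappa> b \<odot>\<^bsub>\<Omega>2\<^esub> (?Y \<and>\<and> ?X))
        \<oplus>\<^bsub>\<Omega>2\<^esub> \<kappa> e \<odot>\<^bsub>\<Omega>2\<^esub> (\<kappa> a \<odot>\<^bsub>\<Omega>2\<^esub> (?X \<and>\<and> ?Y) \<oplus>\<^bsub>\<Omega>2\<^esub> \<kappa> b \<odot>\<^bsub>\<Omega>2\<^esub> (?Y \<and>\<and> ?Y))"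
    unfolding one_form_def
    by (simp add: wedge_add_right wedge_smult_right wedge_add_left wedge_smult_left)
  also have "\<dots> = two_form (c * (a * 0 + b * - 1) + e * (a * 1 + b * 0))"
    unfolding XY YX self by (simp only: two_form_mult two_form_add)
  finally show ?thesis by (simp add: algebra_simps)
qed

lemma wedge_differentials: "d (\<kappa> g) \<and>\<and> d (\<kappa> h) = two_form (poisson g h)"
  unfolding d_\<kappa> wedge_one_forms poisson_def ..

lemma two_form_surj: "two_form ` UNIV = carrier \<Omega>2"
proof
  show "two_form ` UNIV \<subseteq> carrier \<Omega>2" by auto
  have "submodule C (two_form ` UNIV) \<Omega>2"
    unfolding submodule_def
  proof (intro conjI allI impI)
    show "c \<odot>\<^bsub>\<Omega>2\<^esub> v \<in> two_form ` UNIV" if "c \<in> carrier C" "v \<in> two_form ` UNIV" for c v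
      using that two_form_mult[of "rep c"] by (auto simp: \<kappa>_rep)
  qed (auto simp: O2.module_axioms simp flip: two_form_add two_form_zero)
  moreover have "omega2.cls (free_gen C p) \<in> two_form ` UNIV" if p: "p \<in> carrier \<Omega>1 \<times> carrier \<Omega>1" for p
  proof -
    obtain x y where xy: "p = (x, y)" "x \<in> carrier \<Omega>1" "y \<in> carrier \<Omega>1" using p by blast
    obtain a b c e where "x = one_form a b" "y = one_form c e"
      using one_forms xy by metis
    then have "omega2.cls (T x y) = two_form (a * e - b * c)"
      using wedge_one_forms by (simp add: wedge_eq)
    then show ?thesis using xy by auto
  qed
  ultimately show "carrier \<Omega>2 \<subseteq> two_form ` UNIV"
    unfolding \<Omega>2_eq by (rule free_quotient_generated[OF cring omega2.submod])
qed

text \<open>Coefficients of a one-form are well defined modulo the Jacobian ideal: a derivation of the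
  polynomial ring, read modulo the Jacobian ideal, kills the relations between differentials.\<close>

lemma derivation_kills_relations:
  assumes D: "derivation_mod f D" and x: "x \<in> N1"
  shows "lin_ext (\<lambda>a. D (rep a)) x \<approx> 0"
proof -
  let ?h = "\<lambda>a. D (rep a)"
  have D_add: "D (g + h) = D g + D h" and D_mult: "D (g * h) = g * D h + D g * h"
    and D_cst: "D (cst c) = 0" for g h c
    using D by (auto simp: derivation_mod_def)
  note rel = derivation_cong_of_\<kappa>_eq[OF D]
  have "kaehler_gens \<subseteq> {\<phi> \<in> carrier F1. lin_ext ?h \<phi> \<approx> 0}"
  proof
    fix \<phi> assume \<phi>: "\<phi> \<in> kaehler_gens"
    then have cl: "\<phi> \<in> carrier F1" using kaehler_gens_closed by blast
    from \<phi> consider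
        (add) a b where "\<phi> = free_gen C (a \<oplus> b) \<ominus>\<^bsub>F1\<^esub> (free_gen C a \<oplus>\<^bsub>F1\<^esub> free_gen C b)"
          "a \<in> carrier C" "b \<in> carrier C"
      | (mult) a b where "\<phi> = free_gen C (a \<otimes> b)
            \<ominus>\<^bsub>F1\<^esub> (a \<odot>\<^bsub>F1\<^esub> free_gen C b \<oplus>\<^bsub>F1\<^esub> b \<odot>\<^bsub>F1\<^esub> free_gen C a)"
          "a \<in> carrier C" "b \<in> carrier C"
      | (const) k where "\<phi> = free_gen C (k \<odot> \<one>)"
      unfolding kaehler_gens_def by blast
    then have "lin_ext ?h \<phi> \<approx> 0"
    proof cases
      case add
      have "lin_ext ?h \<phi> \<approx> ?h (a \<oplus> b) - (?h a + ?h b)"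
        unfolding add(1) using add(2,3)
        by (intro cong_trans[OF lin_ext_diff] cong_diff lin_ext_gen cong_trans[OF lin_ext_add] cong_add) auto
      also have "\<dots> \<approx> D (rep a + rep b) - (?h a + ?h b)"
        by (intro cong_diff cong_refl rel) (simp add: \<kappa>_rep \<kappa>_add add)
      finally show ?thesis by (simp add: D_add)
    next
      case mult
      have "lin_ext ?h \<phi> \<approx> ?h (a \<otimes> b) - (rep a * ?h b + rep b * ?h a)"
        unfolding mult(1) using mult(2,3)
        by (intro cong_trans[OF lin_ext_diff] cong_diff lin_ext_gen cong_trans[OF lin_ext_add] cong_add
            cong_trans[OF lin_ext_smult] cong_mult cong_refl) auto
      also have "\<dots> \<approx> D (rep a * rep b) - (rep a * ?h b + rep b * ?h a)"
        by (intro cong_diff cong_refl rel) (simp add: \<kappa>_rep \<kappa>_mult mult)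
      finally show ?thesis by (simp add: D_mult mult.commute)
    next
      case const
      have "lin_ext ?h \<phi> \<approx> ?h (\<kappa> (cst k))"
        unfolding const const_closed by (rule lin_ext_gen)
      also have "\<dots> \<approx> D (cst k)"
        by (rule rel) (simp add: \<kappa>_rep)
      finally show ?thesis by (simp add: D_cst)
    qed
    with cl show "\<phi> \<in> {\<phi> \<in> carrier F1. lin_ext ?h \<phi> \<approx> 0}" by simp
  qed
  from F1.span_is_subset[OF this lin_ext_kernel_submodule] x show ?thesis
    unfolding kaehler_relations_eq by blast
qed

definition coeff_of :: "(bipoly \<Rightarrow> bipoly) \<Rightarrow> ('c \<Rightarrow> 'c) set \<Rightarrow> bipoly" where
  "coeff_of D W = lin_ext (\<lambda>a. D (rep a)) (SOME \<phi>. \<phi> \<in> carrier F1 \<and> omega1.cls \<phi> = W)"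

lemma coeff_of_cls:
  assumes D: "derivation_mod f D" and \<phi>: "\<phi> \<in> carrier F1"
  shows "coeff_of D (omega1.cls \<phi>) \<approx> lin_ext (\<lambda>a. D (rep a)) \<phi>"
proof -
  let ?\<psi> = "SOME \<psi>. \<psi> \<in> carrier F1 \<and> omega1.cls \<psi> = omega1.cls \<phi>"
  have \<psi>: "?\<psi> \<in> carrier F1 \<and> omega1.cls ?\<psi> = omega1.cls \<phi>"
    by (rule someI[of _ \<phi>]) (simp add: \<phi>)
  then have "?\<psi> \<ominus>\<^bsub>F1\<^esub> \<phi> \<in> N1"
    using \<phi> omega1.cls_eq_iff by blast
  from derivation_kills_relations[OF D this]
  have "lin_ext (\<lambda>a. D (rep a)) ?\<psi> - lin_ext (\<lambda>a. D (rep a)) \<phi> \<approx> 0"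
    using cong_trans[OF cong_sym[OF lin_ext_diff]] \<psi> \<phi> by blast
  then show ?thesis by (simp add: coeff_of_def cong_def)
qed

lemma coeff_of_add:
  assumes D: "derivation_mod f D" and "x \<in> carrier \<Omega>1" "y \<in> carrier \<Omega>1"
  shows "coeff_of D (x \<oplus>\<^bsub>\<Omega>1\<^esub> y) \<approx> coeff_of D x + coeff_of D y"
proof -
  obtain \<phi> \<psi> where \<phi>\<psi>: "\<phi> \<in> carrier F1" "x = omega1.cls \<phi>" "\<psi> \<in> carrier F1" "y = omega1.cls \<psi>"
    using assms(2,3) unfolding \<Omega>1_eq quot_module_simps(1) by blast
  have "x \<oplus>\<^bsub>\<Omega>1\<^esub> y = omega1.cls (\<phi> \<oplus>\<^bsub>F1\<^esub> \<psi>)"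
    using \<phi>\<psi> by (simp add: omega1.cls_add \<Omega>1_eq)
  then have "coeff_of D (x \<oplus>\<^bsub>\<Omega>1\<^esub> y) \<approx> lin_ext (\<lambda>a. D (rep a)) (\<phi> \<oplus>\<^bsub>F1\<^esub> \<psi>)"
    using coeff_of_cls[OF D, of "\<phi> \<oplus>\<^bsub>F1\<^esub> \<psi>"] \<phi>\<psi> by simp
  also have "\<dots> \<approx> lin_ext (\<lambda>a. D (rep a)) \<phi> + lin_ext (\<lambda>a. D (rep a)) \<psi>"
    by (rule lin_ext_add) (use \<phi>\<psi> in auto)
  also have "\<dots> \<approx> coeff_of D x + coeff_of D y"
    unfolding \<phi>\<psi> by (intro cong_add cong_sym[OF coeff_of_cls] D \<phi>\<psi>)
  finally show ?thesis .
qed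

lemma coeff_of_smult:
  assumes D: "derivation_mod f D" and "c \<in> carrier C" "x \<in> carrier \<Omega>1"
  shows "coeff_of D (c \<odot>\<^bsub>\<Omega>1\<^esub> x) \<approx> rep c * coeff_of D x"
proof -
  obtain \<phi> where \<phi>: "\<phi> \<in> carrier F1" "x = omega1.cls \<phi>"
    using assms(3) unfolding \<Omega>1_eq quot_module_simps(1) by blast
  have "c \<odot>\<^bsub>\<Omega>1\<^esub> x = omega1.cls (c \<odot>\<^bsub>F1\<^esub> \<phi>)"
    using \<phi> assms(2) by (simp add: omega1.cls_smult \<Omega>1_eq)
  then have "coeff_of D (c \<odot>\<^bsub>\<Omega>1\<^esub> x) \<approx> lin_ext (\<lambda>a. D (rep a)) (c \<odot>\<^bsub>F1\<^esub> \<phi>)"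
    using coeff_of_cls[OF D, of "c \<odot>\<^bsub>F1\<^esub> \<phi>"] \<phi> assms(2) by simp
  also have "\<dots> \<approx> rep c * lin_ext (\<lambda>a. D (rep a)) \<phi>"
    by (rule lin_ext_smult) (use \<phi> assms(2) in auto)
  also have "\<dots> \<approx> rep c * coeff_of D x"
    unfolding \<phi> by (intro cong_mult cong_refl cong_sym[OF coeff_of_cls] D \<phi>)
  finally show ?thesis .
qed

lemma coeff_of_d:
  assumes D: "derivation_mod f D"
  shows "coeff_of D (d (\<kappa> g)) \<approx> D g"
proof -
  have "coeff_of D (d (\<kappa> g)) \<approx> lin_ext (\<lambda>a. D (rep a)) (free_gen C (\<kappa> g))"
    unfolding d_eq by (rule coeff_of_cls[OF D]) simp
  also have "\<dots> \<approx> D (rep (\<kappa> g))" by (rule lin_ext_gen)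
  also have "\<dots> \<approx> D g" by (rule derivation_cong_of_\<kappa>_eq[OF D]) (simp add: \<kappa>_rep)
  finally show ?thesis .
qed

definition det_of :: "('c \<Rightarrow> 'c) set \<times> ('c \<Rightarrow> 'c) set \<Rightarrow> bipoly" where
  "det_of p = coeff_of dx (fst p) * coeff_of dy (snd p) - coeff_of dy (fst p) * coeff_of dx (snd p)"

lemma det_kills_relations:
  assumes x: "x \<in> N2"
  shows "lin_ext det_of x \<approx> 0"
proof -
  note add = coeff_of_add[OF derivation_mod_dx] coeff_of_add[OF derivation_mod_dy]
  note smult = coeff_of_smult[OF derivation_mod_dx] coeff_of_smult[OF derivation_mod_dy]
  have "wedge_gens \<subseteq> {\<phi> \<in> carrier F2. lin_ext det_of \<phi> \<approx> 0}"
  proof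
    fix \<phi> assume \<phi>: "\<phi> \<in> wedge_gens"
    then have cl: "\<phi> \<in> carrier F2" using wedge_gens_closed by blast
    from \<phi> consider
        (addl) x y z where "\<phi> = T (x \<oplus>\<^bsub>\<Omega>1\<^esub> y) z \<ominus>\<^bsub>F2\<^esub> (T x z \<oplus>\<^bsub>F2\<^esub> T y z)"
          "x \<in> carrier \<Omega>1" "y \<in> carrier \<Omega>1" "z \<in> carrier \<Omega>1"
      | (addr) x y z where "\<phi> = T x (y \<oplus>\<^bsub>\<Omega>1\<^esub> z) \<ominus>\<^bsub>F2\<^esub> (T x y \<oplus>\<^bsub>F2\<^esub> T x z)"
          "x \<in> carrier \<Omega>1" "y \<in> carrier \<Omega>1" "z \<in> carrier \<Omega>1"
      | (smultl) c x y where "\<phi> = T (c \<odot>\<^bsub>\<Omega>1\<^esub> x) y \<ominus>\<^bsub>F2\<^esub> c \<odot>\<^bsub>F2\<^esub> T x y"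
          "c \<in> carrier C" "x \<in> carrier \<Omega>1" "y \<in> carrier \<Omega>1"
      | (smultr) c x y where "\<phi> = T x (c \<odot>\<^bsub>\<Omega>1\<^esub> y) \<ominus>\<^bsub>F2\<^esub> c \<odot>\<^bsub>F2\<^esub> T x y"
          "c \<in> carrier C" "x \<in> carrier \<Omega>1" "y \<in> carrier \<Omega>1"
      | (self) x where "\<phi> = T x x"
      unfolding wedge_gens_def by blast
    then have "lin_ext det_of \<phi> \<approx> 0"
    proof cases
      case addl
      have "lin_ext det_of \<phi> \<approx> det_of (x \<oplus>\<^bsub>\<Omega>1\<^esub> y, z) - (det_of (x, z) + det_of (y, z))"
        unfolding addl(1) using addl(2-)
        by (intro cong_trans[OF lin_ext_diff] cong_diff lin_ext_gen cong_trans[OF lin_ext_add] cong_add) auto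
      also have "\<dots> \<approx> ((coeff_of dx x + coeff_of dx y) * coeff_of dy z
          - (coeff_of dy x + coeff_of dy y) * coeff_of dx z) - (det_of (x, z) + det_of (y, z))"
        unfolding det_of_def fst_conv snd_conv by (intro cong_diff cong_mult cong_refl add addl)
      finally show ?thesis by (simp add: det_of_def algebra_simps)
    next
      case addr
      have "lin_ext det_of \<phi> \<approx> det_of (x, y \<oplus>\<^bsub>\<Omega>1\<^esub> z) - (det_of (x, y) + det_of (x, z))"
        unfolding addr(1) using addr(2-)
        by (intro cong_trans[OF lin_ext_diff] cong_diff lin_ext_gen cong_trans[OF lin_ext_add] cong_add) auto
      also have "\<dots> \<approx> (coeff_of dx x * (coeff_of dy y + coeff_of dy z)
          - coeff_of dy x * (coeff_of dx y + coeff_of dx z)) - (det_of (x, y) + det_of (x, z))"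
        unfolding det_of_def fst_conv snd_conv by (intro cong_diff cong_mult cong_refl add addr)
      finally show ?thesis by (simp add: det_of_def algebra_simps)
    next
      case smultl
      have "lin_ext det_of \<phi> \<approx> det_of (c \<odot>\<^bsub>\<Omega>1\<^esub> x, y) - rep c * det_of (x, y)"
        unfolding smultl(1) using smultl(2-)
        by (intro cong_trans[OF lin_ext_diff] cong_diff lin_ext_gen cong_trans[OF lin_ext_smult]
            cong_mult cong_refl) auto
      also have "\<dots> \<approx> ((rep c * coeff_of dx x) * coeff_of dy y
          - (rep c * coeff_of dy x) * coeff_of dx y) - rep c * det_of (x, y)"
        unfolding det_of_def fst_conv snd_conv by (intro cong_diff cong_mult cong_refl smult smultl)
      finally show ?thesis by (simp add: det_of_def algebra_simps)
    next
      case smultr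
      have "lin_ext det_of \<phi> \<approx> det_of (x, c \<odot>\<^bsub>\<Omega>1\<^esub> y) - rep c * det_of (x, y)"
        unfolding smultr(1) using smultr(2-)
        by (intro cong_trans[OF lin_ext_diff] cong_diff lin_ext_gen cong_trans[OF lin_ext_smult]
            cong_mult cong_refl) auto
      also have "\<dots> \<approx> (coeff_of dx x * (rep c * coeff_of dy y)
          - coeff_of dy x * (rep c * coeff_of dx y)) - rep c * det_of (x, y)"
        unfolding det_of_def fst_conv snd_conv by (intro cong_diff cong_mult cong_refl smult smultr)
      finally show ?thesis by (simp add: det_of_def algebra_simps)
    next
      case self
      have "lin_ext det_of \<phi> \<approx> det_of (x, x)"
        unfolding self by (rule lin_ext_gen)
      then show ?thesis by (simp add: det_of_def mult.commute)
    qed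
    with cl show "\<phi> \<in> {\<phi> \<in> carrier F2. lin_ext det_of \<phi> \<approx> 0}" by simp
  qed
  from F2.span_is_subset[OF this lin_ext_kernel_submodule] x show ?thesis
    unfolding wedge_relations_eq by blast
qed

text \<open>The determinant of coefficients detects that a vanishing form has its coefficient in the Jacobian
  ideal; conversely \<open>f = 0\<close> in \<open>C\<close> gives \<open>df \<and> dh = 0\<close> for all \<open>h\<close>.\<close>

lemma two_form_eq_zero_iff: "two_form g = \<zero>\<^bsub>\<Omega>2\<^esub> \<longleftrightarrow> g \<in> jacobian f"
proof
  let ?X = "d (\<kappa> PX)" and ?Y = "d (\<kappa> PY)"
  let ?t = "\<kappa> g \<odot>\<^bsub>F2\<^esub> T ?X ?Y"
  assume "two_form g = \<zero>\<^bsub>\<Omega>2\<^esub>"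
  moreover have "two_form g = omega2.cls ?t"
    unfolding two_form_def wedge_eq \<Omega>2_eq by (simp add: omega2.cls_smult)
  ultimately have "?t \<in> N2"
    by (simp add: omega2.cls_eq_zero_iff flip: \<Omega>2_eq) (simp add: \<Omega>2_eq omega2.cls_eq_zero_iff)
  then have "0 \<approx> lin_ext det_of ?t"
    using det_kills_relations cong_sym by blast
  also have "\<dots> \<approx> rep (\<kappa> g) * lin_ext det_of (T ?X ?Y)"
    by (rule lin_ext_smult) auto
  also have "\<dots> \<approx> g * (dx PX * dy PY - dy PX * dx PY)"
    by (intro cong_mult rep_\<kappa> cong_trans[OF lin_ext_gen])
      (simp only: det_of_def fst_conv snd_conv, intro cong_diff cong_mult coeff_of_d
        derivation_mod_dx derivation_mod_dy)
  finally have "0 \<approx> g" by (simp only: dx_PX dy_PX dx_PY dy_PY) simp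
  then show "g \<in> jacobian f" using cong_sym cong_zero_iff by blast
next
  assume "g \<in> jacobian f"
  then obtain u v where g: "g = u * dx f + v * dy f" by (auto simp: jacobian_def)
  have "\<kappa> f = \<kappa> 0" by (simp add: \<kappa>_eq_iff)
  then have df: "d (\<kappa> f) = \<zero>\<^bsub>\<Omega>1\<^esub>"
    using d_\<kappa>[of 0] by (simp add: one_form_zero)
  have "\<zero>\<^bsub>\<Omega>1\<^esub> = \<zero> \<odot>\<^bsub>\<Omega>1\<^esub> \<zero>\<^bsub>\<Omega>1\<^esub>" by simp
  then have zero_wedge: "\<zero>\<^bsub>\<Omega>1\<^esub> \<and>\<and> y = \<zero>\<^bsub>\<Omega>2\<^esub>" if "y \<in> carrier \<Omega>1" for y
    using wedge_smult_left[of "\<zero>" "\<zero>\<^bsub>\<Omega>1\<^esub>" y] that by simp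
  have "two_form (poisson f h) = \<zero>\<^bsub>\<Omega>2\<^esub>" for h
    using wedge_differentials[of f h] zero_wedge by (simp add: df)
  then have z: "two_form (k * poisson f h) = \<zero>\<^bsub>\<Omega>2\<^esub>" for k h
    by (simp add: two_form_mult)
  have "poisson f PY = dx f" "- 1 * poisson f PX = dy f"
    unfolding poisson_def dx_PX dy_PX dx_PY dy_PY by simp_all
  then have "g = u * poisson f PY + (v * - 1) * poisson f PX"
    unfolding g by (simp only: mult.assoc)
  then show "two_form g = \<zero>\<^bsub>\<Omega>2\<^esub>"
    by (simp only: two_form_add z) simp
qed

lemma two_form_eq_iff: "two_form g = two_form h \<longleftrightarrow> g - h \<in> jacobian f"
proof -
  have "two_form g = two_form (g - h) \<oplus>\<^bsub>\<Omega>2\<^esub> two_form h"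
    by (simp flip: two_form_add)
  then have "two_form g = two_form h \<longleftrightarrow> two_form (g - h) = \<zero>\<^bsub>\<Omega>2\<^esub>"
    by simp
  then show ?thesis by (simp add: two_form_eq_zero_iff)
qed

end

lemma supp_in_diff: "g \<in> supp_in A \<Longrightarrow> h \<in> supp_in A \<Longrightarrow> g - h \<in> supp_in A"
  unfolding supp_in_def by (auto) (metis diff_self)

lemma vectorspaceI: "module Kc V \<Longrightarrow> vectorspace Kc V"
  unfolding vectorspace_def using class_field by blast

lemma add_minus_cancel:
  assumes "abelian_group G" "x \<in> carrier G" "y \<in> carrier G"
  shows "(x \<oplus>\<^bsub>G\<^esub> y) \<ominus>\<^bsub>G\<^esub> y = x"
proof -
  interpret abelian_group G by (rule assms)
  show ?thesis using assms(2,3) by (simp add: a_minus_def a_assoc r_neg)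
qed

lemma concrete_minus:
  fixes M :: "('b::ab_group_add, 'm) ring_scheme"
  assumes M: "abelian_group M" and "carrier M = UNIV" "add M = (+)" "zero M = 0"
  shows "x \<ominus>\<^bsub>M\<^esub> y = x - y"
proof -
  interpret abelian_group M by (rule M)
  have "\<ominus>\<^bsub>M\<^esub> y = - y"
    by (rule minus_equality) (simp_all add: assms(2-))
  then show ?thesis by (simp add: a_minus_def assms(3))
qed

lemma poly_algebra_simps:
  "carrier poly_algebra = UNIV" "\<zero>\<^bsub>poly_algebra\<^esub> = 0" "\<one>\<^bsub>poly_algebra\<^esub> = 1"
  "g \<oplus>\<^bsub>poly_algebra\<^esub> h = g + h" "g \<otimes>\<^bsub>poly_algebra\<^esub> h = g * h"
  "c \<odot>\<^bsub>poly_algebra\<^esub> g = cst c * g"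
  by (simp_all add: poly_algebra_def)

lemma poly_algebra_module: "module Kc poly_algebra"
proof (rule module_criteria)
  show "cring Kc" by (rule class_cring.is_cring)
  show "\<forall>a b v. a \<in> carrier Kc \<and> b \<in> carrier Kc \<and> v \<in> carrier poly_algebra \<longrightarrow>
      (a \<oplus>\<^bsub>Kc\<^esub> b) \<odot>\<^bsub>poly_algebra\<^esub> v = a \<odot>\<^bsub>poly_algebra\<^esub> v \<oplus>\<^bsub>poly_algebra\<^esub> b \<odot>\<^bsub>poly_algebra\<^esub> v"
    unfolding poly_algebra_simps by (simp flip: smult_add_left)
  show "\<forall>v\<in>carrier poly_algebra. \<one>\<^bsub>Kc\<^esub> \<odot>\<^bsub>poly_algebra\<^esub> v = v"
    unfolding poly_algebra_simps by (metis cst_one monoid.simps(2) mult_1_left)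
qed (auto simp: poly_algebra_simps smult_add_right algebra_simps intro: exI[of _ "- _"])

lemma poly_algebra_cring: "cring poly_algebra"
  by (rule cringI)
    (auto intro!: abelian_groupI comm_monoidI exI[of _ "- _"] simp: poly_algebra_def algebra_simps)

lemma poly_algebra_minus: "x \<ominus>\<^bsub>poly_algebra\<^esub> y = x - y"
  by (rule concrete_minus[OF ring.is_abelian_group[OF cring.axioms(1)[OF poly_algebra_cring]]])
    (simp_all add: poly_algebra_def)

lemma free_algebra_smult: "c \<odot>\<^bsub>free_algebra\<^esub> p = sc c * p"
  by (simp add: free_algebra_def mult_map_scale_conv_mult zero_word_def)

lemma free_algebra_simps:
  "carrier free_algebra = UNIV" "\<zero>\<^bsub>free_algebra\<^esub> = 0" "\<one>\<^bsub>free_algebra\<^esub> = 1"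
  "p \<oplus>\<^bsub>free_algebra\<^esub> q = p + q" "p \<otimes>\<^bsub>free_algebra\<^esub> q = p * q"
  by (simp_all add: free_algebra_def)

lemma free_algebra_ring: "ring free_algebra"
proof (rule ringI)
  show "abelian_group free_algebra"
    by (rule abelian_groupI) (auto simp: free_algebra_simps algebra_simps intro: exI[of _ "- _"])
  show "Group.monoid free_algebra"
    by (rule Group.monoidI) (auto simp: free_algebra_simps mult.assoc)
qed (auto simp: free_algebra_simps algebra_simps)

lemma free_algebra_module: "module Kc free_algebra"
proof (rule module_criteria)
  show "cring Kc" by (rule class_cring.is_cring)
qed (auto simp: free_algebra_simps free_algebra_smult algebra_simps sc_mult_sc single_add
    simp flip: mult.assoc intro: exI[of _ "- _"])

lemma free_algebra_minus: "p \<ominus>\<^bsub>free_algebra\<^esub> q = p - q"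
  by (rule concrete_minus[OF ring.is_abelian_group[OF free_algebra_ring]])
    (simp_all add: free_algebra_simps fun_eq_iff)

lemma ideal_free_algebra: "ideal T free_algebra \<longleftrightarrow> is_ideal T"
proof
  assume "ideal T free_algebra"
  then interpret ideal T free_algebra .
  note add = additive_subgroup.zero_closed[OF is_additive_subgroup]
    additive_subgroup.a_closed[OF is_additive_subgroup]
  show "is_ideal T"
    unfolding is_ideal_def using add I_l_closed I_r_closed
    by (auto simp: free_algebra_simps)
next
  assume T: "is_ideal T"
  show "ideal T free_algebra"
  proof (rule idealI[OF free_algebra_ring])
    interpret ring free_algebra by (rule free_algebra_ring)
    show "subgroup T (add_monoid free_algebra)"
    proof (rule add.subgroupI)
      show "\<ominus>\<^bsub>free_algebra\<^esub> a \<in> T" if "a \<in> T" for a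
        using is_ideal_minus[OF T that] free_algebra_minus[of 0 a]
        by (simp add: a_minus_def free_algebra_simps)
    qed (use is_ideal_zero[OF T] is_ideal_add[OF T] in \<open>auto simp: free_algebra_simps\<close>)
  qed (auto simp: free_algebra_simps is_ideal_left[OF T] is_ideal_right[OF T])
qed

context plane_curve
begin

lemma Omega2_simps:
  "carrier (Omega2 Kc C) = carrier \<Omega>2" "\<zero>\<^bsub>Omega2 Kc C\<^esub> = \<zero>\<^bsub>\<Omega>2\<^esub>"
  "x \<oplus>\<^bsub>Omega2 Kc C\<^esub> y = x \<oplus>\<^bsub>\<Omega>2\<^esub> y"
  "k \<odot>\<^bsub>Omega2 Kc C\<^esub> x = \<kappa> (cst k) \<odot>\<^bsub>\<Omega>2\<^esub> x"
  by (simp_all add: Omega2_def restrict_scalars_def const_closed)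

lemma Omega2_module: "module Kc (Omega2 Kc C)"
  by (rule module_surj_image[OF poly_algebra_module, of two_form])
    (simp_all only: Omega2_simps poly_algebra_simps two_form_surj two_form_add two_form_mult two_form_zero)

sublocale Om: module Kc "Omega2 Kc C" by (rule Omega2_module)

lemma Omega2_grading_eq:
  assumes G: "\<And>m. G m = \<kappa> ` supp_in (weight s r m)"
  shows "Omega2_grading Kc C G m = two_form ` supp_in (form_weight s r m)"
proof -
  let ?gens = "{a \<odot>\<^bsub>\<Omega>2\<^esub> wedge2 (d b) (d c) | a b c i j k. a \<in> G i \<and> b \<in> G j \<and> c \<in> G k \<and> i + j + k = m}"
  have def: "Omega2_grading Kc C G m = Om.span ?gens"
    by (simp add: Omega2_grading_def)
  have sub: "?gens \<subseteq> two_form ` supp_in (form_weight s r m)"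
  proof
    fix x assume "x \<in> ?gens"
    then obtain a b c i j k where x: "x = \<kappa> a \<odot>\<^bsub>\<Omega>2\<^esub> wedge2 (d (\<kappa> b)) (d (\<kappa> c))"
      and a: "a \<in> supp_in (weight s r i)" and b: "b \<in> supp_in (weight s r j)"
      and c: "c \<in> supp_in (weight s r k)" and m: "i + j + k = m"
      unfolding G by blast
    let ?x = "\<lambda>j. {(p, q). s * p + r * q + s = j}" and ?y = "\<lambda>j. {(p, q). s * p + r * q + r = j}"
    have xy: "dx b \<in> supp_in (?x j)" "dx c \<in> supp_in (?x k)" "dy b \<in> supp_in (?y j)" "dy c \<in> supp_in (?y k)"
      by (intro supp_in_dx[OF b] supp_in_dx[OF c] supp_in_dy[OF b] supp_in_dy[OF c]; auto simp: weight_def)+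
    have 1: "dx b * dy c \<in> supp_in (form_weight s r (j + k))"
      by (rule supp_in_mult[OF xy(1,4)]) (auto simp: form_weight_def algebra_simps)
    have 2: "dy b * dx c \<in> supp_in (form_weight s r (j + k))"
      by (rule supp_in_mult[OF xy(3,2)]) (auto simp: form_weight_def algebra_simps)
    have "poisson b c \<in> supp_in (form_weight s r (j + k))"
      unfolding poisson_def by (rule supp_in_diff[OF 1 2])
    then have "a * poisson b c \<in> supp_in (form_weight s r m)"
      by (rule supp_in_mult[OF a]) (use m in \<open>auto simp: form_weight_def weight_def algebra_simps\<close>)
    then show "x \<in> two_form ` supp_in (form_weight s r m)"
      unfolding x wedge_differentials two_form_mult[symmetric] by blast
  qed
  have "submodule Kc (two_form ` supp_in (form_weight s r m)) (Omega2 Kc C)"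
  proof (unfold_locales)
    show "two_form ` supp_in (form_weight s r m) \<subseteq> carrier (Omega2 Kc C)"
      by (auto simp: Omega2_simps)
    show "\<zero>\<^bsub>Omega2 Kc C\<^esub> \<in> two_form ` supp_in (form_weight s r m)"
      unfolding Omega2_simps two_form_zero[symmetric] using supp_in_zero by blast
    fix v w assume "v \<in> two_form ` supp_in (form_weight s r m)" "w \<in> two_form ` supp_in (form_weight s r m)"
    then show "v \<oplus>\<^bsub>Omega2 Kc C\<^esub> w \<in> two_form ` supp_in (form_weight s r m)"
      by (auto simp: Omega2_simps simp flip: two_form_add intro!: imageI supp_in_add)
  next
    fix c v assume "v \<in> two_form ` supp_in (form_weight s r m)"
    then show "c \<odot>\<^bsub>Omega2 Kc C\<^esub> v \<in> two_form ` supp_in (form_weight s r m)"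
      by (auto simp: Omega2_simps simp flip: two_form_mult intro!: imageI supp_in_smult)
  qed
  from Om.span_is_subset[OF sub this]
  have "Om.span ?gens \<subseteq> two_form ` supp_in (form_weight s r m)" .
  moreover have "two_form g \<in> Om.span ?gens" if "g \<in> supp_in (form_weight s r m)" for g
    using that
  proof (induction rule: supp_in_induct)
    case (mon c i j)
    have gens: "?gens \<subseteq> carrier (Omega2 Kc C)"
      by (rule subset_trans[OF sub]) (auto simp: Omega2_simps)
    have "\<kappa> (mon c i j) \<in> G (s * i + r * j)"
      unfolding G by (intro imageI mon_in_supp_in) (simp add: weight_def)
    moreover have "\<kappa> PX \<in> G s" "\<kappa> PY \<in> G r"
      unfolding G PX_power[of 1, simplified] PY_power[of 1, simplified]
      by (intro imageI; simp add: supp_in_def weight_def coeff_pCons split: nat.splits)+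
    moreover have "s * i + r * j + s + r = m"
      using mon by (simp add: form_weight_def)
    ultimately have "two_form (mon c i j) \<in> ?gens"
      unfolding two_form_def by blast
    then show ?case using Om.in_own_span[OF gens] by blast
  next
    case zero
    have "submodule Kc (Om.span ?gens) (Omega2 Kc C)"
      by (rule Om.span_is_submodule, rule subset_trans[OF sub]) (auto simp: Omega2_simps)
    then show ?case
      unfolding two_form_zero Omega2_simps(2)[symmetric] by (simp add: submodule_def)
  next
    case (add p q)
    have "submodule Kc (Om.span ?gens) (Omega2 Kc C)"
      by (rule Om.span_is_submodule, rule subset_trans[OF sub]) (auto simp: Omega2_simps)
    then show ?case
      using add unfolding two_form_add Omega2_simps(3)[symmetric] by (auto simp: submodule_def)
  qed
  ultimately show ?thesis unfolding def by blast
qed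

end

section \<open>The algebra with one relation\<close>

locale one_relator =
  fixes s r d :: nat and P :: free
  assumes d: "d \<ge> 1" and P: "P \<in> free_grading s r d" and sf: "squarefree (poly_of_free P)"
begin

abbreviation "f \<equiv> poly_of_free P"
abbreviation "I \<equiv> Idl\<^bsub>free_algebra\<^esub> {P}"
abbreviation "A \<equiv> one_relator_algebra P"

lemma f_weight: "f \<in> supp_in (weight s r d)"
  by (rule poly_of_free_graded[OF P])

lemma f_jacobian: "f \<in> jacobian f"
  by (rule self_in_jacobian[OF f_weight d])

lemma f_nonzero: "f \<noteq> 0"
  using sf by auto

lemma I_ideal: "ideal I free_algebra"
  by (rule ring.genideal_ideal[OF free_algebra_ring]) (simp add: free_algebra_simps)

lemma I_is_ideal: "is_ideal I"
  using I_ideal by (simp add: ideal_free_algebra)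

lemma P_in_I: "P \<in> I"
  using ring.genideal_self[OF free_algebra_ring, of "{P}"] by (simp add: free_algebra_simps)

lemma I_minimal: "is_ideal T \<Longrightarrow> P \<in> T \<Longrightarrow> I \<subseteq> T"
  using ring.genideal_minimal[OF free_algebra_ring, of T "{P}"] by (simp add: ideal_free_algebra)

lemma I_theta:
  assumes "z \<in> I"
  shows "\<exists>g. poly_of_free z = g * f \<and> theta z - g * theta P \<in> jacobian f"
  using I_minimal[OF theta_on_ideal[OF f_jacobian] self_in_theta_ideal] assms by blast

lemma I_L2_theta:
  assumes "z \<in> I" "z \<in> L2"
  shows "theta z \<in> jacobian f"
  using I_theta[OF assms(1)] poly_of_free_L2[OF assms(2)] f_nonzero by auto

sublocale qA: module_quotient Kc free_algebra I
proof (rule module_quotient.intro)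
  show "submodule Kc I free_algebra"
    unfolding submodule_def
    using free_algebra_module is_ideal_zero[OF I_is_ideal] is_ideal_add[OF I_is_ideal]
      is_ideal_left[OF I_is_ideal]
    by (auto simp: free_algebra_simps free_algebra_smult)
qed

abbreviation cA :: "free \<Rightarrow> free set" where "cA \<equiv> qA.cls"

lemma A_eq: "A = quot_module free_algebra I"
  by (simp add: one_relator_algebra_def)

sublocale A: ring A
  unfolding A_eq by (rule quot_module_ring(1)[OF I_ideal])

sublocale MA: module Kc A
  unfolding A_eq by (rule qA.quotient_is_module)

lemma carrier_A: "carrier A = range cA"
  unfolding A_eq by (simp add: quot_module_simps(1) free_algebra_simps)

lemma cA_closed [simp]: "cA p \<in> carrier A"
  by (simp add: carrier_A)

lemma cA_hom:
  "cA (p + q) = cA p \<oplus>\<^bsub>A\<^esub> cA q" "cA (p * q) = cA p \<otimes>\<^bsub>A\<^esub> cA q"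
  "cA 0 = \<zero>\<^bsub>A\<^esub>" "cA 1 = \<one>\<^bsub>A\<^esub>" "cA (sc c * p) = c \<odot>\<^bsub>A\<^esub> cA p"
proof -
  note hom = quot_module_ring(2)[OF I_ideal, folded A_eq]
  show "cA (p + q) = cA p \<oplus>\<^bsub>A\<^esub> cA q"
    using ring_hom_add[OF hom, of p q] by (simp add: free_algebra_simps)
  show "cA (p * q) = cA p \<otimes>\<^bsub>A\<^esub> cA q"
    using ring_hom_mult[OF hom, of p q] by (simp add: free_algebra_simps)
  show "cA 0 = \<zero>\<^bsub>A\<^esub>"
    using qA.cls_zero by (simp add: free_algebra_simps A_eq)
  show "cA 1 = \<one>\<^bsub>A\<^esub>"
    using ring_hom_one[OF hom] by (simp add: free_algebra_simps)
  show "cA (sc c * p) = c \<odot>\<^bsub>A\<^esub> cA p"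
    using qA.cls_smult[of c p] by (simp add: free_algebra_simps free_algebra_smult A_eq)
qed

lemma cA_eq_iff: "cA p = cA q \<longleftrightarrow> p - q \<in> I"
  using qA.cls_eq_iff[of p q] by (simp add: free_algebra_simps free_algebra_minus)

lemma cA_minus: "cA (p - q) = cA p \<ominus>\<^bsub>A\<^esub> cA q"
proof -
  have "cA p = cA (p - q) \<oplus>\<^bsub>A\<^esub> cA q" by (simp flip: cA_hom(1))
  then show ?thesis by (simp add: a_minus_def A.a_assoc A.r_neg)
qed

lemma commutator_cA: "commutator A (cA p) (cA q) = cA (bracket p q)"
  by (simp add: commutator_def bracket_def cA_minus cA_hom)

lemma span_commutators:
  "MA.span {commutator A a b | a b. a \<in> carrier A \<and> b \<in> cA ` B} = cA ` bracket_span B"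
  (is "MA.span ?gens = _")
proof
  have gens: "?gens \<subseteq> carrier A"
    by (auto simp: carrier_A commutator_cA)
  have "?gens \<subseteq> cA ` bracket_span B"
    by (auto simp: carrier_A commutator_cA intro!: imageI bracket_in_span)
  moreover have "submodule Kc (cA ` bracket_span B) A"
  proof (unfold_locales)
    show "\<zero>\<^bsub>A\<^esub> \<in> cA ` bracket_span B"
      unfolding cA_hom(3)[symmetric] by (intro imageI bracket_span.zero)
  qed (auto simp flip: cA_hom intro!: imageI bracket_span_add bracket_span_sc)
  ultimately show "MA.span ?gens \<subseteq> cA ` bracket_span B"
    by (rule MA.span_is_subset)
  have sub: "submodule Kc (MA.span ?gens) A"
    by (rule MA.span_is_submodule[OF gens])
  show "cA ` bracket_span B \<subseteq> MA.span ?gens"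
  proof
    fix X assume "X \<in> cA ` bracket_span B"
    then obtain z where "z \<in> bracket_span B" and X: "X = cA z" by blast
    from this(1) have "cA z \<in> MA.span ?gens"
    proof induction
      case zero
      show ?case unfolding cA_hom using sub by (simp add: submodule_def)
    next
      case (step z b a)
      have "commutator A (cA a) (cA b) \<in> ?gens"
        using step(2) by (intro CollectI exI[of _ "cA a"] exI[of _ "cA b"]) auto
      then have "cA (bracket a b) \<in> MA.span ?gens"
        unfolding commutator_cA by (rule subsetD[OF MA.in_own_span[OF gens]])
      with step(3) show ?case
        unfolding cA_hom using sub by (simp add: submodule_def)
    qed
    then show "X \<in> MA.span ?gens" by (simp add: X)
  qed
qed

lemma lower_central_1: "lower_central Kc A (Suc 0) = cA ` UNIV"
  by (simp add: carrier_A)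

lemma lower_central_2: "lower_central Kc A 2 = cA ` L2"
  unfolding numeral_2_eq_2 lower_central.simps(3) lower_central_1 by (rule span_commutators)

lemma lower_central_3: "lower_central Kc A (Suc 2) = cA ` L3"
  unfolding numeral_2_eq_2 lower_central.simps(3)[of _ _ "Suc 0"]
  unfolding numeral_2_eq_2[symmetric] lower_central_2 by (rule span_commutators)

abbreviation "A2 \<equiv> A\<lparr>carrier := cA ` L2\<rparr>"
abbreviation "L3A \<equiv> cA ` L3"
abbreviation "B2 \<equiv> B_space Kc A 2"

lemma cA_bracket_span_submodule: "submodule Kc (cA ` bracket_span B) A"
  unfolding span_commutators[symmetric]
  by (rule MA.span_is_submodule) (auto simp: carrier_A commutator_cA)

sublocale qB: module_quotient Kc A2 L3A
proof (rule module_quotient.intro)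
  have "submodule Kc L3A A" by (rule cA_bracket_span_submodule)
  moreover have "module Kc A2"
    by (rule MA.submodule_is_module[OF cA_bracket_span_submodule])
  ultimately show "submodule Kc L3A A2"
    using L3_subset_L2 by (auto simp: submodule_def)
qed

lemma B2_eq: "B2 = quot_module A2 L3A"
  unfolding B_space_def lower_central_2 lower_central_3 ..

definition cB :: "free \<Rightarrow> free set set" where
  "cB z = qB.cls (cA z)"

text \<open>\<^const>\<open>theta\<close> kills \<^term>\<open>L3\<close> and sends \<open>L\<^sub>2 \<inter> \<langle>P\<rangle>\<close> onto the Jacobian ideal; an element of \<^term>\<open>L2\<close> is
  determined modulo \<^term>\<open>L3\<close> by its image.\<close>

lemma cB_eq_iff:
  assumes z: "z \<in> L2" and w: "w \<in> L2"
  shows "cB z = cB w \<longleftrightarrow> theta z - theta w \<in> jacobian f"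
proof -
  have zw: "z - w \<in> L2" by (rule bracket_span_diff[OF z w])
  have cl: "cA z \<in> carrier A2" "cA w \<in> carrier A2" "cA (z - w) \<in> carrier A2"
    using z w zw by auto
  have "cA z = cA (z - w) \<oplus>\<^bsub>A2\<^esub> cA w" by (simp flip: cA_hom(1))
  then have "cA z \<ominus>\<^bsub>A2\<^esub> cA w = cA (z - w)"
    using add_minus_cancel[OF qB.M.abelian_group_axioms cl(3,2)] by metis
  then have "cB z = cB w \<longleftrightarrow> cA (z - w) \<in> cA ` L3"
    unfolding cB_def using qB.cls_eq_iff[OF cl(1,2)] by simp
  also have "\<dots> \<longleftrightarrow> (\<exists>l\<in>L3. z - w - l \<in> I)"
    by (auto simp: image_iff cA_eq_iff)
  also have "\<dots> \<longleftrightarrow> theta (z - w) \<in> jacobian f"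
  proof
    assume "\<exists>l\<in>L3. z - w - l \<in> I"
    then obtain l where l: "l \<in> L3" "z - w - l \<in> I" by blast
    have "z - w - l \<in> L2"
      using bracket_span_diff[OF zw] l(1) L3_subset_L2 by blast
    then have "theta (z - w - l) \<in> jacobian f" by (rule I_L2_theta[OF l(2)])
    then show "theta (z - w) \<in> jacobian f"
      using theta_L3[OF l(1)] by (simp add: theta_diff)
  next
    assume "theta (z - w) \<in> jacobian f"
    then obtain i where i: "i \<in> L2" "i \<in> I" "theta i = theta (z - w)"
      using jacobian_from_ideal[OF I_is_ideal P_in_I f_weight d] by blast
    then have "z - w - i \<in> L3"
      by (intro L2_theta_kernel bracket_span_diff[OF zw]) (simp_all add: theta_diff)
    then show "\<exists>l\<in>L3. z - w - l \<in> I"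
      using i by (intro bexI[of _ "z - w - i"]) simp_all
  qed
  finally show ?thesis by (simp add: theta_diff)
qed

lemma cB_hom:
  assumes "z \<in> L2"
  shows "w \<in> L2 \<Longrightarrow> cB (z + w) = cB z \<oplus>\<^bsub>B2\<^esub> cB w" and "cB (sc c * z) = c \<odot>\<^bsub>B2\<^esub> cB z"
proof -
  show "cB (z + w) = cB z \<oplus>\<^bsub>B2\<^esub> cB w" if "w \<in> L2"
    unfolding cB_def B2_eq cA_hom(1) using qB.cls_add[of "cA z" "cA w"] assms that by simp
  show "cB (sc c * z) = c \<odot>\<^bsub>B2\<^esub> cB z"
    unfolding cB_def B2_eq cA_hom(5) using qB.cls_smult[of c "cA z"] assms by simp
qed

lemma cB_zero: "cB 0 = \<zero>\<^bsub>B2\<^esub>"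
  using qB.cls_zero by (simp add: cB_def B2_eq cA_hom)

lemma carrier_B2: "carrier B2 = cB ` L2"
  unfolding B2_eq quot_module_simps(1) cB_def by auto

text \<open>The inverse of \<open>[a, b] \<mapsto> da \<and> db\<close>, read on polynomial two-forms of the plane.\<close>

definition bracket_of_form :: "bipoly \<Rightarrow> free set set" where
  "bracket_of_form g = cB (SOME z. z \<in> L2 \<and> theta z = g)"

lemma bracket_of_form_theta:
  assumes z: "z \<in> L2"
  shows "bracket_of_form (theta z) = cB z"
proof -
  let ?w = "SOME w. w \<in> L2 \<and> theta w = theta z"
  have "?w \<in> L2 \<and> theta ?w = theta z"
    by (rule someI[of _ z]) (simp add: z)
  then show ?thesis
    unfolding bracket_of_form_def using z by (simp add: cB_eq_iff jacobian_zero)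
qed

lemma bracket_of_form_add: "bracket_of_form (g + h) = bracket_of_form g \<oplus>\<^bsub>B2\<^esub> bracket_of_form h"
proof -
  obtain z w where "z \<in> L2" "theta z = g" "w \<in> L2" "theta w = h"
    using theta_L2_surj by metis
  then show ?thesis
    using bracket_of_form_theta[of z] bracket_of_form_theta[of w] bracket_of_form_theta[of "z + w"]
    by (simp add: bracket_span_add theta_add cB_hom)
qed

lemma theta_sc: "z \<in> L2 \<Longrightarrow> theta (sc c * z) = cst c * theta z"
  unfolding theta_mult poly_of_free_sc by (simp add: poly_of_free_L2)

lemma bracket_of_form_smult: "bracket_of_form (cst c * g) = c \<odot>\<^bsub>B2\<^esub> bracket_of_form g"
proof -
  obtain z where z: "z \<in> L2" "theta z = g"
    using theta_L2_surj by metis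
  then have "bracket_of_form (theta (sc c * z)) = cB (sc c * z)"
    by (intro bracket_of_form_theta bracket_span_sc)
  then show ?thesis
    using z bracket_of_form_theta[of z] unfolding theta_sc[OF z(1)] by (simp add: cB_hom)
qed

lemma bracket_of_form_zero: "bracket_of_form 0 = \<zero>\<^bsub>B2\<^esub>"
  using bracket_of_form_theta[OF bracket_span.zero] by (simp add: cB_zero)

lemma bracket_of_form_surj: "bracket_of_form ` UNIV = carrier B2"
proof
  show "bracket_of_form ` UNIV \<subseteq> carrier B2"
    using theta_L2_surj bracket_of_form_theta unfolding carrier_B2 by (metis image_eqI image_subsetI)
  show "carrier B2 \<subseteq> bracket_of_form ` UNIV"
    unfolding carrier_B2 using bracket_of_form_theta by (metis image_subsetI rangeI)
qed

lemma bracket_of_form_eq_iff: "bracket_of_form g = bracket_of_form h \<longleftrightarrow> g - h \<in> jacobian f"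
  using theta_L2_surj[of g] theta_L2_surj[of h] bracket_of_form_theta cB_eq_iff by metis

lemma B2_module: "module Kc B2"
  unfolding B2_eq by (rule qB.quotient_is_module)

abbreviation "gA \<equiv> one_relator_grading s r P"

lemma gA_eq: "gA m = cA ` free_grading s r m"
  by (simp add: one_relator_grading_def quot_grading_def)

text \<open>An element of degree \<open>m\<close> in \<open>L\<^sub>2(A)\<close> has a homogeneous representative \<open>a\<close> and a representative \<open>z\<close> in
  \<open>L\<^sub>2(F)\<close>, possibly different. As \<open>z - a\<close> is in \<open>\<langle>P\<rangle>\<close>, the images of \<open>z\<close> and \<open>a\<close> differ, modulo the
  Jacobian ideal, by a multiple of the image of \<open>P\<close> whose cofactor is homogeneous.\<close>

lemma B2_grading: "B_grading Kc A gA 2 m = bracket_of_form ` supp_in (form_weight s r m)"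
proof -
  have def: "B_grading Kc A gA 2 m = qB.cls ` (gA m \<inter> cA ` L2)"
    unfolding B_grading_def quot_grading_def lower_central_2 lower_central_3 ..
  show ?thesis
  proof
    show "bracket_of_form ` supp_in (form_weight s r m) \<subseteq> B_grading Kc A gA 2 m"
    proof
      fix X assume "X \<in> bracket_of_form ` supp_in (form_weight s r m)"
      then obtain g where g: "g \<in> supp_in (form_weight s r m)" "X = bracket_of_form g" by blast
      obtain z where z: "z \<in> L2" "z \<in> free_grading s r m" "theta z = g"
        using theta_L2_graded_surj[OF g(1)] by blast
      then have "X = qB.cls (cA z)"
        using bracket_of_form_theta[of z] g by (simp add: cB_def)
      then show "X \<in> B_grading Kc A gA 2 m"
        unfolding def gA_eq using z by blast
    qed
    show "B_grading Kc A gA 2 m \<subseteq> bracket_of_form ` supp_in (form_weight s r m)"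
    proof
      fix X assume "X \<in> B_grading Kc A gA 2 m"
      then obtain a z where a: "a \<in> free_grading s r m" and z: "z \<in> L2"
        and az: "cA a = cA z" and X: "X = qB.cls (cA z)"
        unfolding def gA_eq by (auto elim!: imageE IntE)
      have "z - a \<in> I" using az[symmetric] by (simp only: cA_eq_iff)
      then obtain g where g: "poly_of_free (z - a) = g * f" "theta (z - a) - g * theta P \<in> jacobian f"
        using I_theta by blast
      have "g * f = 0 - poly_of_free a"
        using g(1) poly_of_free_L2[OF z] by (simp add: poly_of_free_diff)
      then have "g * f \<in> supp_in (weight s r m)"
        using supp_in_diff[OF supp_in_zero poly_of_free_graded[OF a]] by simp
      then have "g \<in> supp_in {(i, j). s * i + r * j + d = m}"
        by (rule cofactor_homogeneous[OF f_weight f_nonzero])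
      then have "g * theta P \<in> supp_in (form_weight s r m)"
        by (rule supp_in_mult[OF _ theta_graded[OF P]]) (auto simp: form_weight_def algebra_simps)
      then have h: "theta a + g * theta P \<in> supp_in (form_weight s r m)"
        by (intro supp_in_add theta_graded a)
      have "theta z - (theta a + g * theta P) \<in> jacobian f"
        using g(2) by (simp add: theta_diff algebra_simps)
      then have "bracket_of_form (theta z) = bracket_of_form (theta a + g * theta P)"
        by (simp add: bracket_of_form_eq_iff)
      then have "X = bracket_of_form (theta a + g * theta P)"
        using bracket_of_form_theta[OF z] by (simp add: X cB_def)
      with h show "X \<in> bracket_of_form ` supp_in (form_weight s r m)" by blast
    qed
  qed
qed

end

context one_relator
begin

abbreviation "CI \<equiv> commutator_ideal A"

definition over_f :: "free set" where
  "over_f = {p. f dvd poly_of_free p}"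

lemma ideal_cA_over_f: "ideal (cA ` over_f) A"
proof (rule idealI[OF A.ring_axioms])
  show "subgroup (cA ` over_f) (add_monoid A)"
  proof (rule A.add.subgroupI)
    show "cA ` over_f \<subseteq> carrier A" by auto
    show "cA ` over_f \<noteq> {}" by (auto simp: over_f_def intro: exI[of _ 0])
    show "\<ominus>\<^bsub>A\<^esub> X \<in> cA ` over_f" if X: "X \<in> cA ` over_f" for X
    proof -
      obtain p where p: "p \<in> over_f" "X = cA p" using X by blast
      have "\<ominus>\<^bsub>A\<^esub> X = cA (0 - p)"
        unfolding cA_minus cA_hom by (simp add: p a_minus_def)
      moreover have "0 - p \<in> over_f" using p(1) by (simp add: over_f_def poly_of_free_diff del: diff_0)
      ultimately show ?thesis by blast
    qed
    show "X \<oplus>\<^bsub>A\<^esub> Y \<in> cA ` over_f" if "X \<in> cA ` over_f" "Y \<in> cA ` over_f" for X Y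
      using that by (auto simp: over_f_def poly_of_free_add simp flip: cA_hom intro!: imageI)
  qed
qed (auto simp: over_f_def poly_of_free_mult carrier_A simp flip: cA_hom intro!: imageI)

lemma CI_ideal: "ideal CI A"
  unfolding commutator_ideal_def by (rule A.genideal_ideal) (auto simp: carrier_A commutator_cA)

text \<open>If \<open>f\<close> divides the abelianization of \<open>p\<close>, then \<open>p - qP\<close> has abelianization zero for some \<open>q\<close>, and
  so lies in the ideal generated by \<open>[x, y]\<close>.\<close>

lemma commutator_ideal_eq: "CI = cA ` over_f"
proof
  show "CI \<subseteq> cA ` over_f"
    unfolding commutator_ideal_def
    by (rule A.genideal_minimal[OF ideal_cA_over_f])
      (auto simp: carrier_A commutator_cA over_f_def poly_of_free_bracket intro!: imageI)
  interpret CI: ideal CI A by (rule CI_ideal)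
  note CI_add = additive_subgroup.zero_closed[OF CI.is_additive_subgroup]
    additive_subgroup.a_closed[OF CI.is_additive_subgroup]
  have T: "is_ideal {p. cA p \<in> CI}"
    unfolding is_ideal_def using CI_add CI.I_l_closed CI.I_r_closed by (auto simp: cA_hom)
  have "commutator A (cA gx) (cA gy) \<in> {commutator A a b | a b. a \<in> carrier A \<and> b \<in> carrier A}"
    using cA_closed by blast
  then have "commutator A (cA gx) (cA gy) \<in> CI"
    unfolding commutator_ideal_def
    by (rule subsetD[OF A.genideal_self, rotated]) (auto simp: carrier_A commutator_cA)
  then have xy: "bracket gx gy \<in> {p. cA p \<in> CI}" by (simp add: commutator_cA)
  show "cA ` over_f \<subseteq> CI"
  proof
    fix X assume "X \<in> cA ` over_f"
    then obtain p where X: "X = cA p" and "f dvd poly_of_free p"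
      by (auto simp: over_f_def)
    then obtain k where p: "poly_of_free p = f * k" by (auto elim: dvdE)
    obtain q where "poly_of_free q = k" using poly_of_free_surj by metis
    then have "p - q * P \<in> {p. cA p \<in> CI}"
      using p by (intro poly_of_free_kernel[OF T xy]) (simp add: poly_of_free_diff poly_of_free_mult)
    moreover have "cA (p - q * P) = cA p"
      using is_ideal_minus[OF I_is_ideal is_ideal_left[OF I_is_ideal P_in_I]] by (simp add: cA_eq_iff)
    ultimately show "X \<in> CI" by (simp add: X)
  qed
qed

abbreviation "Aab \<equiv> abelianization A"

sublocale qC: module_quotient Kc A CI
proof (rule module_quotient.intro)
  interpret CI: ideal CI A by (rule CI_ideal)
  have "c \<odot>\<^bsub>A\<^esub> X \<in> CI" if "X \<in> CI" for c X
    using that unfolding commutator_ideal_eq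
    by (auto simp: over_f_def poly_of_free_mult dvd_smult simp flip: cA_hom intro!: imageI)
  then show "submodule Kc CI A"
    unfolding submodule_def
    using MA.module_axioms CI.a_subset additive_subgroup.zero_closed[OF CI.is_additive_subgroup]
      additive_subgroup.a_closed[OF CI.is_additive_subgroup] by auto
qed

lemma Aab_eq: "Aab = quot_module A CI"
  by (simp add: abelianization_def)

definition cC :: "free \<Rightarrow> free set set" where
  "cC p = qC.cls (cA p)"

lemma carrier_Aab: "carrier Aab = range cC"
  unfolding Aab_eq quot_module_simps(1) cC_def carrier_A by auto

lemma cC_hom:
  "cC (p + q) = cC p \<oplus>\<^bsub>Aab\<^esub> cC q" "cC (p * q) = cC p \<otimes>\<^bsub>Aab\<^esub> cC q"
  "cC 0 = \<zero>\<^bsub>Aab\<^esub>" "cC 1 = \<one>\<^bsub>Aab\<^esub>" "cC (sc c * p) = c \<odot>\<^bsub>Aab\<^esub> cC p"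
proof -
  note hom = quot_module_ring(2)[OF CI_ideal, folded Aab_eq]
  show "cC (p + q) = cC p \<oplus>\<^bsub>Aab\<^esub> cC q"
    using ring_hom_add[OF hom, of "cA p" "cA q"] by (simp add: cC_def cA_hom)
  show "cC (p * q) = cC p \<otimes>\<^bsub>Aab\<^esub> cC q"
    using ring_hom_mult[OF hom, of "cA p" "cA q"] by (simp add: cC_def cA_hom)
  show "cC 0 = \<zero>\<^bsub>Aab\<^esub>"
    using qC.cls_zero by (simp add: cC_def cA_hom Aab_eq)
  show "cC 1 = \<one>\<^bsub>Aab\<^esub>"
    using ring_hom_one[OF hom] by (simp add: cC_def cA_hom)
  show "cC (sc c * p) = c \<odot>\<^bsub>Aab\<^esub> cC p"
    using qC.cls_smult[of c "cA p"] by (simp add: cC_def cA_hom(5) Aab_eq)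
qed

lemma cC_eq_iff: "cC p = cC q \<longleftrightarrow> f dvd poly_of_free p - poly_of_free q"
proof -
  have "cC p = cC q \<longleftrightarrow> cA (p - q) \<in> cA ` over_f"
    unfolding cC_def using qC.cls_eq_iff[of "cA p" "cA q"]
    by (simp add: cA_minus commutator_ideal_eq)
  also have "\<dots> \<longleftrightarrow> p - q \<in> over_f"
  proof
    assume "cA (p - q) \<in> cA ` over_f"
    then obtain e where e: "e \<in> over_f" "p - q - e \<in> I" by (auto simp: cA_eq_iff)
    then have "f dvd poly_of_free (p - q - e)" using I_theta[OF e(2)] by auto
    then have "f dvd poly_of_free (p - q - e) + poly_of_free e"
      using e(1) by (simp add: over_f_def)
    then show "p - q \<in> over_f" by (simp add: over_f_def poly_of_free_diff)
  qed blast
  finally show ?thesis by (simp add: over_f_def poly_of_free_diff)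
qed

definition \<kappa> :: "bipoly \<Rightarrow> free set set" where
  "\<kappa> g = cC (SOME p. poly_of_free p = g)"

lemma \<kappa>_poly_of_free: "\<kappa> (poly_of_free p) = cC p"
proof -
  have "poly_of_free (SOME q. poly_of_free q = poly_of_free p) = poly_of_free p"
    by (rule someI[of _ p]) simp
  then show ?thesis by (simp add: \<kappa>_def cC_eq_iff)
qed

lemma \<kappa>_image: "\<kappa> ` poly_of_free ` X = cC ` X"
  by (simp add: image_image \<kappa>_poly_of_free)

lemma range_poly_of_free: "range poly_of_free = UNIV"
  using poly_of_free_surj by (auto simp: image_iff) metis

lemma Aab_cring: "cring Aab"
proof -
  have R: "ring Aab" unfolding Aab_eq by (rule quot_module_ring(1)[OF CI_ideal])
  moreover have "comm_monoid Aab"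
  proof (rule comm_monoid.intro)
    show "Group.monoid Aab" by (rule ring.is_monoid[OF R])
    show "comm_monoid_axioms Aab"
    proof
      fix X Y assume "X \<in> carrier Aab" "Y \<in> carrier Aab"
      then obtain p q where "X = cC p" "Y = cC q" by (auto simp: carrier_Aab)
      moreover have "cC (p * q) = cC (q * p)"
        by (simp add: cC_eq_iff poly_of_free_mult mult.commute)
      ultimately show "X \<otimes>\<^bsub>Aab\<^esub> Y = Y \<otimes>\<^bsub>Aab\<^esub> X" by (simp add: cC_hom)
    qed
  qed
  ultimately show ?thesis by (rule cring.intro)
qed

sublocale curve: plane_curve Aab \<kappa> f
proof (rule plane_curve.intro)
  show "range \<kappa> = carrier Aab"
    using \<kappa>_image[of UNIV] by (simp add: range_poly_of_free carrier_Aab)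
  fix g h c
  obtain p q where pq: "poly_of_free p = g" "poly_of_free q = h" using poly_of_free_surj by metis
  show "\<kappa> (g + h) = \<kappa> g \<oplus>\<^bsub>Aab\<^esub> \<kappa> h"
    unfolding pq[symmetric] poly_of_free_add[symmetric] \<kappa>_poly_of_free cC_hom ..
  show "\<kappa> (g * h) = \<kappa> g \<otimes>\<^bsub>Aab\<^esub> \<kappa> h"
    unfolding pq[symmetric] poly_of_free_mult[symmetric] \<kappa>_poly_of_free cC_hom ..
  show "\<kappa> (cst c * g) = c \<odot>\<^bsub>Aab\<^esub> \<kappa> g"
    unfolding pq[symmetric] poly_of_free_sc[symmetric] poly_of_free_mult[symmetric] \<kappa>_poly_of_free
    by (rule cC_hom)
  show "\<kappa> g = \<kappa> h \<longleftrightarrow> f dvd g - h"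
    unfolding pq[symmetric] \<kappa>_poly_of_free by (rule cC_eq_iff)
next
  show "\<kappa> 1 = \<one>\<^bsub>Aab\<^esub>" "\<kappa> 0 = \<zero>\<^bsub>Aab\<^esub>"
    using \<kappa>_poly_of_free[of 1] \<kappa>_poly_of_free[of 0] by (simp_all add: cC_hom)
qed (rule Aab_cring f_jacobian)+

abbreviation "gAab \<equiv> abelianization_grading A gA"

lemma gAab_eq: "gAab m = \<kappa> ` supp_in (weight s r m)"
proof -
  have "poly_of_free ` free_grading s r m = supp_in (weight s r m)"
    using poly_of_free_graded poly_of_free_graded_surj by (auto simp: image_iff) metis
  then have "\<kappa> ` supp_in (weight s r m) = cC ` free_grading s r m"
    using \<kappa>_image[of "free_grading s r m"] by simp
  then show ?thesis
    by (simp add: abelianization_grading_def quot_grading_def gA_eq image_image cC_def)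
qed

lemma B2_iso_Omega2:
  "\<exists>h. graded_linear_iso Kc B2 (B_grading Kc A gA 2) (Omega2 Kc Aab) (Omega2_grading Kc Aab gAab) h"
proof -
  have "\<exists>h. graded_linear_iso Kc B2 (B_grading Kc A gA 2) (Omega2 Kc Aab) (Omega2_grading Kc Aab gAab) h
      \<and> (\<forall>g \<in> carrier poly_algebra. h (bracket_of_form g) = curve.two_form g)"
  proof (rule iso_from_common_source)
    show "vectorspace Kc B2" by (rule vectorspaceI[OF B2_module])
    show "vectorspace Kc (Omega2 Kc Aab)" by (rule vectorspaceI[OF curve.Omega2_module])
    show "module Kc poly_algebra" by (rule poly_algebra_module)
    show "bracket_of_form ` supp_in (form_weight s r m) = B_grading Kc A gA 2 m" for m
      by (rule B2_grading[symmetric])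
    show "curve.two_form ` supp_in (form_weight s r m) = Omega2_grading Kc Aab gAab m" for m
      by (rule curve.Omega2_grading_eq[OF gAab_eq, symmetric])
  qed (simp_all only: poly_algebra_simps curve.Omega2_simps bracket_of_form_surj curve.two_form_surj
      bracket_of_form_add curve.two_form_add bracket_of_form_smult curve.two_form_mult
      bracket_of_form_eq_iff curve.two_form_eq_iff subset_UNIV)
  then show ?thesis by blast
qed

lemma principal_ideal_iff: "h \<in> Idl\<^bsub>poly_algebra\<^esub> {f} \<longleftrightarrow> f dvd h"
proof -
  interpret R: cring poly_algebra by (rule poly_algebra_cring)
  have "Idl\<^bsub>poly_algebra\<^esub> {f} = {x * f | x. True}"
    using R.cgenideal_eq_genideal[of f] by (simp add: cgenideal_def poly_algebra_simps)
  then show ?thesis by (auto simp: dvd_def mult.commute)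
qed

lemma principal_ideal: "ideal (Idl\<^bsub>poly_algebra\<^esub> {f}) poly_algebra"
  by (rule ring.genideal_ideal[OF cring.axioms(1)[OF poly_algebra_cring]]) (simp add: poly_algebra_simps)

lemma abelianization_iso:
  "\<exists>h \<in> ring_iso Aab (plane_curve_algebra f).
     graded_linear_iso Kc Aab gAab (plane_curve_algebra f) (plane_curve_grading s r f) h"
proof -
  let ?N = "Idl\<^bsub>poly_algebra\<^esub> {f}" and ?W = "plane_curve_algebra f"
  have W: "?W = quot_module poly_algebra ?N" by (simp add: plane_curve_algebra_def)
  interpret q: module_quotient Kc poly_algebra ?N
  proof (rule module_quotient.intro)
    show "submodule Kc ?N poly_algebra"
      unfolding submodule_def using poly_algebra_module
      by (auto simp: principal_ideal_iff poly_algebra_simps dvd_smult)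
  qed
  have eq: "q.cls g = q.cls h \<longleftrightarrow> f dvd g - h" for g h
    using q.cls_eq_iff[of g h] by (simp add: poly_algebra_simps poly_algebra_minus principal_ideal_iff)
  note hom = quot_module_ring(2)[OF principal_ideal, folded W]
  have "\<exists>h. graded_linear_iso Kc Aab gAab ?W (plane_curve_grading s r f) h
      \<and> (\<forall>g \<in> carrier poly_algebra. h (\<kappa> g) = q.cls g)"
  proof (rule iso_from_common_source)
    show "vectorspace Kc Aab"
      unfolding Aab_eq by (rule vectorspaceI[OF qC.quotient_is_module])
    show "vectorspace Kc ?W"
      unfolding W by (rule vectorspaceI[OF q.quotient_is_module])
    show "module Kc poly_algebra" by (rule poly_algebra_module)
    show "\<kappa> ` supp_in (weight s r m) = gAab m" for m
      by (rule gAab_eq[symmetric])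
    show "q.cls ` supp_in (weight s r m) = plane_curve_grading s r f m" for m
      by (simp add: plane_curve_grading_def quot_grading_def poly_grading_eq)
    show "\<kappa> ` carrier poly_algebra = carrier Aab"
      unfolding poly_algebra_simps by (rule curve.surj)
    show "q.cls ` carrier poly_algebra = carrier ?W"
      by (simp add: W quot_module_simps)
    show "q.cls (x \<oplus>\<^bsub>poly_algebra\<^esub> y) = q.cls x \<oplus>\<^bsub>?W\<^esub> q.cls y" for x y
      unfolding W by (rule q.cls_add) (simp_all add: poly_algebra_simps)
    show "q.cls (c \<odot>\<^bsub>poly_algebra\<^esub> x) = c \<odot>\<^bsub>?W\<^esub> q.cls x" for c x
      unfolding W by (rule q.cls_smult) (simp_all add: poly_algebra_simps)
  qed (simp_all only: poly_algebra_simps curve.\<kappa>_add curve.\<kappa>_smult eq curve.\<kappa>_eq_iff subset_UNIV)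
  then obtain h where h: "graded_linear_iso Kc Aab gAab ?W (plane_curve_grading s r f) h"
    and h_\<kappa>: "\<And>g. h (\<kappa> g) = q.cls g"
    unfolding poly_algebra_simps by blast
  have ex: "\<exists>g. X = \<kappa> g" if "X \<in> carrier Aab" for X
    using that unfolding curve.surj[symmetric] by blast
  have "h \<in> Ring.ring_hom Aab ?W"
  proof (rule ring_hom_memI)
    fix X Y assume "X \<in> carrier Aab" "Y \<in> carrier Aab"
    then obtain g g' where g: "X = \<kappa> g" "Y = \<kappa> g'" using ex by metis
    show "h X \<in> carrier ?W"
      unfolding g h_\<kappa> by (simp add: W quot_module_simps poly_algebra_simps)
    show "h (X \<otimes>\<^bsub>Aab\<^esub> Y) = h X \<otimes>\<^bsub>?W\<^esub> h Y"
      using ring_hom_mult[OF hom, of g g'] unfolding g curve.\<kappa>_mult[symmetric] h_\<kappa>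
      by (simp add: poly_algebra_simps)
    show "h (X \<oplus>\<^bsub>Aab\<^esub> Y) = h X \<oplus>\<^bsub>?W\<^esub> h Y"
      using ring_hom_add[OF hom, of g g'] unfolding g curve.\<kappa>_add[symmetric] h_\<kappa>
      by (simp add: poly_algebra_simps)
  next
    show "h \<one>\<^bsub>Aab\<^esub> = \<one>\<^bsub>?W\<^esub>"
      using ring_hom_one[OF hom] unfolding curve.\<kappa>_one[symmetric] h_\<kappa> by (simp add: poly_algebra_simps)
  qed
  then have "h \<in> ring_iso Aab ?W"
    using h by (simp add: ring_iso_def graded_linear_iso_def)
  then show ?thesis using h by blast
qed

end

section \<open>Dimensions\<close>

lemma linear_mapI:
  assumes V: "vectorspace K V" and W: "vectorspace K W"
    and "T ` carrier V \<subseteq> carrier W"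
    and "\<And>x y. x \<in> carrier V \<Longrightarrow> y \<in> carrier V \<Longrightarrow> T (x \<oplus>\<^bsub>V\<^esub> y) = T x \<oplus>\<^bsub>W\<^esub> T y"
    and "\<And>c x. c \<in> carrier K \<Longrightarrow> x \<in> carrier V \<Longrightarrow> T (c \<odot>\<^bsub>V\<^esub> x) = c \<odot>\<^bsub>W\<^esub> T x"
  shows "linear_map K V W T"
proof -
  interpret V: vectorspace K V by (rule V)
  interpret W: vectorspace K W by (rule W)
  have "T \<in> module_hom K V W"
    using assms(3-) by (auto simp: module_hom_def)
  then show ?thesis
    by (intro linear_map.intro mod_hom.intro mod_hom_axioms.intro V W V.module_axioms W.module_axioms)
qed

lemma linear_surj_dim:
  assumes T: "linear_map K V W T" and surj: "T ` carrier V = carrier W"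
    and fd: "vectorspace.fin_dim K V"
  shows "vectorspace.fin_dim K W"
    and "vectorspace.dim K W + vectorspace.dim K (V\<lparr>carrier := {v \<in> carrier V. T v = \<zero>\<^bsub>W\<^esub>}\<rparr>)
      = vectorspace.dim K V"
proof -
  interpret linear_map K V W T by (rule T)
  show "vectorspace.fin_dim K W" by (rule surj_fin_dim[OF fd surj])
  have "imT = carrier W" by (rule surj_imp_imT_carrier[OF surj])
  then show "vectorspace.dim K W + vectorspace.dim K (V\<lparr>carrier := {v \<in> carrier V. T v = \<zero>\<^bsub>W\<^esub>}\<rparr>)
      = vectorspace.dim K V"
    using rank_nullity[OF fd] by (simp add: ker_def)
qed

lemma linear_bij_dim:
  assumes T: "linear_map K V W T" and "inj_on T (carrier V)" and surj: "T ` carrier V = carrier W"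
    and fd: "vectorspace.fin_dim K V"
  shows "vectorspace.fin_dim K W" and "vectorspace.dim K W = vectorspace.dim K V"
proof -
  interpret linear_map K V W T by (rule T)
  show "vectorspace.fin_dim K W" by (rule surj_fin_dim[OF fd surj])
  show "vectorspace.dim K W = vectorspace.dim K V" using dim_eq[OF fd assms(2) surj] by simp
qed

lemma direct_sum_simps:
  "carrier (direct_sum V W) = carrier V \<times> carrier W"
  "\<zero>\<^bsub>direct_sum V W\<^esub> = (\<zero>\<^bsub>V\<^esub>, \<zero>\<^bsub>W\<^esub>)"
  "x \<oplus>\<^bsub>direct_sum V W\<^esub> y = (fst x \<oplus>\<^bsub>V\<^esub> fst y, snd x \<oplus>\<^bsub>W\<^esub> snd y)"
  "c \<odot>\<^bsub>direct_sum V W\<^esub> x = (c \<odot>\<^bsub>V\<^esub> fst x, c \<odot>\<^bsub>W\<^esub> snd x)"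
  by (simp_all add: direct_sum_def)

text \<open>Rank-nullity for the first projection.\<close>

lemma direct_sum_dim:
  fixes V :: "('k, 'a) module" and W :: "('k, 'b) module"
  assumes V: "vectorspace K V" and W: "vectorspace K W"
    and fdV: "vectorspace.fin_dim K V" and fdW: "vectorspace.fin_dim K W"
  shows "vectorspace.fin_dim K (direct_sum V W)"
    and "vectorspace.dim K (direct_sum V W) = vectorspace.dim K V + vectorspace.dim K W"
proof -
  interpret V: vectorspace K V by (rule V)
  interpret W: vectorspace K W by (rule W)
  let ?S = "direct_sum V W"
  have vs: "vectorspace K ?S" by (rule direct_sum_is_vs[OF V W])
  interpret S: vectorspace K ?S by (rule vs)
  obtain B where B: "finite B" "B \<subseteq> carrier V" "V.span B = carrier V"
    using fdV by (auto simp: V.fin_dim_def)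
  obtain C where C: "finite C" "C \<subseteq> carrier W" "W.span C = carrier W"
    using fdW by (auto simp: W.fin_dim_def)
  let ?G = "(\<lambda>v. (v, \<zero>\<^bsub>W\<^esub>)) ` B \<union> (\<lambda>w. (\<zero>\<^bsub>V\<^esub>, w)) ` C"
  have G: "?G \<subseteq> carrier ?S" using B C by (auto simp: direct_sum_simps)
  have sub: "submodule K (S.span ?G) ?S" by (rule S.span_is_submodule[OF G])
  have 1: "(v, \<zero>\<^bsub>W\<^esub>) \<in> S.span ?G" if "v \<in> carrier V" for v
  proof -
    have "submodule K {v \<in> carrier V. (v, \<zero>\<^bsub>W\<^esub>) \<in> S.span ?G} V"
      using sub V.module_axioms unfolding submodule_def
      by (auto simp: direct_sum_simps) (metis W.r_zero W.zero_closed fst_conv snd_conv,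
          metis W.smult_r_null fst_conv snd_conv)
    moreover have "B \<subseteq> {v \<in> carrier V. (v, \<zero>\<^bsub>W\<^esub>) \<in> S.span ?G}"
      using B S.in_own_span[OF G] by auto
    ultimately show ?thesis using V.span_is_subset B(3) that by blast
  qed
  have 2: "(\<zero>\<^bsub>V\<^esub>, w) \<in> S.span ?G" if "w \<in> carrier W" for w
  proof -
    have "submodule K {w \<in> carrier W. (\<zero>\<^bsub>V\<^esub>, w) \<in> S.span ?G} W"
      using sub W.module_axioms unfolding submodule_def
      by (auto simp: direct_sum_simps) (metis V.r_zero V.zero_closed fst_conv snd_conv,
          metis V.smult_r_null fst_conv snd_conv)
    moreover have "C \<subseteq> {w \<in> carrier W. (\<zero>\<^bsub>V\<^esub>, w) \<in> S.span ?G}"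
      using C S.in_own_span[OF G] by auto
    ultimately show ?thesis using W.span_is_subset C(3) that by blast
  qed
  have "carrier ?S \<subseteq> S.span ?G"
  proof
    fix x assume "x \<in> carrier ?S"
    then obtain v w where x: "x = (v, w)" "v \<in> carrier V" "w \<in> carrier W"
      by (auto simp: direct_sum_simps)
    then have "x = (v, \<zero>\<^bsub>W\<^esub>) \<oplus>\<^bsub>?S\<^esub> (\<zero>\<^bsub>V\<^esub>, w)" by (simp add: direct_sum_simps)
    then show "x \<in> S.span ?G" using sub 1 2 x unfolding submodule_def by metis
  qed
  then have "S.span ?G = carrier ?S" using S.span_is_subset2[OF G] by blast
  then show fd: "vectorspace.fin_dim K ?S"
    unfolding S.fin_dim_def using G B(1) C(1) by (intro exI[of _ ?G]) auto
  have fst: "linear_map K ?S V fst"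
    by (rule linear_mapI[OF vs V]) (auto simp: direct_sum_simps)
  have "fst ` carrier ?S = carrier V"
    using W.zero_closed by (auto simp: direct_sum_simps image_iff intro!: bexI[of _ "(_, \<zero>\<^bsub>W\<^esub>)"])
  note * = linear_surj_dim(2)[OF fst this fd]
  let ?ker = "?S\<lparr>carrier := {v \<in> carrier ?S. fst v = \<zero>\<^bsub>V\<^esub>}\<rparr>"
  have ker: "vectorspace K ?ker"
    using linear_map.kerT_is_subspace[OF fst] S.subspace_is_vs
    by (simp add: mod_hom.ker_def[OF linear_map.axioms(3)[OF fst]])
  have "linear_map K W ?ker (\<lambda>w. (\<zero>\<^bsub>V\<^esub>, w))"
    by (rule linear_mapI[OF W ker]) (auto simp: direct_sum_simps)
  then have "vectorspace.dim K ?ker = vectorspace.dim K W"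
    by (rule linear_bij_dim(2)) (auto simp: direct_sum_simps inj_on_def fdW)
  with * show "vectorspace.dim K ?S = vectorspace.dim K V + vectorspace.dim K W" by simp
qed

abbreviation "Pol S \<equiv> poly_algebra\<lparr>carrier := S\<rparr>"

lemma Pol_vectorspace:
  assumes "0 \<in> S" "\<And>g h. g \<in> S \<Longrightarrow> h \<in> S \<Longrightarrow> g + h \<in> S" "\<And>c g. g \<in> S \<Longrightarrow> cst c * g \<in> S"
  shows "vectorspace Kc (Pol S)"
proof (rule vectorspaceI, rule module.submodule_is_module[OF poly_algebra_module])
  show "submodule Kc S poly_algebra"
    using assms poly_algebra_module by (auto simp: submodule_def poly_algebra_simps)
qed

lemma supp_in_vectorspace: "vectorspace Kc (Pol (supp_in N))"
  by (rule Pol_vectorspace) (auto simp: supp_in_zero supp_in_add supp_in_smult)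

lemma coef_sum: "coef (\<Sum>k\<in>A. g k) i j = (\<Sum>k\<in>A. coef (g k) i j)"
  by (simp add: Polynomial.coeff_sum)

lemma coef_mon: "coef (mon c k l) i j = (if (i, j) = (k, l) then c else 0)"
  by auto

text \<open>The coordinate space \<open>\<complex>\<^sup>n\<close> is mapped isomorphically by an enumeration \<open>e\<close> of the monomials.\<close>

lemma supp_in_dim:
  assumes N: "finite N"
  shows "vectorspace.fin_dim Kc (Pol (supp_in N))"
    and "vectorspace.dim Kc (Pol (supp_in N)) = card N"
proof -
  let ?n = "card N"
  obtain e where e: "bij_betw e {0..<?n} N"
    using ex_bij_betw_nat_finite[OF N] by blast
  have inj: "e k = e l \<longleftrightarrow> k = l" if "k < ?n" "l < ?n" for k l
    using e that unfolding bij_betw_def inj_on_def by auto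
  have im: "p \<in> N \<longleftrightarrow> (\<exists>k<?n. p = e k)" for p
  proof -
    have "p \<in> e ` {0..<?n} \<longleftrightarrow> (\<exists>k<?n. p = e k)" by auto
    then show ?thesis unfolding bij_betw_imp_surj_on[OF e] .
  qed
  let ?V = "module_vec TYPE(complex) ?n"
  define T :: "complex vec \<Rightarrow> bipoly" where
    "T v = (\<Sum>k<?n. mon (v $ k) (fst (e k)) (snd (e k)))" for v
  have coef_T: "coef (T v) i j = (\<Sum>k<?n. if (i, j) = e k then v $ k else 0)" for v i j
    unfolding T_def coef_sum coef_mon by simp
  have coef_T_e: "coef (T v) (fst (e l)) (snd (e l)) = v $ l" if "l < ?n" for v l
  proof -
    have "coef (T v) (fst (e l)) (snd (e l)) = (\<Sum>k<?n. if k = l then v $ k else 0)"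
      unfolding coef_T by (rule sum.cong) (use inj that in auto)
    then show ?thesis using that by simp
  qed
  have coef_T_0: "coef (T v) i j = 0" if "(i, j) \<notin> N" for v i j
    unfolding coef_T using that im by (intro sum.neutral) auto
  have lin: "linear_map Kc ?V (Pol (supp_in N)) T"
  proof (rule linear_mapI[OF vec_vs supp_in_vectorspace])
    show "T ` carrier ?V \<subseteq> carrier (Pol (supp_in N))"
      using coef_T_0 by (auto simp: supp_in_def)
    fix v w c assume "v \<in> carrier ?V"
    then have v: "v \<in> carrier_vec ?n" by (simp add: module_vec_simps)
    show "T (c \<odot>\<^bsub>?V\<^esub> v) = c \<odot>\<^bsub>Pol (supp_in N)\<^esub> T v"
      using v by (intro bipoly_eqI) (simp add: coef_T module_vec_simps poly_algebra_simps sum_distrib_left if_distrib cong: if_cong)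
    assume "w \<in> carrier ?V"
    then have w: "w \<in> carrier_vec ?n" by (simp add: module_vec_simps)
    show "T (v \<oplus>\<^bsub>?V\<^esub> w) = T v \<oplus>\<^bsub>Pol (supp_in N)\<^esub> T w"
    proof (rule bipoly_eqI)
      fix i j
      have "(\<Sum>k<?n. if (i, j) = e k then (v + w) $ k else 0)
          = (\<Sum>k<?n. (if (i, j) = e k then v $ k else 0) + (if (i, j) = e k then w $ k else 0))"
        by (rule sum.cong) (use w in auto)
      then show "coef (T (v \<oplus>\<^bsub>?V\<^esub> w)) i j = coef (T v \<oplus>\<^bsub>Pol (supp_in N)\<^esub> T w) i j"
        by (simp add: coef_T module_vec_simps poly_algebra_simps sum.distrib)
    qed
  qed
  have inj_T: "inj_on T (carrier ?V)"
  proof (rule inj_onI)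
    fix v w assume vw: "v \<in> carrier ?V" "w \<in> carrier ?V" "T v = T w"
    then have "v $ l = w $ l" if "l < ?n" for l using coef_T_e[OF that] by metis
    with vw show "v = w" by (intro eq_vecI) (auto simp: module_vec_simps)
  qed
  have surj: "T ` carrier ?V = carrier (Pol (supp_in N))"
  proof
    show "T ` carrier ?V \<subseteq> carrier (Pol (supp_in N))"
      using coef_T_0 by (auto simp: supp_in_def)
    show "carrier (Pol (supp_in N)) \<subseteq> T ` carrier ?V"
    proof
      fix g assume "g \<in> carrier (Pol (supp_in N))"
      then have g: "coef g i j = 0" if "(i, j) \<notin> N" for i j
        using that by (auto simp: supp_in_def)
      let ?v = "vec ?n (\<lambda>k. coef g (fst (e k)) (snd (e k)))"
      have eq: "T ?v = g"
      proof (rule bipoly_eqI)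
        fix i j
        show "coef (T ?v) i j = coef g i j"
        proof (cases "(i, j) \<in> N")
          case True
          then obtain l where "l < ?n" "(i, j) = e l" using im by blast
          then show ?thesis using coef_T_e[of l ?v] by (metis fst_conv snd_conv index_vec)
        qed (simp add: coef_T_0 g)
      qed
      have "?v \<in> carrier ?V" by (simp add: module_vec_simps)
      with eq[symmetric] show "g \<in> T ` carrier ?V" by (rule image_eqI)
    qed
  qed
  have fd: "vectorspace.fin_dim Kc ?V" and dim: "vectorspace.dim Kc ?V = ?n"
    using vec_space.fin_dim vec_space.dim_is_n by blast+
  show "vectorspace.fin_dim Kc (Pol (supp_in N))" and "vectorspace.dim Kc (Pol (supp_in N)) = card N"
    using linear_bij_dim[OF lin inj_T surj fd] dim by simp_all
qed

lemma split_support: "\<exists>g'. g' \<in> supp_in N \<and> g - g' \<in> supp_in (- N)"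
proof (induction g rule: bipoly_induct)
  case (1 i j c)
  show ?case
  proof (cases "(i, j) \<in> N")
    case True
    then show ?thesis by (intro exI[of _ "mon c i j"]) (simp add: mon_in_supp_in supp_in_zero)
  next
    case False
    then show ?thesis by (intro exI[of _ 0]) (simp add: mon_in_supp_in supp_in_zero)
  qed
next
  case (2 p q)
  then obtain p' q' where "p' \<in> supp_in N" "p - p' \<in> supp_in (- N)" "q' \<in> supp_in N" "q - q' \<in> supp_in (- N)"
    by blast
  then have "p' + q' \<in> supp_in N" "(p - p') + (q - q') \<in> supp_in (- N)"
    by (simp_all add: supp_in_add)
  then show ?case by (intro exI[of _ "p' + q'"]) (simp add: algebra_simps)
qed

lemma supp_in_disjoint: "g \<in> supp_in N \<Longrightarrow> g \<in> supp_in (- N) \<Longrightarrow> g = 0"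
  by (rule bipoly_eqI) (auto simp: supp_in_def)

text \<open>Monomials \<open>x\<^sup>i y\<^sup>j\<close> of degree \<open>m - e\<close>, none if \<open>m < e\<close>. Their number is the coefficient of \<open>t\<^sup>m\<close> in
  \<open>t\<^sup>e / ((1 - t\<^sup>s)(1 - t\<^sup>r))\<close>.\<close>

definition shifted_weight :: "nat \<Rightarrow> nat \<Rightarrow> nat \<Rightarrow> nat \<Rightarrow> (nat \<times> nat) set" where
  "shifted_weight s r e m = {(i, j). s * i + r * j + e = m}"

lemma finite_shifted_weight:
  assumes "s > 0" "r > 0"
  shows "finite (shifted_weight s r e m)"
proof (rule finite_subset)
  have "i \<le> s * i" "j \<le> r * j" for i j using assms by (cases s; cases r; simp)+
  then show "shifted_weight s r e m \<subseteq> {..m} \<times> {..m}"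
    unfolding shifted_weight_def by (auto; metis add_leD1 add_leD2 le_trans order_refl)
qed simp

lemma form_weight_eq: "form_weight s r m = shifted_weight s r (s + r) m"
  by (auto simp: form_weight_def shifted_weight_def)

context one_relator
begin

abbreviation "wt \<equiv> shifted_weight s r"

lemma dx_f_weight: "dx f \<in> supp_in (wt s d)" and dy_f_weight: "dy f \<in> supp_in (wt r d)"
  by (intro supp_in_dx[OF f_weight] supp_in_dy[OF f_weight]; auto simp: shifted_weight_def weight_def)+

lemma wt_mult:
  assumes "u \<in> supp_in (wt (d + e) m)" "v \<in> supp_in (wt b d)"
  shows "u * v \<in> supp_in (wt (e + b) m)"
  by (rule supp_in_mult[OF assms]) (auto simp: shifted_weight_def algebra_simps)

lemma compl_wt_mult:
  assumes "u \<in> supp_in (- wt (d + e) m)" "v \<in> supp_in (wt b d)"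
  shows "u * v \<in> supp_in (- wt (e + b) m)"
  by (rule supp_in_mult[OF assms]) (auto simp: shifted_weight_def algebra_simps)

lemma coprime_partials: "coprime (dx f) (dy f)"
  by (rule partials_coprime[OF sf f_jacobian])

text \<open>The parts of \<open>u\<close> and \<open>v\<close> outside the prescribed degrees contribute to other degrees only, hence
  nothing.\<close>

lemma graded_jacobian:
  "jacobian f \<inter> supp_in (wt (s + r) m)
    = {u * dx f + v * dy f | u v. u \<in> supp_in (wt (d + r) m) \<and> v \<in> supp_in (wt (d + s) m)}"
    (is "?L = ?R")
proof
  show "?R \<subseteq> ?L"
  proof
    fix g assume "g \<in> ?R"
    then obtain u v where g: "g = u * dx f + v * dy f"
      and u: "u \<in> supp_in (wt (d + r) m)" and v: "v \<in> supp_in (wt (d + s) m)" by blast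
    have "u * dx f \<in> supp_in (wt (s + r) m)"
      using wt_mult[OF u dx_f_weight] by (simp add: add.commute)
    moreover have "v * dy f \<in> supp_in (wt (s + r) m)"
      by (rule wt_mult[OF v dy_f_weight])
    ultimately show "g \<in> ?L"
      using jacobianI[of u f v] by (simp add: g supp_in_add)
  qed
  show "?L \<subseteq> ?R"
  proof
    fix g assume g: "g \<in> ?L"
    then obtain u v where uv: "g = u * dx f + v * dy f" by (auto simp: jacobian_def)
    obtain u' where u': "u' \<in> supp_in (wt (d + r) m)" "u - u' \<in> supp_in (- wt (d + r) m)"
      using split_support by blast
    obtain v' where v': "v' \<in> supp_in (wt (d + s) m)" "v - v' \<in> supp_in (- wt (d + s) m)"
      using split_support by blast
    have "(u - u') * dx f \<in> supp_in (- wt (s + r) m)"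
      using compl_wt_mult[OF u'(2) dx_f_weight] by (simp add: add.commute)
    moreover have "(v - v') * dy f \<in> supp_in (- wt (s + r) m)"
      by (rule compl_wt_mult[OF v'(2) dy_f_weight])
    ultimately have "(u - u') * dx f + (v - v') * dy f \<in> supp_in (- wt (s + r) m)"
      by (rule supp_in_add)
    moreover have "u' * dx f \<in> supp_in (wt (s + r) m)"
      using wt_mult[OF u'(1) dx_f_weight] by (simp add: add.commute)
    moreover have "v' * dy f \<in> supp_in (wt (s + r) m)"
      by (rule wt_mult[OF v'(1) dy_f_weight])
    moreover have eq: "(u - u') * dx f + (v - v') * dy f = g - (u' * dx f + v' * dy f)"
      unfolding uv by (simp add: algebra_simps)
    ultimately have "g - (u' * dx f + v' * dy f) = 0"
      using g by (intro supp_in_disjoint[of _ "wt (s + r) m"]) (auto intro: supp_in_diff supp_in_add)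
    then show "g \<in> ?R"
      using u' v' by auto
  qed
qed

text \<open>The component is the image of the pairs \<open>(u, v)\<close> under \<open>u f\<^sub>x + v f\<^sub>y\<close>, and by coprimality the kernel
  consists of the pairs \<open>(w f\<^sub>y, - w f\<^sub>x)\<close>. This parametrizes the kernel injectively if \<open>f\<^sub>x \<noteq> 0\<close>. Otherwise
  \<open>f\<^sub>y\<close> is a unit, which forces \<open>d = r\<close>, and the Jacobian ideal is everything.\<close>

lemma graded_jacobian_dim:
  fixes m :: nat
  assumes sr: "s > 0" "r > 0"
  defines "J \<equiv> Pol (jacobian f \<inter> supp_in (wt (s + r) m))"
  shows "vectorspace.dim Kc J + card (wt (2 * d) m) = card (wt (d + r) m) + card (wt (d + s) m)"
proof (cases "dx f = 0")
  case True
  then have "dy f dvd 1" using coprime_partials by simp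
  then obtain k where k: "1 = dy f * k" ..
  have "g = 0 * dx f + (g * k) * dy f" for g
    by (metis add_0 k mult.assoc mult.commute mult_1_right mult_zero_left)
  then have "jacobian f = UNIV" using jacobianI by (metis UNIV_eq_I)
  moreover have "coef (dy f * k) 0 0 = coef (dy f) 0 0 * coef k 0 0"
    by (simp add: coeff_mult)
  then have "coef (dy f) 0 0 \<noteq> 0" unfolding k[symmetric] by auto
  then have "(0, 0) \<in> wt r d" using dy_f_weight unfolding supp_in_def by blast
  then have "r = d" by (simp add: shifted_weight_def)
  ultimately show ?thesis
    using supp_in_dim(2)[OF finite_shifted_weight[OF sr]] by (simp add: J_def mult_2 add.commute)
next
  case False
  let ?a = "Pol (supp_in (wt (d + r) m))" and ?b = "Pol (supp_in (wt (d + s) m))"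
  let ?c = "Pol (supp_in (wt (2 * d) m))"
  let ?S = "direct_sum ?a ?b"
  define T where "T x = fst x * dx f + snd x * dy f" for x
  have fin: "finite (wt e m)" for e by (rule finite_shifted_weight[OF sr])
  note ds = direct_sum_dim[OF supp_in_vectorspace supp_in_vectorspace supp_in_dim(1)[OF fin] supp_in_dim(1)[OF fin]]
  have S: "vectorspace Kc ?S" by (intro direct_sum_is_vs supp_in_vectorspace)
  have J: "vectorspace Kc J"
    unfolding J_def
  proof (rule Pol_vectorspace)
    show "cst c * g \<in> jacobian f \<inter> supp_in (wt (s + r) m)"
      if "g \<in> jacobian f \<inter> supp_in (wt (s + r) m)" for c g
      using that jacobian_mult[of g f "cst c"] by (simp add: supp_in_smult)
  qed (auto simp: supp_in_zero jacobian_zero intro: supp_in_add jacobian_add)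
  have surj: "T ` carrier ?S = carrier J"
  proof -
    have "T ` (X \<times> Y) = {u * dx f + v * dy f | u v. u \<in> X \<and> v \<in> Y}" for X Y
    proof (intro equalityI subsetI)
      fix g assume "g \<in> {u * dx f + v * dy f | u v. u \<in> X \<and> v \<in> Y}"
      then obtain u v where "g = T (u, v)" "(u, v) \<in> X \<times> Y" by (auto simp: T_def)
      then show "g \<in> T ` (X \<times> Y)" by (rule image_eqI)
    next
      fix g assume "g \<in> T ` (X \<times> Y)"
      then obtain u v where "g = T (u, v)" "u \<in> X" "v \<in> Y" by (elim imageE SigmaE) simp
      then show "g \<in> {u * dx f + v * dy f | u v. u \<in> X \<and> v \<in> Y}"
        by (intro CollectI exI[of _ u] exI[of _ v]) (simp add: T_def)
    qed
    from this[of "supp_in (wt (d + r) m)" "supp_in (wt (d + s) m)"] show ?thesis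
      unfolding J_def graded_jacobian by (simp add: direct_sum_simps)
  qed
  have lin: "linear_map Kc ?S J T"
  proof (rule linear_mapI[OF S J])
    show "T ` carrier ?S \<subseteq> carrier J" by (simp add: surj)
  qed (simp_all add: T_def direct_sum_simps poly_algebra_simps J_def algebra_simps smult_add_right)
  let ?ker = "?S\<lparr>carrier := {x \<in> carrier ?S. T x = \<zero>\<^bsub>J\<^esub>}\<rparr>"
  have zero: "\<zero>\<^bsub>J\<^esub> = 0" by (simp add: J_def poly_algebra_simps)
  have ker: "vectorspace Kc ?ker"
    using linear_map.kerT_is_subspace[OF lin] vectorspace.subspace_is_vs[OF S]
    by (simp add: mod_hom.ker_def[OF linear_map.axioms(3)[OF lin]])
  let ?U = "\<lambda>w. (w * dy f, - w * dx f)"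
  have U_in: "?U w \<in> carrier ?ker" if w: "w \<in> supp_in (wt (2 * d) m)" for w
  proof -
    have "w * dy f \<in> supp_in (wt (d + r) m)"
      by (rule wt_mult[OF w[unfolded mult_2] dy_f_weight])
    moreover have "w * dx f \<in> supp_in (wt (d + s) m)"
      by (rule wt_mult[OF w[unfolded mult_2] dx_f_weight])
    then have "- w * dx f \<in> supp_in (wt (d + s) m)"
      using supp_in_diff[OF supp_in_zero] by fastforce
    ultimately show ?thesis
      by (simp add: direct_sum_simps T_def zero)
  qed
  have lin_U: "linear_map Kc ?c ?ker ?U"
  proof (rule linear_mapI[OF supp_in_vectorspace ker])
    show "?U ` carrier ?c \<subseteq> carrier ?ker" using U_in by auto
  qed (simp_all add: direct_sum_simps poly_algebra_simps algebra_simps)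
  have inj_U: "inj_on ?U (carrier ?c)"
    using False by (auto intro: inj_onI)
  have surj_U: "?U ` carrier ?c = carrier ?ker"
  proof
    show "?U ` carrier ?c \<subseteq> carrier ?ker" using U_in by auto
    show "carrier ?ker \<subseteq> ?U ` carrier ?c"
    proof
      fix x assume x: "x \<in> carrier ?ker"
      then obtain u v where uv: "x = (u, v)" "v \<in> supp_in (wt (d + s) m)" "u * dx f + v * dy f = 0"
        by (auto simp: direct_sum_simps T_def zero)
      obtain w where w: "u = w * dy f" "v = - w * dx f"
        using partials_syzygy[OF coprime_partials False uv(3)] by blast
      obtain w' where w': "w' \<in> supp_in (wt (2 * d) m)" "w - w' \<in> supp_in (- wt (2 * d) m)"
        using split_support by blast
      have 1: "(w - w') * dx f \<in> supp_in (- wt (d + s) m)"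
        by (rule compl_wt_mult[OF w'(2)[unfolded mult_2] dx_f_weight])
      have 2: "w' * dx f \<in> supp_in (wt (d + s) m)"
        by (rule wt_mult[OF w'(1)[unfolded mult_2] dx_f_weight])
      have "(w - w') * dx f = 0 - v - w' * dx f"
        unfolding w by (simp add: algebra_simps)
      then have "(w - w') * dx f \<in> supp_in (wt (d + s) m)"
        using supp_in_diff[OF supp_in_diff[OF supp_in_zero uv(2)] 2] by simp
      then have "(w - w') * dx f = 0" using 1 by (rule supp_in_disjoint)
      then have "w = w'" using False by simp
      then show "x \<in> ?U ` carrier ?c" using w' w uv by auto
    qed
  qed
  have "vectorspace.dim Kc ?ker = card (wt (2 * d) m)"
    unfolding linear_bij_dim(2)[OF lin_U inj_U surj_U supp_in_dim(1)[OF fin]]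
    by (rule supp_in_dim(2)[OF fin])
  then show ?thesis
    using linear_surj_dim(2)[OF lin surj ds(1)] unfolding ds(2) supp_in_dim(2)[OF fin] by simp
qed

lemma B2_component_dim:
  fixes m :: nat
  assumes sr: "s > 0" "r > 0"
  defines "B \<equiv> B2\<lparr>carrier := B_grading Kc A gA 2 m\<rparr>"
  shows "vectorspace.fin_dim Kc B"
    and "vectorspace.dim Kc B + card (wt (d + r) m) + card (wt (d + s) m)
      = card (wt (s + r) m) + card (wt (2 * d) m)"
proof -
  let ?V = "Pol (supp_in (wt (s + r) m))"
  have fin: "finite (wt e m)" for e by (rule finite_shifted_weight[OF sr])
  interpret V: vectorspace Kc ?V by (rule supp_in_vectorspace)
  have surj: "bracket_of_form ` carrier ?V = carrier B"
    by (simp add: B_def B2_grading form_weight_eq)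
  have B: "vectorspace Kc B"
  proof (rule vectorspaceI, rule module_surj_image[OF V.module_axioms surj])
  qed (simp_all add: B_def poly_algebra_simps bracket_of_form_add bracket_of_form_smult[simplified]
      bracket_of_form_zero)
  have lin: "linear_map Kc ?V B bracket_of_form"
  proof (rule linear_mapI[OF supp_in_vectorspace B])
    show "bracket_of_form ` carrier ?V \<subseteq> carrier B" using surj by simp
  qed (simp_all add: B_def poly_algebra_simps bracket_of_form_add bracket_of_form_smult[simplified])
  have fd: "vectorspace.fin_dim Kc ?V" by (rule supp_in_dim(1)[OF fin])
  show "vectorspace.fin_dim Kc B" by (rule linear_surj_dim(1)[OF lin surj fd])
  have "bracket_of_form g = \<zero>\<^bsub>B\<^esub> \<longleftrightarrow> g \<in> jacobian f" for g
    using bracket_of_form_eq_iff[of g 0] by (simp add: B_def bracket_of_form_zero)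
  then have "{g \<in> carrier ?V. bracket_of_form g = \<zero>\<^bsub>B\<^esub>} = jacobian f \<inter> supp_in (wt (s + r) m)"
    by auto
  then have "vectorspace.dim Kc B + vectorspace.dim Kc (Pol (jacobian f \<inter> supp_in (wt (s + r) m)))
      = card (wt (s + r) m)"
    using linear_surj_dim(2)[OF lin surj fd] by (simp add: supp_in_dim(2)[OF fin])
  then show "vectorspace.dim Kc B + card (wt (d + r) m) + card (wt (d + s) m)
      = card (wt (s + r) m) + card (wt (2 * d) m)"
    using graded_jacobian_dim[OF sr, of m] by linarith
qed

end

section \<open>The Hilbert series\<close>

definition multiples_fps :: "nat \<Rightarrow> rat fps" where
  "multiples_fps k = Abs_fps (\<lambda>n. if k dvd n then 1 else 0)"

lemma multiples_fps_inverse: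
  assumes "k > 0"
  shows "(1 - fps_X ^ k) * multiples_fps k = 1"
proof (rule fps_ext)
  fix n
  show "fps_nth ((1 - fps_X ^ k) * multiples_fps k) n = fps_nth 1 n"
  proof (cases "n < k")
    case True
    then have "k dvd n \<longleftrightarrow> n = 0" using nat_dvd_not_less by blast
    with True show ?thesis
      by (simp add: left_diff_distrib fps_X_power_mult_nth multiples_fps_def)
  next
    case False
    then show ?thesis using assms
      by (simp add: left_diff_distrib fps_X_power_mult_nth multiples_fps_def dvd_minus_self)
  qed
qed

lemma monomials_fps:
  assumes sr: "s > 0" "r > 0"
  shows "Abs_fps (\<lambda>m. of_nat (card (shifted_weight s r e m)))
    = fps_X ^ e * (multiples_fps s * multiples_fps r)"
proof (rule fps_ext)
  fix m
  have *: "fps_nth (multiples_fps s * multiples_fps r) n = of_nat (card (shifted_weight s r 0 n))" for n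
  proof -
    have "fps_nth (multiples_fps s * multiples_fps r) n
        = (\<Sum>k\<in>{0..n}. if s dvd k \<and> r dvd n - k then 1 else 0)"
      unfolding fps_mult_nth by (rule sum.cong) (auto simp: multiples_fps_def)
    also have "\<dots> = of_nat (card {k \<in> {0..n}. s dvd k \<and> r dvd n - k})"
      by (simp add: sum.If_cases Int_def)
    also have "card {k \<in> {0..n}. s dvd k \<and> r dvd n - k} = card (shifted_weight s r 0 n)"
    proof (rule bij_betw_same_card[symmetric], rule bij_betw_imageI)
      show "inj_on (\<lambda>(i, j). s * i) (shifted_weight s r 0 n)"
        using sr by (auto simp: inj_on_def shifted_weight_def)
      show "(\<lambda>(i, j). s * i) ` shifted_weight s r 0 n = {k \<in> {0..n}. s dvd k \<and> r dvd n - k}"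
      proof
        show "(\<lambda>(i, j). s * i) ` shifted_weight s r 0 n \<subseteq> {k \<in> {0..n}. s dvd k \<and> r dvd n - k}"
          by (auto simp: shifted_weight_def)
        show "{k \<in> {0..n}. s dvd k \<and> r dvd n - k} \<subseteq> (\<lambda>(i, j). s * i) ` shifted_weight s r 0 n"
        proof
          fix k assume "k \<in> {k \<in> {0..n}. s dvd k \<and> r dvd n - k}"
          then obtain i j where "k \<le> n" "k = s * i" "n - k = r * j" by (auto elim!: dvdE)
          then have "k = (\<lambda>(i, j). s * i) (i, j)" "(i, j) \<in> shifted_weight s r 0 n"
            by (auto simp: shifted_weight_def)
          then show "k \<in> (\<lambda>(i, j). s * i) ` shifted_weight s r 0 n" by (rule image_eqI)
        qed
      qed
    qed
    finally show ?thesis .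
  qed
  show "fps_nth (Abs_fps (\<lambda>m. of_nat (card (shifted_weight s r e m)))) m
      = fps_nth (fps_X ^ e * (multiples_fps s * multiples_fps r)) m"
  proof (cases "m < e")
    case True
    then have "shifted_weight s r e m = {}" by (auto simp: shifted_weight_def)
    with True show ?thesis by (simp add: fps_X_power_mult_nth)
  next
    case False
    then have "shifted_weight s r e m = shifted_weight s r 0 (m - e)"
      by (auto simp: shifted_weight_def)
    with False show ?thesis by (simp add: fps_X_power_mult_nth *)
  qed
qed

lemma (in one_relator) B2_hilbert_series:
  assumes sr: "s > 0" "r > 0"
  shows "hilbert_series Kc B2 (B_grading Kc A gA 2)
    = (fps_X ^ s - fps_X ^ d) * (fps_X ^ r - fps_X ^ d) / ((1 - fps_X ^ s) * (1 - fps_X ^ r))"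
proof -
  let ?H = "multiples_fps s * multiples_fps r"
  let ?h = "\<lambda>e. Abs_fps (\<lambda>m. of_nat (card (wt e m))) :: rat fps"
  let ?D = "(1 - fps_X ^ s) * (1 - fps_X ^ r) :: rat fps"
  have "hilbert_series Kc B2 (B_grading Kc A gA 2) + ?h (d + r) + ?h (d + s) = ?h (s + r) + ?h (2 * d)"
    using B2_component_dim(2)[OF sr]
    by (intro fps_ext) (simp add: hilbert_series_def flip: of_nat_add)
  then have "hilbert_series Kc B2 (B_grading Kc A gA 2) = ?h (s + r) + ?h (2 * d) - ?h (d + r) - ?h (d + s)"
    by (simp add: algebra_simps)
  also have "\<dots> = (fps_X ^ s - fps_X ^ d) * (fps_X ^ r - fps_X ^ d) * ?H"
    unfolding monomials_fps[OF sr] by (simp add: algebra_simps power_add mult_2 mult_2_right)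
  finally have "hilbert_series Kc B2 (B_grading Kc A gA 2) * ?D
      = (fps_X ^ s - fps_X ^ d) * (fps_X ^ r - fps_X ^ d)
        * (((1 - fps_X ^ s) * multiples_fps s) * ((1 - fps_X ^ r) * multiples_fps r))"
    by (simp only: mult_ac)
  then have "hilbert_series Kc B2 (B_grading Kc A gA 2) * ?D = (fps_X ^ s - fps_X ^ d) * (fps_X ^ r - fps_X ^ d)"
    unfolding multiples_fps_inverse[OF sr(1)] multiples_fps_inverse[OF sr(2)] by simp
  moreover have "?D \<noteq> 0"
    using multiples_fps_inverse[OF sr(1)] multiples_fps_inverse[OF sr(2)] by auto
  ultimately show ?thesis
    by (metis nonzero_mult_div_cancel_right)
qed

theorem theorem1:
  fixes s r d :: nat and P :: "word \<Rightarrow>\<^sub>0 complex"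
  assumes "s > 0" and "r > 0" and "coprime s r" and "d \<ge> 1"
    and "P \<in> free_grading s r d"
    and "squarefree (poly_of_free P)"
  shows
    "let K = (class_ring :: complex ring);
         A = one_relator_algebra P;
         gA = one_relator_grading s r P;
         Aab = abelianization A;
         gAab = abelianization_grading A gA;
         B2 = B_space K A 2;
         gB2 = B_grading K A gA 2
     in (\<exists>f. graded_linear_iso K B2 gB2 (Omega2 K Aab) (Omega2_grading K Aab gAab) f) \<and>
        (\<exists>g \<in> ring_iso Aab (plane_curve_algebra (poly_of_free P)).
            graded_linear_iso K Aab gAab
              (plane_curve_algebra (poly_of_free P)) (plane_curve_grading s r (poly_of_free P)) g) \<and>
        (\<forall>m. vectorspace.fin_dim K (B2\<lparr>carrier := gB2 m\<rparr>)) \<and>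
        hilbert_series K B2 gB2 =
          (fps_X ^ s - fps_X ^ d) * (fps_X ^ r - fps_X ^ d) / ((1 - fps_X ^ s) * (1 - fps_X ^ r))"
proof -
  interpret one_relator s r d P
    by (rule one_relator.intro) (rule assms)+
  show ?thesis
    unfolding Let_def
    using B2_iso_Omega2 abelianization_iso B2_component_dim(1)[OF assms(1,2)]
      B2_hilbert_series[OF assms(1,2)]
    by (intro conjI allI)
qed

end
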